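(* Let $I=[a,b]\subset\mathbb R$ be a closed bounded interval and let $w:I\times I\to\mathbb R\cup\{+\infty\}$ be a continuous symmetric function such that $F_{\rm OT}(\rho)<\infty$ for every $n\in\mathbb N$ and every non-atomic $\rho\in\mathcal P(I)$. Then the following are equivalent: (a) for every $n\in\mathbb N$ and every non-atomic $\rho\in\mathcal P(I)$, the Seidl plan $\gamma_\rho$ is a minimizer of $F_{\rm OT}(\rho)$; (b) $w$ is well-ordering on $I$. Moreover, if $w$ is strictly well-ordering, then for every $n$ and every non-atomic $\rho\in\mathcal P(I)$ the symmetrization $\frac{1}{n!}\sum_{\sigma\in S_n}\sigma^\#\gamma_\rho$ of $\gamma_\rho$ is the unique minimizer of $F_{\rm OT}(\rho)$ among symmetric (i.e. invariant under permutation of coordinates) measures in $\Pi(\rho)$.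
   Context: For $n\in\mathbb N$ and $x=(x_1,\dots,x_n)\in I^n$ let $c_n(x)=\sum_{i\neq j}w(x_i,x_j)$, the sum over ordered pairs of distinct indices. For $\rho\in\mathcal P(I)$, $\Pi(\rho)$ denotes the set of Borel probability measures on $I^n$ each of whose $n$ one-dimensional marginals equals $\rho$, and $F_{\rm OT}(\rho)=\min\{\int_{I^n}c_n\,d\gamma:\gamma\in\Pi(\rho)\}$ ($n$-marginal optimal transport problem). Well-ordering: a continuous symmetric $w:J\times J\to\mathbb R\cup\{+\infty\}$ is well-ordering on $J\subset\mathbb R$ if for all $x_1\le x_2\le x_3\le x_4$ in $J$, $w(x_1,x_3)+w(x_2,x_4)=\min\{w(x_{\sigma(1)},x_{\sigma(2)})+w(x_{\sigma(3)},x_{\sigma(4)}):\sigma\text{ a permutation of }\{1,2,3,4\}\}$. It is strictly well-ordering if in addition, for such $x_1\le\dots\le x_4$ and a permutation $\sigma$, the equality $w(x_1,x_3)+w(x_2,x_4)=w(x_{\sigma(1)},x_{\sigma(2)})+w(x_{\sigma(3)},x_{\sigma(4)})$ holds only if either $w(x_1,x_3)+w(x_2,x_4)=\infty$, or $\delta_{x_1}+\delta_{x_3}=\delta_{x_{\sigma(1)}}+\delta_{x_{\sigma(2)}}$, or $\delta_{x_1}+\delta_{x_3}=\delta_{x_{\sigma(3)}}+\delta_{x_{\sigma(4)}}$. Seidl plan: for non-atomic $\rho\in\mathcal P([a,b])$, choose $a=d_0<d_1<\dots<d_n=b$ with $\rho([d_i,d_{i+1}])=1/n$ for $i=0,\dots,n-1$;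 let $T:I\to I$ be the ($\rho$-a.e. unique) map which is increasing on each $(d_i,d_{i+1})$ and satisfies $T^\#(\mathbb 1_{[d_i,d_{i+1}]}\rho)=\mathbb 1_{[d_{i+1},d_{i+2}]}\rho$ for $i=0,\dots,n-2$ and $T^\#(\mathbb 1_{[d_{n-1},d_n]}\rho)=\mathbb 1_{[d_0,d_1]}\rho$. Then $\gamma_\rho=(\mathrm{id},T,T^{(2)},\dots,T^{(n-1)})^\#\rho\in\Pi(\rho)$, where $T^{(k)}$ is the $k$-fold composition of $T$. *)

theory Defs
  imports "HOL-Probability.Probability" "HOL-Library.Multiset"
begin

text \<open>Borel sigma-algebra on R^n, points x = (x_0,...,x_{n-1}) as extensional functions on {..<n}.\<close>
abbreviation Rn :: "nat \<Rightarrow> (nat \<Rightarrow> real) measure" where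
  "Rn n \<equiv> PiM {..<n} (\<lambda>_. borel)"

definition nonatomic_prob :: "real \<Rightarrow> real \<Rightarrow> real measure \<Rightarrow> bool" where
  "nonatomic_prob a b \<rho> \<longleftrightarrow> prob_space \<rho> \<and> sets \<rho> = sets borel \<and>
     emeasure \<rho> {a..b} = 1 \<and> (\<forall>x. emeasure \<rho> {x} = 0)"

definition cost_n :: "nat \<Rightarrow> (real \<Rightarrow> real \<Rightarrow> ereal) \<Rightarrow> (nat \<Rightarrow> real) \<Rightarrow> ereal" where
  "cost_n n w x = (\<Sum>i\<in>{..<n}. \<Sum>j\<in>{..<n} - {i}. w (x i) (x j))"

definition ereal_integral :: "'a measure \<Rightarrow> ('a \<Rightarrow> ereal) \<Rightarrow> ereal" where
  "ereal_integral M f = enn2ereal (\<integral>\<^sup>+ x. e2ennreal (f x) \<partial>M) - enn2ereal (\<integral>\<^sup>+ x. e2ennreal (- f x) \<partial>M)"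

definition ot_cost :: "nat \<Rightarrow> (real \<Rightarrow> real \<Rightarrow> ereal) \<Rightarrow> (nat \<Rightarrow> real) measure \<Rightarrow> ereal" where
  "ot_cost n w \<gamma> = ereal_integral \<gamma> (cost_n n w)"

definition couplings :: "nat \<Rightarrow> real measure \<Rightarrow> (nat \<Rightarrow> real) measure set" where
  "couplings n \<rho> = {\<gamma>. prob_space \<gamma> \<and> sets \<gamma> = sets (Rn n) \<and>
      (\<forall>i<n. distr \<gamma> borel (\<lambda>x. x i) = \<rho>)}"

definition F_OT :: "nat \<Rightarrow> (real \<Rightarrow> real \<Rightarrow> ereal) \<Rightarrow> real measure \<Rightarrow> ereal" where
  "F_OT n w \<rho> = (INF \<gamma>\<in>couplings n \<rho>. ot_cost n w \<gamma>)"

definition is_OT_minimizer :: "nat \<Rightarrow> (real \<Rightarrow> real \<Rightarrow> ereal) \<Rightarrow> real measure \<Rightarrow> (nat \<Rightarrow> real) measure \<Rightarrow> bool" where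
  "is_OT_minimizer n w \<rho> \<gamma> \<longleftrightarrow> \<gamma> \<in> couplings n \<rho> \<and> ot_cost n w \<gamma> = F_OT n w \<rho>"

definition well_ordering :: "real set \<Rightarrow> (real \<Rightarrow> real \<Rightarrow> ereal) \<Rightarrow> bool" where
  "well_ordering J w \<longleftrightarrow>
     continuous_on (J \<times> J) (\<lambda>(x, y). w x y) \<and> (\<forall>x\<in>J. \<forall>y\<in>J. w x y = w y x) \<and>
     (\<forall>x1\<in>J. \<forall>x2\<in>J. \<forall>x3\<in>J. \<forall>x4\<in>J. x1 \<le> x2 \<and> x2 \<le> x3 \<and> x3 \<le> x4 \<longrightarrow>
        (let x = (\<lambda>k::nat. [x1, x2, x3, x4] ! k) in
         w x1 x3 + w x2 x4 =
           Min ((\<lambda>\<sigma>. w (x (\<sigma> 0)) (x (\<sigma> 1)) + w (x (\<sigma> 2)) (x (\<sigma> 3))) `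
                {\<sigma>. \<sigma> permutes {..<4::nat}})))"

definition strictly_well_ordering :: "real set \<Rightarrow> (real \<Rightarrow> real \<Rightarrow> ereal) \<Rightarrow> bool" where
  "strictly_well_ordering J w \<longleftrightarrow> well_ordering J w \<and>
     (\<forall>x1\<in>J. \<forall>x2\<in>J. \<forall>x3\<in>J. \<forall>x4\<in>J. x1 \<le> x2 \<and> x2 \<le> x3 \<and> x3 \<le> x4 \<longrightarrow>
        (let x = (\<lambda>k::nat. [x1, x2, x3, x4] ! k) in
         \<forall>\<sigma>. \<sigma> permutes {..<4::nat} \<longrightarrow>
           w x1 x3 + w x2 x4 = w (x (\<sigma> 0)) (x (\<sigma> 1)) + w (x (\<sigma> 2)) (x (\<sigma> 3)) \<longrightarrow>
           (w x1 x3 + w x2 x4 = \<infinity> \<or>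
            {#x1, x3#} = {#x (\<sigma> 0), x (\<sigma> 1)#} \<or>
            {#x1, x3#} = {#x (\<sigma> 2), x (\<sigma> 3)#})))"

definition seidl_plan :: "real \<Rightarrow> real \<Rightarrow> nat \<Rightarrow> real measure \<Rightarrow> (nat \<Rightarrow> real) measure \<Rightarrow> bool" where
  "seidl_plan a b n \<rho> \<gamma> \<longleftrightarrow>
     (\<exists>(d :: nat \<Rightarrow> real) (T :: real \<Rightarrow> real).
        d 0 = a \<and> d n = b \<and> (\<forall>i<n. d i < d (Suc i)) \<and>
        (\<forall>i<n. emeasure \<rho> {d i..d (Suc i)} = ennreal (1 / real n)) \<and>
        T \<in> borel_measurable borel \<and> T ` {a..b} \<subseteq> {a..b} \<and>
        (\<forall>i<n. mono_on {d i<..<d (Suc i)} T) \<and>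
        (\<forall>i. i + 2 \<le> n \<longrightarrow>
           distr (density \<rho> (indicator {d i..d (Suc i)})) borel T
             = density \<rho> (indicator {d (Suc i)..d (Suc (Suc i))})) \<and>
        distr (density \<rho> (indicator {d (n - 1)..d n})) borel T
             = density \<rho> (indicator {d 0..d 1}) \<and>
        \<gamma> = distr \<rho> (Rn n) (\<lambda>x. \<lambda>i\<in>{..<n}. (T ^^ i) x))"

definition perm_coords :: "nat \<Rightarrow> (nat \<Rightarrow> nat) \<Rightarrow> (nat \<Rightarrow> real) \<Rightarrow> (nat \<Rightarrow> real)" where
  "perm_coords n \<sigma> x = (\<lambda>i\<in>{..<n}. x (\<sigma> i))"

definition symmetric_measure :: "nat \<Rightarrow> (nat \<Rightarrow> real) measure \<Rightarrow> bool" where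
  "symmetric_measure n \<gamma> \<longleftrightarrow>
     (\<forall>\<sigma>. \<sigma> permutes {..<n} \<longrightarrow> distr \<gamma> (Rn n) (perm_coords n \<sigma>) = \<gamma>)"

definition symmetrization :: "nat \<Rightarrow> (nat \<Rightarrow> real) measure \<Rightarrow> (nat \<Rightarrow> real) measure" where
  "symmetrization n \<gamma> = measure_of (space (Rn n)) (sets (Rn n))
     (\<lambda>A. (\<Sum>\<sigma>\<in>{\<sigma>. \<sigma> permutes {..<n}}. emeasure (distr \<gamma> (Rn n) (perm_coords n \<sigma>)) A)
          / of_nat (fact n))"

end

theory Submission
  imports Defs
begin

text \<open>
  \<^bold>\<open>Sufficiency.\<close> For \<open>a \<le> x \<le> y \<le> b\<close> write \<open>w x y = w x b + w a y - w a b + M x y\<close>. One well-ordering inequality says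
  that \<open>M\<close> has nonnegative mixed differences, so \<open>M\<close> is a limit of nonnegative combinations of products
  \<open>1\<^sub>J(x) 1\<^sub>J(y)\<close> of indicators of intervals \<open>J\<close>; the other one says that \<open>D x = w x b - w a x\<close> increases, and
  \<open>w x b + w a y\<close> is, up to terms depending on one point only, \<open>- |D x - D y| / 2\<close>. The total cost of \<open>n\<close> points is thus
  bounded below through the counts \<open>N\<^sub>J\<close> of points in \<open>J\<close>, by \<open>(N - k) (N - k - 1) \<ge> 0\<close> for integers, and through an
  energy inequality for the values of \<open>D\<close>. Both bounds are sums of functions of one point, and both are equalities on the
  Seidl orbits, whose points are equispaced for \<open>n F\<close>, where \<open>F\<close> is the distribution function of \<open>\<rho>\<close>. The value
  \<open>w a b\<close> may be infinite; the cost is first cut off near the corner \<open>(a, b)\<close>.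

  \<^bold>\<open>Uniqueness.\<close> If \<open>w\<close> is strictly well-ordering, all mixed differences are positive, so a minimizer can put no
  mass on configurations with too many points in some \<open>J\<close>. A Chebyshev-type sum with vanishing mean then forces
  equispacing, that is, almost every configuration is a permuted Seidl orbit.

  \<^bold>\<open>Necessity.\<close> For \<open>n = 2\<close> and \<open>\<rho>\<close> uniform on four short intervals at \<open>x0 < x1 < x2 < x3\<close>, the Seidl plan pairs
  \<open>x0\<close> with \<open>x2\<close> and \<open>x1\<close> with \<open>x3\<close>; comparing it with the two other pairings gives the well-ordering inequalities.
\<close>

section \<open>Fatou and energy inequalities\<close>

text \<open>The obstacle is that \<open>w\<close> may be infinite on the diagonal, while finiteness
  elsewhere is hidden in the hypothesis on \<open>F_OT\<close>. If \<open>w c\<close> were infinite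
  on a whole interval containing \<open>c\<close>, a measure that accumulates at \<open>c\<close>
  geometrically would have infinite cost for \<open>n = 2\<close>; one well-ordering inequality then
  makes \<open>w x y\<close> finite for all \<open>x < y\<close> except possibly at the corner. Near
  the diagonal \<open>M\<close> can still be unbounded, so it is only approached from below, by step
  functions built from cells that stay away from the diagonal. For a competitor the inequality
  suffices; for the Seidl orbits the bound is carried over by Fatou's lemma, once for the refinement
  of the grid and once for the removal of the cutoff. The loss \<open>(N - k) (N - k - 1)\<close> is
  not discarded on the way: on the event that some interval is clearly overfull it stays in the
  estimate as an explicit term. One estimate thus yields both the optimality and the null events on
  which uniqueness rests. The energy part contributes nothing to uniqueness; only the mixed
  differences are used there.\<close>

lemma integral_le_of_AE_limit:
  fixes f :: "nat \<Rightarrow> 'a \<Rightarrow> real"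
  assumes "finite_measure M"
    and f: "\<And>k. integrable M (f k)" and g: "g \<in> borel_measurable M"
    and lb: "\<And>k. AE x in M. - C \<le> f k x"
    and lim: "AE x in M. (\<lambda>k. f k x) \<longlonglongrightarrow> g x"
    and ub: "eventually (\<lambda>k. integral\<^sup>L M (f k) \<le> X) sequentially"
  shows "integrable M g \<and> integral\<^sup>L M g \<le> X"
proof -
  interpret finite_measure M by fact
  have lbA: "AE x in M. \<forall>k. - C \<le> f k x" using lb by (simp add: AE_all_countable)
  have g_lb: "AE x in M. - C \<le> g x"
    using lbA lim by eventually_elim (auto intro: LIMSEQ_le_const)
  \<comment> \<open>A single \<open>k\<close> obeying the bound already shows that
    \<open>X + C * m\<close> is nonnegative, which the return from \<open>ennreal\<close> to reals
    at the end requires.\<close>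
  obtain k0 where k0: "integral\<^sup>L M (f k0) \<le> X"
    using eventually_happens'[OF sequentially_bot ub] by blast
  define m where "m = measure M (space M)"
  \<comment> \<open>Adding \<open>C\<close> makes all functions nonnegative, so that Fatou's lemma
    for \<open>nn_integral\<close> applies.\<close>
  have fk: "(\<integral>\<^sup>+x. ennreal (f k x + C) \<partial>M) = ennreal (integral\<^sup>L M (f k) + C * m)" for k
  proof -
    have "(\<integral>\<^sup>+x. ennreal (f k x + C) \<partial>M) = ennreal (integral\<^sup>L M (\<lambda>x. f k x + C))"
      using f lb[of k] by (intro nn_integral_eq_integral) auto
    then show ?thesis using f by (simp add: m_def mult.commute)
  qed
  have nonneg: "0 \<le> integral\<^sup>L M (f k) + C * m" for k
  proof -
    have "0 \<le> integral\<^sup>L M (\<lambda>x. f k x + C)"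
      using lb[of k] by (intro integral_nonneg_AE) auto
    then show ?thesis using f by (simp add: m_def mult.commute)
  qed
  have "(\<integral>\<^sup>+x. ennreal (g x + C) \<partial>M) = (\<integral>\<^sup>+x. liminf (\<lambda>k. ennreal (f k x + C)) \<partial>M)"
  proof (rule nn_integral_cong_AE)
    show "AE x in M. ennreal (g x + C) = liminf (\<lambda>k. ennreal (f k x + C))"
      using lim
    proof eventually_elim
      case (elim x)
      then have "(\<lambda>k. ennreal (f k x + C)) \<longlonglongrightarrow> ennreal (g x + C)"
        by (intro tendsto_intros)
      then show ?case by (simp add: lim_imp_Liminf)
    qed
  qed
  also have "\<dots> \<le> liminf (\<lambda>k. \<integral>\<^sup>+x. ennreal (f k x + C) \<partial>M)"
    using f by (intro nn_integral_liminf) auto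
  also have "\<dots> \<le> ennreal (X + C * m)"
  proof -
    have "eventually (\<lambda>k. (\<integral>\<^sup>+x. ennreal (f k x + C) \<partial>M) \<le> ennreal (X + C * m)) sequentially"
      using ub by eventually_elim (auto simp: fk intro!: ennreal_leI)
    then show ?thesis
      by (intro Liminf_le) auto
  qed
  finally have fin: "(\<integral>\<^sup>+x. ennreal (g x + C) \<partial>M) \<le> ennreal (X + C * m)" .
  have gC: "integrable M (\<lambda>x. g x + C)"
  proof (rule integrableI_nonneg)
    show "(\<lambda>x. g x + C) \<in> borel_measurable M" using g by simp
    show "AE x in M. 0 \<le> g x + C" using g_lb by eventually_elim auto
    show "(\<integral>\<^sup>+x. ennreal (g x + C) \<partial>M) < \<infinity>" using fin by (simp add: order_le_less_trans)
  qed
  have gi: "integrable M g"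
    using Bochner_Integration.integrable_diff[OF gC, of "\<lambda>_. C"] by simp
  have "ennreal (integral\<^sup>L M (\<lambda>x. g x + C)) \<le> ennreal (X + C * m)"
    using fin gC g_lb by (subst nn_integral_eq_integral[symmetric]) auto
  then have "integral\<^sup>L M (\<lambda>x. g x + C) \<le> X + C * m"
    using nonneg[of k0] k0 by (subst (asm) ennreal_le_iff) auto
  then show ?thesis using gi by (simp add: m_def mult.commute)
qed

text \<open>The common part has length \<open>R - max x y\<close>, and \<open>max x y\<close> is
  half of \<open>x + y + \<bar>x - y\<bar>\<close>. In this way distances become correlations of
  counting functions.\<close>

lemma integral_indicator_atLeast_mult:
  fixes x y R :: real
  assumes "x \<le> R" "y \<le> R"
  shows "integrable lborel (\<lambda>s. indicator {x..R} s * indicator {y..R} s :: real)"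
    and "(\<integral>s. indicator {x..R} s * indicator {y..R} s \<partial>lborel) = R - (x + y + \<bar>x - y\<bar>) / 2"
proof -
  have eq: "(\<lambda>s. indicator {x..R} s * indicator {y..R} s :: real) = indicator {max x y..R}"
    by (auto simp: fun_eq_iff indicator_def)
  show "integrable lborel (\<lambda>s. indicator {x..R} s * indicator {y..R} s :: real)"
    unfolding eq by (intro integrable_real_indicator) (auto simp: emeasure_lborel_Icc_eq)
  show "(\<integral>s. indicator {x..R} s * indicator {y..R} s \<partial>lborel) = R - (x + y + \<bar>x - y\<bar>) / 2"
    unfolding eq using assms by (simp add: max_def field_simps)
qed

text \<open>Energy inequality and equality express that \<open>f (f - 1) \<ge> 0\<close> for the integer-valued function
  \<open>f s = |{i. t i \<le> s}| - |{k. e k \<le> s}|\<close>, which only takes the values 0 and 1 when the points interlace.\<close>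

lemma energy_identity:
  fixes t :: "'i \<Rightarrow> real" and e :: "'k \<Rightarrow> real"
  assumes fin: "finite I" "finite K" and card: "card I = Suc (card K)"
    and R: "\<And>i. i \<in> I \<Longrightarrow> t i \<le> R" "\<And>k. k \<in> K \<Longrightarrow> e k \<le> R"
  defines "f \<equiv> (\<lambda>s. (\<Sum>i\<in>I. indicator {t i..R} s) - (\<Sum>k\<in>K. indicator {e k..R} s) :: real)"
  shows "(\<integral>s. f s * f s - f s \<partial>lborel) =
    (\<Sum>i\<in>I. \<Sum>k\<in>K. \<bar>t i - e k\<bar>) - (\<Sum>i\<in>I. \<Sum>j\<in>I. \<bar>t i - t j\<bar>) / 2 - (\<Sum>k\<in>K. \<Sum>l\<in>K. \<bar>e k - e l\<bar>) / 2"
proof -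
  have sum_d: "(\<Sum>x\<in>X. \<Sum>y\<in>Y. R - (g x + h y + \<bar>g x - h y\<bar>) / 2) =
      real (card X) * real (card Y) * R - (real (card Y) * sum g X + real (card X) * sum h Y) / 2
      - (\<Sum>x\<in>X. \<Sum>y\<in>Y. \<bar>g x - h y\<bar>) / 2" for X :: "'x set" and Y :: "'y set" and g h
    by (simp add: sum.distrib sum_subtractf sum_divide_distrib[symmetric] sum_distrib_left[symmetric]
        add_divide_distrib)
  have one: "integrable lborel (indicator {x..R} :: real \<Rightarrow> real)"
    "x \<le> R \<Longrightarrow> (\<integral>s. indicator {x..R} s \<partial>lborel) = R - x" for x :: real
    by (auto intro!: integrable_real_indicator simp: emeasure_lborel_Icc_eq)
  have tt: "(\<integral>s. (\<Sum>x\<in>X. \<Sum>y\<in>Y. indicator {g x..R} s * indicator {h y..R} s) \<partial>lborel) =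
      (\<Sum>x\<in>X. \<Sum>y\<in>Y. R - (g x + h y + \<bar>g x - h y\<bar>) / 2)"
    "integrable lborel (\<lambda>s. \<Sum>x\<in>X. \<Sum>y\<in>Y. indicator {g x..R} s * indicator {h y..R} s :: real)"
    if "\<And>x. x \<in> X \<Longrightarrow> g x \<le> R" "\<And>y. y \<in> Y \<Longrightarrow> h y \<le> R" for X :: "'x set" and Y :: "'y set" and g h
    using that by (simp_all add: integral_indicator_atLeast_mult)
  have o: "(\<integral>s. (\<Sum>x\<in>X. indicator {g x..R} s) \<partial>lborel) = real (card X) * R - sum g X"
    "integrable lborel (\<lambda>s. \<Sum>x\<in>X. indicator {g x..R} s :: real)"
    if "\<And>x. x \<in> X \<Longrightarrow> g x \<le> R" for X :: "'x set" and g
    using that by (simp_all add: one sum_subtractf)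
  have f2: "f s * f s - f s =
      (\<Sum>i\<in>I. \<Sum>j\<in>I. indicator {t i..R} s * indicator {t j..R} s)
      - 2 * (\<Sum>i\<in>I. \<Sum>k\<in>K. indicator {t i..R} s * indicator {e k..R} s)
      + (\<Sum>k\<in>K. \<Sum>l\<in>K. indicator {e k..R} s * indicator {e l..R} s)
      - (\<Sum>i\<in>I. indicator {t i..R} s) + (\<Sum>k\<in>K. indicator {e k..R} s)" for s
  proof -
    have "(p - q) * (p - q) - (p - q) = p * p - 2 * (p * q) + q * q - p + q" for p q :: real
      by (simp add: algebra_simps)
    then show ?thesis unfolding f_def sum_product[symmetric] .
  qed
  define SI SK where "SI = sum t I" and "SK = sum e K"
  define TT TE EE where "TT = (\<Sum>i\<in>I. \<Sum>j\<in>I. \<bar>t i - t j\<bar>)" and "TE = (\<Sum>i\<in>I. \<Sum>k\<in>K. \<bar>t i - e k\<bar>)"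
    and "EE = (\<Sum>k\<in>K. \<Sum>l\<in>K. \<bar>e k - e l\<bar>)"
  define n where "n = real (card K)"
  have nI: "real (card I) = n + 1" using card by (simp add: n_def)
  have "(\<integral>s. f s * f s - f s \<partial>lborel) =
      (\<Sum>i\<in>I. \<Sum>j\<in>I. R - (t i + t j + \<bar>t i - t j\<bar>) / 2)
      - 2 * (\<Sum>i\<in>I. \<Sum>k\<in>K. R - (t i + e k + \<bar>t i - e k\<bar>) / 2)
      + (\<Sum>k\<in>K. \<Sum>l\<in>K. R - (e k + e l + \<bar>e k - e l\<bar>) / 2)
      - (real (card I) * R - sum t I) + (real (card K) * R - sum e K)"
    unfolding f2 by (simp add: tt o R sum_subtractf del: sum_mult_indicator)
  \<comment> \<open>Because one family has exactly one member more than the other, all terms in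
    \<open>R\<close>, \<open>SI\<close> and \<open>SK\<close> cancel; for \<open>R\<close> the
    factor is \<open>(n + 1 - n)^2 - 1 = 0\<close>.\<close>
  also have "\<dots> = (\<Sum>i\<in>I. \<Sum>k\<in>K. \<bar>t i - e k\<bar>) - (\<Sum>i\<in>I. \<Sum>j\<in>I. \<bar>t i - t j\<bar>) / 2
      - (\<Sum>k\<in>K. \<Sum>l\<in>K. \<bar>e k - e l\<bar>) / 2"
    unfolding sum_d nI n_def[symmetric] SI_def[symmetric] SK_def[symmetric]
      TT_def[symmetric] TE_def[symmetric] EE_def[symmetric] by (simp add: field_simps)
  finally show ?thesis .
qed

lemma card_eq_sum_indicator_atLeast:
  assumes "finite I"
  shows "(\<Sum>i\<in>I. indicator {t i..R} (s::real)) = (of_nat (card {i\<in>I. t i \<le> s \<and> s \<le> R}) :: real)"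
proof -
  have "{i\<in>I. t i \<le> s \<and> s \<le> R} = {i\<in>I. s \<in> {t i..R}}" by auto
  then show ?thesis using assms by (simp add: indicator_def sum.If_cases Int_def conj_commute)
qed

lemma energy_inequality:
  fixes t :: "'i \<Rightarrow> real" and e :: "'k \<Rightarrow> real"
  assumes fin: "finite I" "finite K" and card: "card I = Suc (card K)"
  shows "(\<Sum>i\<in>I. \<Sum>j\<in>I. \<bar>t i - t j\<bar>) / 2 + (\<Sum>k\<in>K. \<Sum>l\<in>K. \<bar>e k - e l\<bar>) / 2
    \<le> (\<Sum>i\<in>I. \<Sum>k\<in>K. \<bar>t i - e k\<bar>)"
proof -
  define R where "R = Max (t ` I \<union> e ` K)"
  have R: "\<And>i. i \<in> I \<Longrightarrow> t i \<le> R" "\<And>k. k \<in> K \<Longrightarrow> e k \<le> R"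
    using fin by (auto simp: R_def)
  let ?f = "\<lambda>s. (\<Sum>i\<in>I. indicator {t i..R} s) - (\<Sum>k\<in>K. indicator {e k..R} s) :: real"
  have "0 \<le> ?f s * ?f s - ?f s" for s
  proof -
    define z where "z = int (card {i\<in>I. t i \<le> s \<and> s \<le> R}) - int (card {k\<in>K. e k \<le> s \<and> s \<le> R})"
    have z: "?f s = of_int z" using fin by (simp add: card_eq_sum_indicator_atLeast z_def)
    have "0 \<le> z * z - z"
    proof (cases "z \<le> 0")
      case True then show ?thesis using mult_nonpos_nonpos[of z z] by linarith
    next
      case False then have "z * 1 \<le> z * z" by (intro mult_left_mono) auto
      then show ?thesis by simp
    qed
    then have "0 \<le> real_of_int (z * z - z)" by (metis of_int_0_le_iff)
    then show ?thesis unfolding z by simp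
  qed
  then have "0 \<le> (\<integral>s. ?f s * ?f s - ?f s \<partial>lborel)"
    by (intro integral_nonneg_AE) auto
  also have "\<dots> = (\<Sum>i\<in>I. \<Sum>k\<in>K. \<bar>t i - e k\<bar>) - (\<Sum>i\<in>I. \<Sum>j\<in>I. \<bar>t i - t j\<bar>) / 2
      - (\<Sum>k\<in>K. \<Sum>l\<in>K. \<bar>e k - e l\<bar>) / 2"
    by (rule energy_identity[OF fin card R])
  finally show ?thesis by linarith
qed

lemma energy_equality:
  fixes t e :: "nat \<Rightarrow> real"
  assumes n: "n \<ge> 1"
    and lo: "\<And>j. j + 1 < n \<Longrightarrow> t j \<le> e (Suc j)" and up: "\<And>j. j + 1 < n \<Longrightarrow> e (Suc j) \<le> t (Suc j)"
  shows "(\<Sum>i<n. \<Sum>j<n. \<bar>t i - t j\<bar>) / 2 + (\<Sum>k=1..<n. \<Sum>l=1..<n. \<bar>e k - e l\<bar>) / 2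
    = (\<Sum>i<n. \<Sum>k=1..<n. \<bar>t i - e k\<bar>)"
proof -
  define R where "R = Max (t ` {..<n} \<union> e ` {1..<n})"
  have R: "\<And>i. i \<in> {..<n} \<Longrightarrow> t i \<le> R" "\<And>k. k \<in> {1..<n} \<Longrightarrow> e k \<le> R"
    by (auto simp: R_def)
  let ?f = "\<lambda>s. (\<Sum>i<n. indicator {t i..R} s) - (\<Sum>k=1..<n. indicator {e k..R} s) :: real"
  have "?f s * ?f s - ?f s = 0" for s
  proof -
    let ?T = "{i\<in>{..<n}. t i \<le> s \<and> s \<le> R}" and ?E = "{k\<in>{1..<n}. e k \<le> s \<and> s \<le> R}"
    \<comment> \<open>By \<open>lo\<close>, every counted \<open>e k\<close> comes with a counted
      \<open>t (k - 1)\<close>, so \<open>f \<ge> 0\<close>; by \<open>up\<close>, every counted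
      \<open>t j\<close> with \<open>j > 0\<close> comes with a counted \<open>e j\<close>, so
      \<open>f \<le> 1\<close>.\<close>
    have "?E \<subseteq> Suc ` ?T"
    proof
      fix k assume k: "k \<in> ?E"
      then obtain j where j: "k = Suc j" by (cases k) auto
      then have "j \<in> ?T" using k lo[of j] by auto
      then show "k \<in> Suc ` ?T" using j by blast
    qed
    then have "card ?E \<le> card (Suc ` ?T)" by (intro card_mono) auto
    then have 1: "card ?E \<le> card ?T" by (simp add: card_image)
    have "?T \<subseteq> insert 0 ?E"
    proof
      fix j assume j: "j \<in> ?T"
      show "j \<in> insert 0 ?E"
      proof (cases j)
        case (Suc i)
        then show ?thesis using j up[of i] by auto
      qed simp
    qed
    then have "card ?T \<le> card (insert 0 ?E)" by (intro card_mono) auto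
    also have "\<dots> \<le> Suc (card ?E)" by (simp add: card_insert_le_m1 card_insert_if)
    finally have "card ?T = card ?E \<or> card ?T = Suc (card ?E)" using 1 by linarith
    then show ?thesis by (auto simp: card_eq_sum_indicator_atLeast)
  qed
  then have "0 = (\<integral>s. ?f s * ?f s - ?f s \<partial>lborel)" by (simp only: integral_zero)
  also have "\<dots> = (\<Sum>i<n. \<Sum>k=1..<n. \<bar>t i - e k\<bar>) - (\<Sum>i<n. \<Sum>j<n. \<bar>t i - t j\<bar>) / 2
      - (\<Sum>k=1..<n. \<Sum>l=1..<n. \<bar>e k - e l\<bar>) / 2"
    using n by (intro energy_identity R) auto
  finally show ?thesis by linarith
qed

section \<open>Pair costs with nonnegative mixed differences\<close>

text \<open>Telescoping in both directions. The sign is the one for which the well-ordering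
  inequality makes every summand nonnegative.\<close>

lemma sum_mixed_differences:
  fixes h :: "nat \<Rightarrow> nat \<Rightarrow> real"
  assumes "P1 \<le> P2" "Q1 \<le> Q2"
  shows "(\<Sum>p=P1..<P2. \<Sum>q=Q1..<Q2. h (Suc p) q - h p q - h (Suc p) (Suc q) + h p (Suc q))
    = h P2 Q1 - h P1 Q1 - h P2 Q2 + h P1 Q2"
proof -
  have "(\<Sum>q=Q1..<Q2. h (Suc p) q - h p q - h (Suc p) (Suc q) + h p (Suc q))
      = (h (Suc p) Q1 - h (Suc p) Q2) - (h p Q1 - h p Q2)" for p
  proof -
    have "(\<Sum>q=Q1..<Q2. h (Suc p) q - h p q - h (Suc p) (Suc q) + h p (Suc q))
      = (\<Sum>q=Q1..<Q2. (h p (Suc q) - h (Suc p) (Suc q)) - (h p q - h (Suc p) q))"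
      by (intro sum.cong) auto
    also have "\<dots> = (h p Q2 - h (Suc p) Q2) - (h p Q1 - h (Suc p) Q1)"
      using assms by (intro sum_Suc_diff') auto
    finally show ?thesis by simp
  qed
  then have "(\<Sum>p=P1..<P2. \<Sum>q=Q1..<Q2. h (Suc p) q - h p q - h (Suc p) (Suc q) + h p (Suc q))
    = (\<Sum>p=P1..<P2. (h (Suc p) Q1 - h (Suc p) Q2) - (h p Q1 - h p Q2))" by simp
  also have "\<dots> = (h P2 Q1 - h P2 Q2) - (h P1 Q1 - h P1 Q2)"
    using assms by (intro sum_Suc_diff') auto
  finally show ?thesis by simp
qed

lemma sum_off_diagonal:
  fixes f :: "nat \<Rightarrow> nat \<Rightarrow> real"
  shows "(\<Sum>i<n. \<Sum>j\<in>{..<n}-{i}. f i j) = (\<Sum>i<n. \<Sum>j<n. f i j) - (\<Sum>i<n. f i i)"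
proof -
  have "(\<Sum>i<n. \<Sum>j\<in>{..<n}-{i}. f i j) = (\<Sum>i<n. (\<Sum>j<n. f i j) - f i i)"
    by (intro sum.cong) (auto simp: sum_diff1)
  then show ?thesis by (simp add: sum_subtractf)
qed

section \<open>Dyadic grids on the interval\<close>

definition dyadic :: "real \<Rightarrow> real \<Rightarrow> nat \<Rightarrow> nat \<Rightarrow> real" where
  "dyadic a b N p = a + (b - a) * real p / 2 ^ N"

lemma dyadic_0 [simp]: "dyadic a b N 0 = a" and dyadic_last [simp]: "dyadic a b N (2 ^ N) = b"
  by (simp_all add: dyadic_def)

lemma dyadic_less_iff [simp]: "a < b \<Longrightarrow> dyadic a b N p < dyadic a b N q \<longleftrightarrow> p < q"
  by (simp add: dyadic_def divide_less_cancel)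

lemma dyadic_le_iff [simp]: "a < b \<Longrightarrow> dyadic a b N p \<le> dyadic a b N q \<longleftrightarrow> p \<le> q"
  by (simp add: dyadic_def divide_le_cancel)

lemma dyadic_refine: "N \<le> N' \<Longrightarrow> dyadic a b N p = dyadic a b N' (p * 2 ^ (N' - N))"
proof -
  assume "N \<le> N'"
  then have "(2::real) ^ N' = 2 ^ N * 2 ^ (N' - N)" by (simp flip: power_add)
  then show ?thesis by (simp add: dyadic_def)
qed

lemma dyadic_cell:
  assumes "a < b" "a \<le> x" "x < b"
  obtains p where "p < 2 ^ N" "dyadic a b N p \<le> x" "x < dyadic a b N (Suc p)"
    "x - (b - a) / 2 ^ N < dyadic a b N p" "dyadic a b N (Suc p) \<le> x + (b - a) / 2 ^ N"
proof -
  define z where "z = (x - a) / (b - a) * 2 ^ N"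
  have z: "0 \<le> z" "z < 2 ^ N" using assms by (simp_all add: z_def divide_simps)
  have x: "x = a + (b - a) * z / 2 ^ N" using assms by (simp add: z_def)
  define p where "p = nat \<lfloor>z\<rfloor>"
  have p: "real p \<le> z" "z < real (Suc p)" using z by (auto simp: p_def) linarith
  have "real p < 2 ^ N" using p z by linarith
  then have "p < 2 ^ N" by (metis of_nat_less_numeral_power_cancel_iff)
  moreover have 1: "dyadic a b N p \<le> x" "x < dyadic a b N (Suc p)"
    using p assms by (auto simp: dyadic_def x divide_le_cancel divide_less_cancel)
  moreover have "dyadic a b N (Suc p) = dyadic a b N p + (b - a) / 2 ^ N"
    by (simp add: dyadic_def field_simps)
  ultimately show ?thesis using that[of p] by force
qed

text \<open>\<open>v\<close> is only meaningful for \<open>a \<le> x \<le> y \<le> b\<close>; \<open>P\<close> collects the points of the diagonal where it is finite.\<close>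

locale pair_cost =
  fixes a b :: real and v :: "real \<Rightarrow> real \<Rightarrow> real" and P :: "real set"
  assumes ab: "a < b"
    and submod: "\<And>x1 x2 x3 x4. a \<le> x1 \<Longrightarrow> x1 \<le> x2 \<Longrightarrow> x2 \<le> x3 \<Longrightarrow> x3 \<le> x4 \<Longrightarrow> x4 \<le> b \<Longrightarrow>
        x2 < x3 \<or> x2 \<in> P \<Longrightarrow> v x1 x3 + v x2 x4 \<le> v x1 x4 + v x2 x3"
    and end_mono: "\<And>x y. a < x \<Longrightarrow> x \<le> y \<Longrightarrow> y < b \<Longrightarrow> v x b - v a x \<le> v y b - v a y"
    and cont: "continuous_on {(x, y). a \<le> x \<and> x < y \<and> y \<le> b} (\<lambda>(x, y). v x y)"
begin

definition D :: "real \<Rightarrow> real" where "D x = v x b - v a x"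
definition S :: "real \<Rightarrow> real" where "S x = v x b + v a x"
text \<open>Subtracting the values on the sides \<open>x = a\<close> and \<open>y = b\<close> makes
  \<open>M\<close> vanish there. Its value at a point is then a pure sum of mixed differences over
  the cells to the left of and above that point, without boundary terms.\<close>

definition M :: "real \<Rightarrow> real \<Rightarrow> real" where "M x y = v x y - v a y - v x b + v a b"

lemma D_mono: "a < x \<Longrightarrow> x \<le> y \<Longrightarrow> y < b \<Longrightarrow> D x \<le> D y"
  by (simp add: D_def end_mono)

lemma v_decomp:
  assumes "a < x" "a < y" "x < b" "y < b"
  shows "v (min x y) (max x y) = (S x + S y) / 2 - \<bar>D x - D y\<bar> / 2 - v a b + M (min x y) (max x y)"
proof (cases "x \<le> y")
  case True
  then show ?thesis using D_mono[of x y] assms by (simp add: D_def S_def M_def field_simps)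
next
  case False
  then show ?thesis using D_mono[of y x] assms by (simp add: D_def S_def M_def field_simps)
qed

text \<open>Each end of the interval is moved separately, and each move is one mixed difference with
  a fourth point at \<open>b\<close> or \<open>a\<close>, where \<open>M\<close> vanishes. Rounding
  the ends outwards to the grid therefore gives lower bounds.\<close>

lemma M_mono:
  assumes "a \<le> x'" "x' \<le> x" "x \<le> y" "y \<le> y'" "y' \<le> b" "x < y \<or> x \<in> P"
  shows "M x' y' \<le> M x y"
proof -
  have "v x' y' + v x b \<le> v x' b + v x y'" using assms by (intro submod) auto
  moreover have "v a y + v x y' \<le> v a y' + v x y" using assms by (intro submod) auto
  ultimately show ?thesis by (simp add: M_def)
qed

lemma M_left [simp]: "M a y = 0" and M_right [simp]: "M x b = 0"
  by (simp_all add: M_def)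

section \<open>Step functions approximating \<open>M\<close> from below\<close>

definition mix :: "nat \<Rightarrow> nat \<Rightarrow> nat \<Rightarrow> real" where
  "mix N p q = M (dyadic a b N (Suc p)) (dyadic a b N q) - M (dyadic a b N p) (dyadic a b N q)
     - M (dyadic a b N (Suc p)) (dyadic a b N (Suc q)) + M (dyadic a b N p) (dyadic a b N (Suc q))"

text \<open>The condition \<open>Suc p < q\<close> keeps all four corners of the cell strictly above
  the diagonal, where \<open>submod\<close> asks nothing of \<open>P\<close>;
  \<open>q < 2 ^ N\<close> keeps the corner \<open>Suc q\<close> inside the grid.\<close>

definition idx :: "nat \<Rightarrow> (nat \<times> nat) set" where
  "idx N = {(p, q). Suc p < q \<and> q < 2 ^ N}"

lemma finite_idx [simp]: "finite (idx N)"
  by (rule finite_subset[of _ "{..<2 ^ N} \<times> {..<2 ^ N}"]) (auto simp: idx_def)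

text \<open>For \<open>x \<le> y\<close>, both points lie in this interval exactly when the cell
  \<open>(p, q)\<close> is entirely to the left of \<open>x\<close> and above \<open>y\<close>. So
  the quadrant of cells that build up \<open>M x y\<close> is encoded by a product of two indicators
  of one interval.\<close>

definition block :: "nat \<Rightarrow> nat \<times> nat \<Rightarrow> real set" where
  "block N pq = {dyadic a b N (Suc (fst pq))..<dyadic a b N (snd pq)}"

definition MG :: "nat \<Rightarrow> real \<Rightarrow> real \<Rightarrow> real" where
  "MG N x y = (\<Sum>pq\<in>idx N. mix N (fst pq) (snd pq) * (indicator (block N pq) x * indicator (block N pq) y))"

lemma MG_commute: "MG N x y = MG N y x"
  by (simp add: MG_def mult.commute)

lemma dyadic_in: "p \<le> 2 ^ N \<Longrightarrow> a \<le> dyadic a b N p \<and> dyadic a b N p \<le> b"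
  using dyadic_le_iff[OF ab, of N 0 p] dyadic_le_iff[OF ab, of N p "2 ^ N"] by simp

lemma mix_nonneg:
  assumes "(p, q) \<in> idx N" shows "0 \<le> mix N p q"
proof -
  have "v (dyadic a b N p) (dyadic a b N q) + v (dyadic a b N (Suc p)) (dyadic a b N (Suc q))
      \<le> v (dyadic a b N p) (dyadic a b N (Suc q)) + v (dyadic a b N (Suc p)) (dyadic a b N q)"
    using assms ab dyadic_in[of p N] dyadic_in[of "Suc q" N]
    by (intro submod) (auto simp: idx_def)
  then show ?thesis by (simp add: mix_def M_def)
qed

lemma sum_mix:
  assumes "P1 \<le> P2" "Q1 \<le> Q2"
  shows "(\<Sum>p=P1..<P2. \<Sum>q=Q1..<Q2. mix N p q) =
     M (dyadic a b N P2) (dyadic a b N Q1) - M (dyadic a b N P1) (dyadic a b N Q1)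
     - M (dyadic a b N P2) (dyadic a b N Q2) + M (dyadic a b N P1) (dyadic a b N Q2)"
  unfolding mix_def using assms by (rule sum_mixed_differences)

text \<open>The contributing cells form the rectangle with \<open>p < p0\<close> and
  \<open>q > q0\<close>. Their mixed differences telescope to four values of \<open>M\<close>, three
  of which lie on the sides where \<open>M\<close> is zero.\<close>

lemma MG_eq:
  assumes x: "dyadic a b N p0 \<le> x" "x < dyadic a b N (Suc p0)"
    and y: "q0 < 2 ^ N" "dyadic a b N q0 \<le> y" "y < dyadic a b N (Suc q0)" and xy: "x \<le> y"
  shows "MG N x y = M (dyadic a b N p0) (dyadic a b N (Suc q0))"
proof -
  have "dyadic a b N p0 < dyadic a b N (Suc q0)" using x y xy by linarith
  then have pq: "p0 \<le> q0" using ab by simp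
  have less: "dyadic a b N p \<le> x \<longleftrightarrow> p \<le> p0" for p
  proof
    assume "dyadic a b N p \<le> x"
    then have "dyadic a b N p < dyadic a b N (Suc p0)" using x by linarith
    then show "p \<le> p0" using ab by simp
  next
    assume "p \<le> p0"
    then have "dyadic a b N p \<le> dyadic a b N p0" using ab by simp
    then show "dyadic a b N p \<le> x" using x by linarith
  qed
  have greater: "y < dyadic a b N q \<longleftrightarrow> q0 < q" for q
  proof
    assume "y < dyadic a b N q"
    then have "dyadic a b N q0 < dyadic a b N q" using y by linarith
    then show "q0 < q" using ab by simp
  next
    assume "q0 < q"
    then have "dyadic a b N (Suc q0) \<le> dyadic a b N q" using ab by simp
    then show "y < dyadic a b N q" using y by linarith
  qed
  have "MG N x y = (\<Sum>pq\<in>{0..<p0} \<times> {Suc q0..<2 ^ N}. mix N (fst pq) (snd pq))"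
    unfolding MG_def
  proof (rule sum.mono_neutral_cong_right)
    show "{0..<p0} \<times> {Suc q0..<2 ^ N} \<subseteq> idx N" using pq by (auto simp: idx_def)
    show "\<forall>pq\<in>idx N - {0..<p0} \<times> {Suc q0..<2 ^ N}.
        mix N (fst pq) (snd pq) * (indicator (block N pq) x * indicator (block N pq) y) = 0"
    proof
      fix pq assume "pq \<in> idx N - {0..<p0} \<times> {Suc q0..<2 ^ N}"
      then have "\<not> Suc (fst pq) \<le> p0 \<or> \<not> q0 < snd pq" by (auto simp: idx_def)
      then have "x \<notin> block N pq \<or> y \<notin> block N pq"
        using less[of "Suc (fst pq)"] greater[of "snd pq"] by (auto simp: block_def)
      then show "mix N (fst pq) (snd pq) * (indicator (block N pq) x * indicator (block N pq) y) = 0"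
        by auto
    qed
    fix pq assume "pq \<in> {0..<p0} \<times> {Suc q0..<2 ^ N}"
    then have "Suc (fst pq) \<le> p0" "q0 < snd pq" by auto
    then have "x \<in> block N pq" "y \<in> block N pq"
      using xy less[of "Suc (fst pq)"] greater[of "snd pq"] by (auto simp: block_def)
    then show "mix N (fst pq) (snd pq) * (indicator (block N pq) x * indicator (block N pq) y)
      = mix N (fst pq) (snd pq)" by simp
  qed simp
  also have "\<dots> = (\<Sum>p=0..<p0. \<Sum>q=Suc q0..<2 ^ N. mix N p q)"
    by (simp add: sum.cartesian_product case_prod_unfold)
  also have "\<dots> = M (dyadic a b N p0) (dyadic a b N (Suc q0))"
    using y by (subst sum_mix) auto
  finally show ?thesis .
qed

text \<open>By \<open>MG_eq\<close> the step function takes the value of \<open>M\<close> at the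
  grid points just outside \<open>x\<close> and \<open>y\<close>, which \<open>M_mono\<close>
  bounds.\<close>

lemma MG_le:
  assumes "a < x" "x \<le> y" "y < b" "x < y \<or> x \<in> P"
  shows "MG N x y \<le> M x y"
proof -
  obtain p where p: "p < 2 ^ N" "dyadic a b N p \<le> x" "x < dyadic a b N (Suc p)"
    using dyadic_cell[of a b x N] assms ab by (metis less_imp_le order_le_less_trans)
  obtain q where q: "q < 2 ^ N" "dyadic a b N q \<le> y" "y < dyadic a b N (Suc q)"
    using dyadic_cell[of a b y N] assms ab by (metis less_imp_le less_le_trans)
  have "MG N x y = M (dyadic a b N p) (dyadic a b N (Suc q))"
    using p q assms by (intro MG_eq) auto
  also have "\<dots> \<le> M x y"
    using p q assms dyadic_in[of p N] dyadic_in[of "Suc q" N] by (intro M_mono) auto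
  finally show ?thesis .
qed

lemma cont_M: "continuous_on {(x, y). a < x \<and> x < y \<and> y < b} (\<lambda>(x, y). M x y)"
proof -
  let ?\<Delta> = "{(x, y). a < x \<and> x < y \<and> y < b}"
  have "continuous_on ?\<Delta> (\<lambda>z. v (f z) (g z))"
    if "continuous_on ?\<Delta> (\<lambda>z. (f z, g z))" "\<And>z. z \<in> ?\<Delta> \<Longrightarrow> a \<le> f z \<and> f z < g z \<and> g z \<le> b" for f g
    using continuous_on_compose2[OF cont that(1)] that(2) by fastforce
  note c = this
  have "continuous_on ?\<Delta> (\<lambda>z. v (fst z) (snd z))"
    by (rule c) (auto intro!: continuous_intros)
  moreover have "continuous_on ?\<Delta> (\<lambda>z. v a (snd z))"
    by (rule c) (auto intro!: continuous_intros)
  moreover have "continuous_on ?\<Delta> (\<lambda>z. v (fst z) b)"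
    by (rule c) (auto intro!: continuous_intros)
  ultimately show ?thesis unfolding M_def case_prod_unfold by (intro continuous_intros)
qed

text \<open>The grid points of \<open>MG_eq\<close> approach \<open>x\<close> from the left and
  \<open>y\<close> from the right, hence remain strictly ordered, and \<open>M\<close> is continuous
  off the diagonal.\<close>

lemma MG_tendsto:
  assumes "a < x" "x < y" "y < b"
  shows "(\<lambda>N. MG N x y) \<longlonglongrightarrow> M x y"
proof -
  let ?cell = "\<lambda>N x p. p < 2 ^ N \<and> dyadic a b N p \<le> x \<and> x < dyadic a b N (Suc p) \<and>
    x - (b - a) / 2 ^ N < dyadic a b N p \<and> dyadic a b N (Suc p) \<le> x + (b - a) / 2 ^ N"
  have "\<exists>p. ?cell N x p" if "a < x" "x < b" for N x
    using dyadic_cell[of a b x N] that ab by (metis less_imp_le)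
  then have ex: "\<exists>p. \<forall>N. ?cell N x (p N)" if "a < x" "x < b" for x
    using that by (intro choice) blast
  have px: "a < x" "x < b" and py: "a < y" "y < b" using assms by auto
  obtain p q where p: "\<And>N. ?cell N x (p N)" and q: "\<And>N. ?cell N y (q N)"
    using ex[OF px] ex[OF py] by blast
  have z: "(\<lambda>N. (b - a) / 2 ^ N) \<longlonglongrightarrow> 0"
    by (simp add: LIMSEQ_divide_realpow_zero)
  have l: "(\<lambda>N. dyadic a b N (p N)) \<longlonglongrightarrow> x"
  proof (rule tendsto_sandwich[of "\<lambda>N. x - (b - a) / 2 ^ N" _ _ "\<lambda>_. x"])
    show "(\<lambda>N. x - (b - a) / 2 ^ N) \<longlonglongrightarrow> x"
      using tendsto_diff[OF tendsto_const z, of x] by simp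
  qed (use p in \<open>auto intro: always_eventually less_imp_le\<close>)
  have r: "(\<lambda>N. dyadic a b N (Suc (q N))) \<longlonglongrightarrow> y"
  proof (rule tendsto_sandwich[of "\<lambda>_. y" _ _ "\<lambda>N. y + (b - a) / 2 ^ N"])
    show "(\<lambda>N. y + (b - a) / 2 ^ N) \<longlonglongrightarrow> y"
      using tendsto_add[OF tendsto_const z, of y] by simp
  qed (use q in \<open>auto intro: always_eventually less_imp_le\<close>)
  let ?\<Delta> = "{(x, y). a < x \<and> x < y \<and> y < b}"
  have e1: "eventually (\<lambda>N. a < dyadic a b N (p N)) sequentially"
    using order_tendstoD(1)[OF l, of a] assms by simp
  have e2: "eventually (\<lambda>N. dyadic a b N (Suc (q N)) < b) sequentially"
    using order_tendstoD(2)[OF r, of b] assms by simp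
  have "(\<lambda>N. M (dyadic a b N (p N)) (dyadic a b N (Suc (q N)))) \<longlonglongrightarrow> M x y"
  proof -
    have "(\<lambda>N. (dyadic a b N (p N), dyadic a b N (Suc (q N)))) \<longlonglongrightarrow> (x, y)"
      by (intro tendsto_intros l r)
    moreover have "eventually (\<lambda>N. (dyadic a b N (p N), dyadic a b N (Suc (q N))) \<in> ?\<Delta>) sequentially"
      using e1 e2
    proof eventually_elim
      case (elim N)
      have "dyadic a b N (p N) < dyadic a b N (Suc (q N))"
        using p[of N] q[of N] assms by linarith
      with elim show ?case by blast
    qed
    ultimately show ?thesis
      using continuous_on_tendsto_compose[OF cont_M, of _ "(x, y)"] assms by fastforce
  qed
  moreover have "MG N x y = M (dyadic a b N (p N)) (dyadic a b N (Suc (q N)))" for N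
    using p[of N] q[of N] assms by (intro MG_eq) auto
  ultimately show ?thesis by simp
qed

end

section \<open>A lower bound for the cost of one configuration\<close>

definition occ :: "nat \<Rightarrow> real set \<Rightarrow> (nat \<Rightarrow> real) \<Rightarrow> nat" where
  "occ n J y = card {i. i < n \<and> y i \<in> J}"

lemma sum_indicator_eq_occ: "(\<Sum>i<n. indicator J (y i)) = real (occ n J y)"
proof -
  have "{i. i < n \<and> y i \<in> J} = {..<n} \<inter> {i. y i \<in> J}" by auto
  then show ?thesis by (simp add: occ_def indicator_def sum.If_cases)
qed

lemma occ_measurable [measurable]:
  assumes [measurable]: "J \<in> sets borel"
  shows "(\<lambda>y. real (occ n J y)) \<in> borel_measurable (Rn n)"
  unfolding sum_indicator_eq_occ[symmetric] by measurable

context pair_cost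
begin

text \<open>One-point part of the bound. The \<open>n - 1\<close> inner division points
  \<open>d k\<close> are the test points against which the energy inequality is applied. The default
  0 is taken at the ends and outside, where \<open>S\<close> and \<open>D\<close> involve values
  such as \<open>v b b\<close> without meaning.\<close>

definition phi :: "nat \<Rightarrow> (nat \<Rightarrow> real) \<Rightarrow> real \<Rightarrow> real" where
  "phi n d x = (if a < x \<and> x < b then \<Sum>k=1..<n. S x - \<bar>D x - D (d k)\<bar> else 0)"

text \<open>The self-energy of the test points, and one copy of \<open>- v a b\<close> for each of
  the \<open>n (n - 1)\<close> ordered pairs.\<close>

definition offset :: "nat \<Rightarrow> (nat \<Rightarrow> real) \<Rightarrow> real" where
  "offset n d = (\<Sum>k=1..<n. \<Sum>l=1..<n. \<bar>D (d k) - D (d l)\<bar>) / 2 - real n * (real n - 1) * v a b"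

definition lower :: "nat \<Rightarrow> (nat \<Rightarrow> real) \<Rightarrow> nat \<Rightarrow> (nat \<Rightarrow> real) \<Rightarrow> real" where
  "lower n d N y = (\<Sum>i<n. phi n d (y i)) + offset n d
     + (\<Sum>pq\<in>idx N. mix N (fst pq) (snd pq) * (real (occ n (block N pq) y) ^ 2 - real (occ n (block N pq) y)))"

text \<open>A block holding \<open>N\<close> of the points contains \<open>N^2 - N\<close> ordered
  pairs with distinct indices, and \<open>MG\<close> gives each of them the weight of the
  cell.\<close>

lemma sum_MG:
  "(\<Sum>i<n. \<Sum>j\<in>{..<n}-{i}. MG N (y i) (y j)) =
    (\<Sum>pq\<in>idx N. mix N (fst pq) (snd pq) * (real (occ n (block N pq) y) ^ 2 - real (occ n (block N pq) y)))"
proof -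
  have "(\<Sum>i<n. \<Sum>j\<in>{..<n}-{i}. MG N (y i) (y j)) =
    (\<Sum>pq\<in>idx N. mix N (fst pq) (snd pq) *
      ((\<Sum>i<n. \<Sum>j<n. indicator (block N pq) (y i) * indicator (block N pq) (y j))
       - (\<Sum>i<n. indicator (block N pq) (y i) * indicator (block N pq) (y i))))"
    unfolding sum_off_diagonal MG_def right_diff_distrib sum_subtractf sum_distrib_left
      sum.swap[of _ "idx N"] ..
  moreover have "(\<Sum>i<n. \<Sum>j<n. indicator J (y i) * indicator J (y j)) = real (occ n J y) ^ 2" for J
    by (simp add: sum_indicator_eq_occ[symmetric] power2_eq_square sum_product)
  moreover have "(\<Sum>i<n. indicator J (y i) * indicator J (y i)) = real (occ n J y)" for J
    unfolding sum_indicator_eq_occ[symmetric] by (intro sum.cong) (auto simp: indicator_def)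
  ultimately show ?thesis by simp
qed

text \<open>The bracket on the right is precisely the slack of the energy inequality between the
  values \<open>D (y i)\<close> and \<open>D (d k)\<close>. Kept explicit, it serves the lower
  bound, where it is nonnegative, and the interlaced case, where it vanishes.\<close>

lemma sum_additive_part:
  assumes "n \<ge> 1" "\<And>i. i < n \<Longrightarrow> a < y i \<and> y i < b"
  shows "(\<Sum>i<n. \<Sum>j\<in>{..<n}-{i}. (S (y i) + S (y j)) / 2 - \<bar>D (y i) - D (y j)\<bar> / 2 - v a b)
    = (\<Sum>i<n. phi n d (y i)) + offset n d
      + ((\<Sum>i<n. \<Sum>k=1..<n. \<bar>D (y i) - D (d k)\<bar>) - (\<Sum>i<n. \<Sum>j<n. \<bar>D (y i) - D (y j)\<bar>) / 2
         - (\<Sum>k=1..<n. \<Sum>l=1..<n. \<bar>D (d k) - D (d l)\<bar>) / 2)"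
proof -
  define c where "c = v a b"
  define X where "X = (\<Sum>i<n. S (y i))"
  define Y where "Y = (\<Sum>i<n. \<Sum>j<n. \<bar>D (y i) - D (y j)\<bar>)"
  define Z where "Z = (\<Sum>i<n. \<Sum>k=1..<n. \<bar>D (y i) - D (d k)\<bar>)"
  define W where "W = (\<Sum>k=1..<n. \<Sum>l=1..<n. \<bar>D (d k) - D (d l)\<bar>)"
  have 1: "(\<Sum>i<n. \<Sum>j<n. (S (y i) + S (y j)) / 2 - \<bar>D (y i) - D (y j)\<bar> / 2 - c) = n * X - Y / 2 - n * n * c"
    by (simp add: X_def Y_def sum.distrib sum_subtractf sum_divide_distrib[symmetric] sum_distrib_left[symmetric]
        add_divide_distrib)
  have 2: "(\<Sum>i<n. (S (y i) + S (y i)) / 2 - \<bar>D (y i) - D (y i)\<bar> / 2 - c) = X - n * c"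
    by (simp add: X_def sum_subtractf)
  have "(\<Sum>i<n. phi n d (y i)) = (\<Sum>i<n. (real n - 1) * S (y i) - (\<Sum>k=1..<n. \<bar>D (y i) - D (d k)\<bar>))"
    using assms by (intro sum.cong) (auto simp: phi_def sum_subtractf of_nat_diff)
  also have "\<dots> = (real n - 1) * X - Z"
    by (simp add: X_def Z_def sum_subtractf sum_distrib_left)
  finally have 3: "(\<Sum>i<n. phi n d (y i)) = (real n - 1) * X - Z" .
  have 4: "offset n d = W / 2 - real n * (real n - 1) * c" by (simp add: offset_def W_def c_def)
  show ?thesis
    unfolding sum_off_diagonal c_def[symmetric] 1 2 3 4 Y_def[symmetric] Z_def[symmetric] W_def[symmetric]
    by (simp add: algebra_simps)
qed

lemma lower_le:
  assumes n: "n \<ge> 1" and y: "\<And>i. i < n \<Longrightarrow> a < y i \<and> y i < b"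
    and P: "\<And>i j. i < n \<Longrightarrow> j < n \<Longrightarrow> i \<noteq> j \<Longrightarrow> y i = y j \<Longrightarrow> y i \<in> P"
  shows "lower n d N y \<le> (\<Sum>i<n. \<Sum>j\<in>{..<n}-{i}. v (min (y i) (y j)) (max (y i) (y j)))"
proof -
  have le: "(\<Sum>i<n. \<Sum>j\<in>{..<n}-{i}. v (min (y i) (y j)) (max (y i) (y j))) \<ge>
    (\<Sum>i<n. \<Sum>j\<in>{..<n}-{i}. ((S (y i) + S (y j)) / 2 - \<bar>D (y i) - D (y j)\<bar> / 2 - v a b) + MG N (y i) (y j))"
  proof (intro sum_mono)
    fix i j assume ij: "i \<in> {..<n}" "j \<in> {..<n} - {i}"
    have "MG N (y i) (y j) = MG N (min (y i) (y j)) (max (y i) (y j))"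
      by (auto simp: min_def max_def MG_commute)
    also have "\<dots> \<le> M (min (y i) (y j)) (max (y i) (y j))"
      using ij y[of i] y[of j] P[of i j] by (intro MG_le) (auto simp: min_def max_def less_le)
    finally show "(S (y i) + S (y j)) / 2 - \<bar>D (y i) - D (y j)\<bar> / 2 - v a b + MG N (y i) (y j)
        \<le> v (min (y i) (y j)) (max (y i) (y j))"
      using v_decomp[of "y i" "y j"] y[of i] y[of j] ij by auto
  qed
  have "(\<Sum>i<n. \<Sum>k=1..<n. \<bar>D (y i) - D (d k)\<bar>) - (\<Sum>i<n. \<Sum>j<n. \<bar>D (y i) - D (y j)\<bar>) / 2
         - (\<Sum>k=1..<n. \<Sum>l=1..<n. \<bar>D (d k) - D (d l)\<bar>) / 2 \<ge> 0"
    using energy_inequality[of "{..<n}" "{1..<n}" "\<lambda>i. D (y i)" "\<lambda>k. D (d k)"] n by auto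
  then have "(\<Sum>i<n. \<Sum>j\<in>{..<n}-{i}. ((S (y i) + S (y j)) / 2 - \<bar>D (y i) - D (y j)\<bar> / 2 - v a b) + MG N (y i) (y j))
     \<ge> lower n d N y"
    using sum_additive_part[of n y d, OF n y] unfolding lower_def sum.distrib sum_MG by linarith
  then show ?thesis using le by linarith
qed

text \<open>For interlaced points the energy slack is zero since \<open>D\<close> is monotone. The
  only error left is that of \<open>MG\<close> against \<open>M\<close>, which tends to 0 because
  the points are distinct.\<close>

lemma lower_tendsto:
  fixes d y :: "nat \<Rightarrow> real" and \<sigma> :: "nat \<Rightarrow> nat"
  assumes n: "n \<ge> 1" and d: "\<And>k. k \<in> {1..<n} \<Longrightarrow> a < d k \<and> d k < b"
    and y: "\<And>i. i < n \<Longrightarrow> a < y i \<and> y i < b"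
    and \<sigma>: "bij_betw \<sigma> {..<n} {..<n}"
    and inter: "\<And>j. j + 1 < n \<Longrightarrow> y (\<sigma> j) < d (Suc j)" "\<And>j. j + 1 < n \<Longrightarrow> d (Suc j) < y (\<sigma> (Suc j))"
    and inj: "inj_on y {..<n}"
  shows "(\<lambda>N. lower n d N y) \<longlonglongrightarrow> (\<Sum>i<n. \<Sum>j\<in>{..<n}-{i}. v (min (y i) (y j)) (max (y i) (y j)))"
proof -
  define t where "t j = D (y (\<sigma> j))" for j
  have s: "\<sigma> j < n" if "j < n" for j using bij_betwE[OF \<sigma>] that by auto
  have re: "(\<Sum>i<n. f (\<sigma> i)) = (\<Sum>i<n. f i)" for f :: "nat \<Rightarrow> real"
    by (rule sum.reindex_bij_betw[OF \<sigma>])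
  have "(\<Sum>i<n. \<Sum>j<n. \<bar>t i - t j\<bar>) / 2 + (\<Sum>k=1..<n. \<Sum>l=1..<n. \<bar>D (d k) - D (d l)\<bar>) / 2
    = (\<Sum>i<n. \<Sum>k=1..<n. \<bar>t i - D (d k)\<bar>)"
  proof (rule energy_equality[OF n])
    fix j assume j: "j + 1 < n"
    show "t j \<le> D (d (Suc j))"
      unfolding t_def using inter(1)[OF j] d[of "Suc j"] y[OF s, of j] j by (intro D_mono) auto
    show "D (d (Suc j)) \<le> t (Suc j)"
      unfolding t_def using inter(2)[OF j] d[of "Suc j"] y[OF s, of "Suc j"] j by (intro D_mono) auto
  qed
  then have en: "(\<Sum>i<n. \<Sum>k=1..<n. \<bar>D (y i) - D (d k)\<bar>) - (\<Sum>i<n. \<Sum>j<n. \<bar>D (y i) - D (y j)\<bar>) / 2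
         - (\<Sum>k=1..<n. \<Sum>l=1..<n. \<bar>D (d k) - D (d l)\<bar>) / 2 = 0"
    unfolding t_def re[where f = "\<lambda>j. \<bar>D (y _) - D (y j)\<bar>"]
      re[where f = "\<lambda>i. \<Sum>j<n. \<bar>D (y i) - D (y j)\<bar>"] re[where f = "\<lambda>i. \<Sum>k=1..<n. \<bar>D (y i) - D (d k)\<bar>"]
    by linarith
  have low: "lower n d N y =
     (\<Sum>i<n. \<Sum>j\<in>{..<n}-{i}. ((S (y i) + S (y j)) / 2 - \<bar>D (y i) - D (y j)\<bar> / 2 - v a b) + MG N (y i) (y j))" for N
    using sum_additive_part[of n y d, OF n y] unfolding lower_def sum.distrib sum_MG en by linarith
  show ?thesis
    unfolding low
  proof (intro tendsto_sum)
    fix i j assume ij: "i \<in> {..<n}" "j \<in> {..<n} - {i}"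
    have "(\<lambda>N. MG N (min (y i) (y j)) (max (y i) (y j))) \<longlonglongrightarrow> M (min (y i) (y j)) (max (y i) (y j))"
      using y[of i] y[of j] ij inj_onD[OF inj, of i j] by (intro MG_tendsto) (auto simp: min_def max_def less_le)
    moreover have "MG N (min (y i) (y j)) (max (y i) (y j)) = MG N (y i) (y j)" for N
      by (auto simp: min_def max_def MG_commute)
    ultimately have "(\<lambda>N. MG N (y i) (y j)) \<longlonglongrightarrow> M (min (y i) (y j)) (max (y i) (y j))" by simp
    then have "(\<lambda>N. ((S (y i) + S (y j)) / 2 - \<bar>D (y i) - D (y j)\<bar> / 2 - v a b) + MG N (y i) (y j))
      \<longlonglongrightarrow> ((S (y i) + S (y j)) / 2 - \<bar>D (y i) - D (y j)\<bar> / 2 - v a b) + M (min (y i) (y j)) (max (y i) (y j))"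
      by (intro tendsto_intros)
    then show "(\<lambda>N. ((S (y i) + S (y j)) / 2 - \<bar>D (y i) - D (y j)\<bar> / 2 - v a b) + MG N (y i) (y j))
      \<longlonglongrightarrow> v (min (y i) (y j)) (max (y i) (y j))"
      using v_decomp[of "y i" "y j"] y[of i] y[of j] ij by simp
  qed
qed

lemma cont_ends: "continuous_on {a..<b} (\<lambda>x. v x b)" "continuous_on {a<..b} (\<lambda>x. v a x)"
proof -
  have "continuous_on {a..<b} (\<lambda>x. case (x, b) of (x, y) \<Rightarrow> v x y)"
    by (rule continuous_on_compose2[OF cont]) (auto intro!: continuous_intros)
  then show "continuous_on {a..<b} (\<lambda>x. v x b)" by simp
  have "continuous_on {a<..b} (\<lambda>x. case (a, x) of (x, y) \<Rightarrow> v x y)"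
    by (rule continuous_on_compose2[OF cont]) (auto intro!: continuous_intros)
  then show "continuous_on {a<..b} (\<lambda>x. v a x)" by simp
qed

lemma phi_measurable [measurable]: "phi n d \<in> borel_measurable borel"
proof -
  have "continuous_on {a<..<b} (\<lambda>x. v x b)" "continuous_on {a<..<b} (\<lambda>x. v a x)"
    by (auto intro: continuous_on_subset[OF cont_ends(1)] continuous_on_subset[OF cont_ends(2)])
  then have "continuous_on {a<..<b} (\<lambda>x. \<Sum>k=1..<n. S x - \<bar>D x - D (d k)\<bar>)"
    unfolding S_def D_def by (intro continuous_intros)
  then have "(\<lambda>x. indicator {a<..<b} x *\<^sub>R (\<Sum>k=1..<n. S x - \<bar>D x - D (d k)\<bar>)) \<in> borel_measurable borel"
    by (intro borel_measurable_continuous_on_indicator) auto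
  moreover have "phi n d = (\<lambda>x. indicator {a<..<b} x *\<^sub>R (\<Sum>k=1..<n. S x - \<bar>D x - D (d k)\<bar>))"
    by (auto simp: phi_def fun_eq_iff indicator_def)
  ultimately show ?thesis by simp
qed

text \<open>\<open>S\<close> and \<open>D\<close> may be unbounded at both ends, but in
  \<open>S x - \<bar>D x - D (d k)\<bar>\<close> one singular term always cancels: it equals
  \<open>2 * v x b - D (d k)\<close> to the left of \<open>d k\<close> and
  \<open>2 * v a x + D (d k)\<close> to the right, both continuous on the compact piece in
  question.\<close>

lemma phi_bounded:
  assumes d: "\<And>k. k \<in> {1..<n} \<Longrightarrow> a < d k \<and> d k < b"
  obtains C where "C \<ge> 0" "\<And>x. \<bar>phi n d x\<bar> \<le> C"
proof -
  have "\<exists>C. \<forall>x. a < x \<longrightarrow> x < b \<longrightarrow> \<bar>S x - \<bar>D x - D (d k)\<bar>\<bar> \<le> C" if k: "k \<in> {1..<n}" for k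
  proof -
    have "compact ((\<lambda>x. v x b) ` {a..d k})" "compact ((\<lambda>x. v a x) ` {d k..b})"
      using d[OF k] by (auto intro!: compact_continuous_image continuous_on_subset[OF cont_ends(1)]
        continuous_on_subset[OF cont_ends(2)])
    then obtain C1 C2 where C: "\<And>x. x \<in> {a..d k} \<Longrightarrow> \<bar>v x b\<bar> \<le> C1" "\<And>x. x \<in> {d k..b} \<Longrightarrow> \<bar>v a x\<bar> \<le> C2"
      by (metis compact_imp_bounded bounded_iff imageI real_norm_def)
    have "\<bar>S x - \<bar>D x - D (d k)\<bar>\<bar> \<le> 2 * \<bar>C1\<bar> + 2 * \<bar>C2\<bar> + \<bar>D (d k)\<bar>" if x: "a < x" "x < b" for x
    proof (cases "x \<le> d k")
      case True
      then have "D x \<le> D (d k)" using d[OF k] x by (intro D_mono) auto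
      moreover have "\<bar>v x b\<bar> \<le> C1" using C True x by auto
      ultimately show ?thesis by (simp add: S_def D_def)
    next
      case False
      then have "D (d k) \<le> D x" using d[OF k] x by (intro D_mono) auto
      moreover have "\<bar>v a x\<bar> \<le> C2" using C False x by auto
      ultimately show ?thesis by (simp add: S_def D_def)
    qed
    then show ?thesis by blast
  qed
  then have "\<forall>k\<in>{1..<n}. \<exists>C. \<forall>x. a < x \<longrightarrow> x < b \<longrightarrow> \<bar>S x - \<bar>D x - D (d k)\<bar>\<bar> \<le> C" by blast
  then obtain C where C: "\<And>k x. k \<in> {1..<n} \<Longrightarrow> a < x \<Longrightarrow> x < b \<Longrightarrow> \<bar>S x - \<bar>D x - D (d k)\<bar>\<bar> \<le> C k"
    by (metis (no_types, lifting))
  have "\<bar>phi n d x\<bar> \<le> (\<Sum>k=1..<n. \<bar>C k\<bar>)" for x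
  proof (cases "a < x \<and> x < b")
    case True
    then have "\<bar>phi n d x\<bar> \<le> (\<Sum>k=1..<n. \<bar>S x - \<bar>D x - D (d k)\<bar>\<bar>)"
      by (simp add: phi_def)
    also have "\<dots> \<le> (\<Sum>k=1..<n. \<bar>C k\<bar>)"
      using C True by (intro sum_mono) (meson abs_ge_self order_trans)
    finally show ?thesis .
  next
    case False
    then show ?thesis unfolding phi_def by (auto intro: sum_nonneg)
  qed
  moreover have "0 \<le> (\<Sum>k=1..<n. \<bar>C k\<bar>)" by (simp add: sum_nonneg)
  ultimately show ?thesis using that by blast
qed

end

section \<open>Seidl plans in terms of the distribution function\<close>

locale nonatomic =
  fixes a b :: real and \<rho> :: "real measure"
  assumes nonatomic: "nonatomic_prob a b \<rho>"
begin

sublocale real_distribution \<rho>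
  using nonatomic by (auto simp: nonatomic_prob_def real_distribution_def real_distribution_axioms_def)

lemma null_singleton: "measure \<rho> {x} = 0"
  using nonatomic by (simp add: nonatomic_prob_def measure_def)

lemma prob_interval: "measure \<rho> {a..b} = 1"
  using nonatomic by (simp add: nonatomic_prob_def measure_def)

lemma F_mono: "x \<le> y \<Longrightarrow> cdf \<rho> x \<le> cdf \<rho> y"
  by (rule cdf_nondecreasing)

lemma F_less_imp: "cdf \<rho> x < cdf \<rho> y \<Longrightarrow> x < y"
  using F_mono[of y x] by linarith

lemma F_cont: "isCont (cdf \<rho>) x"
  by (simp add: isCont_cdf null_singleton)

lemma measure_Icc: "x \<le> y \<Longrightarrow> measure \<rho> {x..y} = cdf \<rho> y - cdf \<rho> x"
proof -
  assume xy: "x \<le> y"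
  have "{x..y} = {x} \<union> {x<..y}" using xy by auto
  moreover have "measure \<rho> ({x} \<union> {x<..y}) = measure \<rho> {x} + measure \<rho> {x<..y}"
    by (rule finite_measure_Union) auto
  ultimately show ?thesis
    using cdf_diff_eq[of x y] xy by (cases "x = y") (auto simp: null_singleton)
qed

lemma F_eq_0: "x \<le> a \<Longrightarrow> cdf \<rho> x = 0"
proof -
  assume x: "x \<le> a"
  have "measure \<rho> ({..<a} \<union> {a..b}) = measure \<rho> {..<a} + measure \<rho> {a..b}"
    by (rule finite_measure_Union) auto
  then have 0: "measure \<rho> {..<a} \<le> 0" using prob_interval prob_le_1[of "{..<a} \<union> {a..b}"] by simp
  have "measure \<rho> {..x} \<le> measure \<rho> ({..<a} \<union> {a})" using x by (intro finite_measure_mono) auto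
  also have "\<dots> \<le> measure \<rho> {..<a} + measure \<rho> {a}" by (rule measure_Un_le) auto
  finally show ?thesis using 0 null_singleton[of a] by (simp add: cdf_def order_antisym)
qed

lemma F_eq_1: "b \<le> x \<Longrightarrow> cdf \<rho> x = 1"
proof -
  assume "b \<le> x"
  then have "measure \<rho> {a..b} \<le> measure \<rho> {..x}" by (intro finite_measure_mono) auto
  then show ?thesis using cdf_bounded_prob[of x] prob_interval by (intro order_antisym) (auto simp: cdf_def)
qed

lemma F_range: "0 \<le> cdf \<rho> x" "cdf \<rho> x \<le> 1"
  using cdf_nonneg cdf_bounded_prob by auto

lemma a_less_b: "a < b"
proof (rule ccontr)
  assume "\<not> a < b"
  then show False using F_eq_0[of a] F_eq_1[of a] by simp
qed

lemma F_measurable [measurable]: "cdf \<rho> \<in> borel_measurable borel"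
  by (intro borel_measurable_continuous_onI continuous_at_imp_continuous_on) (simp add: F_cont)

lemma AE_in_interval: "AE x in \<rho>. x \<in> {a..b}"
proof (rule AE_I[of _ _ "- {a..b}"])
  have "measure \<rho> (space \<rho> - {a..b}) = 1 - measure \<rho> {a..b}"
    by (rule prob_compl) simp
  then show "emeasure \<rho> (- {a..b}) = 0"
    using prob_interval by (simp add: emeasure_eq_measure Compl_eq_Diff_UNIV)
qed auto

lemma AE_neq: "AE x in \<rho>. x \<noteq> c"
proof (rule AE_I[of _ _ "{c}"])
  show "emeasure \<rho> {c} = 0" by (simp add: emeasure_eq_measure null_singleton)
qed auto

lemma AE_interior: "AE x in \<rho>. a < x \<and> x < b"
  using AE_in_interval AE_neq[of a] AE_neq[of b] by eventually_elim auto

text \<open>Monotonicity of the distribution function puts a level set between its extreme points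
  \<open>s\<close> and \<open>t\<close>, and the mass of \<open>{s..t}\<close> is a difference of
  two equal values.\<close>

lemma AE_level: "AE x in \<rho>. cdf \<rho> x \<noteq> c"
proof (cases "\<exists>x\<in>{a..b}. cdf \<rho> x = c")
  case False
  show ?thesis using AE_in_interval by eventually_elim (use False in blast)
next
  case True
  define L where "L = {x \<in> {a..b}. cdf \<rho> x = c}"
  have "closed {x \<in> {a..b}. cdf \<rho> x = c}"
    using F_cont by (intro continuous_closed_preimage_constant continuous_at_imp_continuous_on) auto
  moreover have "bounded {x \<in> {a..b}. cdf \<rho> x = c}"
    by (rule bounded_subset[OF bounded_closed_interval[of a b]]) auto
  ultimately have "compact L" unfolding L_def by (simp add: compact_eq_bounded_closed)
  moreover have "L \<noteq> {}" using True by (auto simp: L_def)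
  ultimately obtain s t where st: "s \<in> L" "t \<in> L" "\<And>x. x \<in> L \<Longrightarrow> s \<le> x \<and> x \<le> t"
    using compact_attains_inf[of L] compact_attains_sup[of L] by blast
  have "measure \<rho> {s..t} = 0" using st(1,2) st(3)[OF st(2)] by (subst measure_Icc) (auto simp: L_def)
  then have "AE x in \<rho>. x \<notin> {s..t}"
    by (intro AE_I[of _ _ "{s..t}"]) (auto simp: emeasure_eq_measure)
  with AE_in_interval show ?thesis
    by eventually_elim (use st in \<open>auto simp: L_def\<close>)
qed

text \<open>Two points on one level enclose a rational on the same level, and the countably many
  levels of rationals are null.\<close>

lemma AE_F_injective: "AE x in \<rho>. \<forall>z. cdf \<rho> z = cdf \<rho> x \<longrightarrow> z = x"
proof -
  have "AE x in \<rho>. \<forall>q::rat. cdf \<rho> x \<noteq> cdf \<rho> (of_rat q)"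
    by (subst AE_all_countable) (simp add: AE_level)
  then show ?thesis
  proof eventually_elim
    case (elim x)
    show ?case
    proof (intro allI impI, rule ccontr)
      fix z assume z: "cdf \<rho> z = cdf \<rho> x" "z \<noteq> x"
      then have "min z x < max z x" by (auto simp: min_def max_def)
      then obtain q where q: "min z x < of_rat q" "of_rat q < max z x"
        using of_rat_dense by blast
      then have "cdf \<rho> (of_rat q) = cdf \<rho> x"
        using F_mono[of "min z x" "of_rat q"] F_mono[of "of_rat q" "max z x"] z
        by (auto simp: min_def max_def split: if_splits)
      then show False using elim by metis
    qed
  qed
qed

text \<open>A monotone map preserves the mass to the left of a point: up to a null set, the points
  of \<open>{p..q}\<close> with image at most \<open>T x\<close> are those up to \<open>x\<close>.
  Flat pieces of \<open>T\<close> do no harm, since the fibre over \<open>T x\<close> has at most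
  the mass of a singleton.\<close>

lemma transport_step:
  assumes T [measurable]: "T \<in> borel_measurable borel" and mono: "mono_on {p<..<q} T"
    and tr: "distr (density \<rho> (indicator {p..q})) borel T = density \<rho> (indicator {p'..q'})"
    and pq: "p < q" "p' < q'"
  shows "AE x in \<rho>. p < x \<and> x < q \<longrightarrow>
    p' < T x \<and> T x < q' \<and> cdf \<rho> (T x) - cdf \<rho> p' = cdf \<rho> x - cdf \<rho> p"
proof -
  have E: "measure \<rho> ({p..q} \<inter> T -` B) = measure \<rho> ({p'..q'} \<inter> B)" if [measurable]: "B \<in> sets borel" for B
  proof -
    have [measurable]: "T -` B \<in> sets borel" using measurable_sets[OF T that] by simp
    have "emeasure (distr (density \<rho> (indicator {p..q})) borel T) B = emeasure \<rho> ({p..q} \<inter> T -` B)"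
      by (simp add: emeasure_distr emeasure_density indicator_inter_arith[symmetric])
    moreover have "emeasure (density \<rho> (indicator {p'..q'})) B = emeasure \<rho> ({p'..q'} \<inter> B)"
      by (simp add: emeasure_density indicator_inter_arith[symmetric])
    ultimately show ?thesis unfolding tr by (simp add: measure_def)
  qed
  let ?N = "{p..q} \<inter> T -` (- {p'<..<q'})"
  have [measurable]: "T -` B \<in> sets borel" if "B \<in> sets borel" for B
    using measurable_sets[OF T that] by simp
  have "measure \<rho> ?N = measure \<rho> ({p'..q'} \<inter> - {p'<..<q'})" by (rule E) auto
  also have "\<dots> \<le> measure \<rho> ({p'} \<union> {q'})" by (intro finite_measure_mono) auto
  also have "\<dots> \<le> measure \<rho> {p'} + measure \<rho> {q'}" by (rule measure_Un_le) auto
  finally have "measure \<rho> ?N = 0" by (simp add: null_singleton order_antisym)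
  moreover have "?N \<in> sets \<rho>" by auto
  ultimately have "AE x in \<rho>. x \<notin> ?N"
    by (intro AE_I[of _ _ ?N]) (auto simp: emeasure_eq_measure)
  then show ?thesis
  proof (eventually_elim, intro impI)
    fix x assume x: "x \<notin> ?N" and xpq: "p < x \<and> x < q"
    then have Tx: "p' < T x" "T x < q'" by auto
    let ?A = "{p..q} \<inter> T -` {..T x}"
    have "{p'..T x} = {p'..q'} \<inter> {..T x}" using Tx by auto
    then have A: "cdf \<rho> (T x) - cdf \<rho> p' = measure \<rho> ?A"
      using measure_Icc[of p' "T x"] Tx E[of "{..T x}"] by simp
    have "measure \<rho> {p<..x} \<le> measure \<rho> ?A"
      using xpq mono_onD[OF mono, of _ x] by (intro finite_measure_mono) auto
    then have 1: "cdf \<rho> x - cdf \<rho> p \<le> measure \<rho> ?A" using cdf_diff_eq[of p x] xpq by simp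
    \<comment> \<open>Beyond \<open>x\<close>, monotonicity leaves only points with the same image
      as \<open>x\<close>; the end \<open>q\<close> is listed separately because \<open>T\<close> is
      monotone only on the open interval.\<close>
    have "?A \<subseteq> {p..x} \<union> ({q} \<union> ({p..q} \<inter> T -` {T x}))"
    proof
      fix z assume z: "z \<in> ?A"
      show "z \<in> {p..x} \<union> ({q} \<union> ({p..q} \<inter> T -` {T x}))"
      proof (cases "z \<le> x \<or> z = q")
        case False
        then have "T x \<le> T z" using z xpq mono_onD[OF mono, of x z] by auto
        then show ?thesis using z by auto
      qed (use z in auto)
    qed
    then have "measure \<rho> ?A \<le> measure \<rho> ({p..x} \<union> ({q} \<union> ({p..q} \<inter> T -` {T x})))"
      by (intro finite_measure_mono) auto
    also have "\<dots> \<le> measure \<rho> {p..x} + measure \<rho> ({q} \<union> ({p..q} \<inter> T -` {T x}))"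
      by (intro measure_Un_le) auto
    also have "measure \<rho> ({q} \<union> ({p..q} \<inter> T -` {T x})) \<le> measure \<rho> {q} + measure \<rho> ({p..q} \<inter> T -` {T x})"
      by (intro measure_Un_le) auto
    also have "measure \<rho> ({p..q} \<inter> T -` {T x}) \<le> measure \<rho> {T x}"
      unfolding E[of "{T x}", simplified] by (intro finite_measure_mono) auto
    finally have "measure \<rho> ?A \<le> cdf \<rho> x - cdf \<rho> p"
      using measure_Icc[of p x] xpq by (simp add: null_singleton)
    with 1 A Tx show "p' < T x \<and> T x < q' \<and> cdf \<rho> (T x) - cdf \<rho> p' = cdf \<rho> x - cdf \<rho> p" by simp
  qed
qed

text \<open>A Seidl orbit up to order, expressed through the distribution function alone: the
  numbers \<open>n F (y i)\<close> share the fractional part \<open>u\<close> and their integer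
  parts run through 0 to \<open>n - 1\<close>. Strict bounds on \<open>u\<close> keep the points off
  the division points.\<close>

definition equispaced :: "nat \<Rightarrow> (nat \<Rightarrow> real) \<Rightarrow> bool" where
  "equispaced n y \<longleftrightarrow> (\<exists>u \<sigma>. 0 < u \<and> u < 1 \<and> bij_betw \<sigma> {..<n} {..<n} \<and>
     (\<forall>i<n. real n * cdf \<rho> (y i) = u + real (\<sigma> i)))"

text \<open>An interval of length \<open>L\<close> meets a translate of the integers, in general
  position, in \<open>\<lfloor>L\<rfloor>\<close> or \<open>\<lfloor>L\<rfloor> + 1\<close> points.
  The hypothesis \<open>gen\<close> makes the difference between open and closed ends
  immaterial.\<close>

lemma equispaced_occ:
  assumes eq: "equispaced n y" and st: "s \<le> t"
    and gen: "\<And>i. i < n \<Longrightarrow> cdf \<rho> (y i) \<noteq> cdf \<rho> s \<and> cdf \<rho> (y i) \<noteq> cdf \<rho> t"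
  shows "int (occ n {s..<t} y) = \<lfloor>real n * (cdf \<rho> t - cdf \<rho> s)\<rfloor> \<or>
    int (occ n {s..<t} y) = \<lfloor>real n * (cdf \<rho> t - cdf \<rho> s)\<rfloor> + 1"
proof (cases "n = 0")
  case True then show ?thesis by (simp add: occ_def)
next
  case False
  then have n: "real n > 0" by simp
  obtain u \<sigma> where u: "0 < u" "u < 1" and \<sigma>: "bij_betw \<sigma> {..<n} {..<n}"
    and F: "\<And>i. i < n \<Longrightarrow> real n * cdf \<rho> (y i) = u + real (\<sigma> i)"
    using eq by (auto simp: equispaced_def)
  define \<alpha> \<beta> where "\<alpha> = real n * cdf \<rho> s - u" and "\<beta> = real n * cdf \<rho> t - u"
  \<comment> \<open>These bounds show that restricting the integers to 0 to \<open>n - 1\<close>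
    truncates nothing: all integers in the window from \<open>\<alpha>\<close> (excluded) to
    \<open>\<beta>\<close> are values of \<open>\<sigma>\<close>.\<close>
  have ab: "\<alpha> \<le> \<beta>" "- 1 < \<alpha>" "\<beta> < real n"
  proof -
    have "real n * cdf \<rho> s \<le> real n * cdf \<rho> t" using F_mono[OF st] by (rule mult_left_mono) simp
    moreover have "0 \<le> real n * cdf \<rho> s" using F_range(1)[of s] by simp
    moreover have "real n * cdf \<rho> t \<le> real n * 1" using F_range(2)[of t] by (rule mult_left_mono) simp
    ultimately show "\<alpha> \<le> \<beta>" "- 1 < \<alpha>" "\<beta> < real n" using u by (auto simp: \<alpha>_def \<beta>_def)
  qed
  have in_iff: "y i \<in> {s..<t} \<longleftrightarrow> \<lfloor>\<alpha>\<rfloor> < int (\<sigma> i) \<and> int (\<sigma> i) \<le> \<lfloor>\<beta>\<rfloor>" if i: "i < n" for i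
  proof -
    have "y i \<in> {s..<t} \<longleftrightarrow> cdf \<rho> s < cdf \<rho> (y i) \<and> cdf \<rho> (y i) < cdf \<rho> t"
    proof
      assume "y i \<in> {s..<t}"
      then show "cdf \<rho> s < cdf \<rho> (y i) \<and> cdf \<rho> (y i) < cdf \<rho> t"
        using F_mono[of s "y i"] F_mono[of "y i" t] gen[OF i] by force
    next
      assume "cdf \<rho> s < cdf \<rho> (y i) \<and> cdf \<rho> (y i) < cdf \<rho> t"
      then show "y i \<in> {s..<t}" using F_less_imp[of s "y i"] F_less_imp[of "y i" t] by auto
    qed
    also have "\<dots> \<longleftrightarrow> real n * cdf \<rho> s < real n * cdf \<rho> (y i) \<and> real n * cdf \<rho> (y i) < real n * cdf \<rho> t"
      using n by simp
    also have "\<dots> \<longleftrightarrow> real n * cdf \<rho> s < real n * cdf \<rho> (y i) \<and> real n * cdf \<rho> (y i) \<le> real n * cdf \<rho> t"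
      using n gen[OF i] by force
    also have "\<dots> \<longleftrightarrow> \<alpha> < real (\<sigma> i) \<and> real (\<sigma> i) \<le> \<beta>"
      unfolding F[OF i] by (auto simp: \<alpha>_def \<beta>_def)
    also have "\<dots> \<longleftrightarrow> \<lfloor>\<alpha>\<rfloor> < int (\<sigma> i) \<and> int (\<sigma> i) \<le> \<lfloor>\<beta>\<rfloor>"
      by (simp add: floor_less_iff le_floor_iff)
    finally show ?thesis .
  qed
  have "\<sigma> ` {i. i < n \<and> y i \<in> {s..<t}} = {l. l < n \<and> \<lfloor>\<alpha>\<rfloor> < int l \<and> int l \<le> \<lfloor>\<beta>\<rfloor>}"
  proof -
    have "\<sigma> ` {i\<in>{..<n}. \<lfloor>\<alpha>\<rfloor> < int (\<sigma> i) \<and> int (\<sigma> i) \<le> \<lfloor>\<beta>\<rfloor>} = {l\<in>{..<n}. \<lfloor>\<alpha>\<rfloor> < int l \<and> int l \<le> \<lfloor>\<beta>\<rfloor>}"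
      using bij_betw_imp_surj_on[OF \<sigma>] by auto
    moreover have "{i. i < n \<and> y i \<in> {s..<t}} = {i\<in>{..<n}. \<lfloor>\<alpha>\<rfloor> < int (\<sigma> i) \<and> int (\<sigma> i) \<le> \<lfloor>\<beta>\<rfloor>}"
      using in_iff by auto
    ultimately show ?thesis by auto
  qed
  also have "\<dots> = {nat (\<lfloor>\<alpha>\<rfloor> + 1)..<nat (\<lfloor>\<beta>\<rfloor> + 1)}"
  proof (intro set_eqI)
    fix l
    have "\<lfloor>\<alpha>\<rfloor> \<ge> -1" "\<lfloor>\<beta>\<rfloor> < int n" using ab by linarith+
    then show "l \<in> {l. l < n \<and> \<lfloor>\<alpha>\<rfloor> < int l \<and> int l \<le> \<lfloor>\<beta>\<rfloor>} \<longleftrightarrow> l \<in> {nat (\<lfloor>\<alpha>\<rfloor> + 1)..<nat (\<lfloor>\<beta>\<rfloor> + 1)}"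
      by auto
  qed
  finally have im: "\<sigma> ` {i. i < n \<and> y i \<in> {s..<t}} = {nat (\<lfloor>\<alpha>\<rfloor> + 1)..<nat (\<lfloor>\<beta>\<rfloor> + 1)}" .
  have "inj_on \<sigma> {i. i < n \<and> y i \<in> {s..<t}}"
    using bij_betw_imp_inj_on[OF \<sigma>] by (rule inj_on_subset) auto
  then have "occ n {s..<t} y = card (\<sigma> ` {i. i < n \<and> y i \<in> {s..<t}})"
    by (simp add: occ_def card_image)
  also have "\<dots> = nat (\<lfloor>\<beta>\<rfloor> + 1) - nat (\<lfloor>\<alpha>\<rfloor> + 1)" unfolding im by simp
  finally have o: "occ n {s..<t} y = nat (\<lfloor>\<beta>\<rfloor> + 1) - nat (\<lfloor>\<alpha>\<rfloor> + 1)" .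
  have "- 1 \<le> \<lfloor>\<alpha>\<rfloor>" "\<lfloor>\<alpha>\<rfloor> \<le> \<lfloor>\<beta>\<rfloor>" using ab floor_mono[OF ab(1)] by linarith+
  then have "int (occ n {s..<t} y) = \<lfloor>\<beta>\<rfloor> - \<lfloor>\<alpha>\<rfloor>"
    unfolding o by simp
  moreover have eq: "real n * (cdf \<rho> t - cdf \<rho> s) = \<beta> - \<alpha>" by (simp add: \<alpha>_def \<beta>_def algebra_simps)
  moreover have "\<lfloor>\<beta> - \<alpha>\<rfloor> \<le> \<lfloor>\<beta>\<rfloor> - \<lfloor>\<alpha>\<rfloor>" "\<lfloor>\<beta>\<rfloor> - \<lfloor>\<alpha>\<rfloor> \<le> \<lfloor>\<beta> - \<alpha>\<rfloor> + 1"
    by linarith+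
  ultimately show ?thesis unfolding eq by presburger
qed

end

section \<open>Orbits of the Seidl map\<close>

locale seidl = nonatomic +
  fixes n :: nat and d :: "nat \<Rightarrow> real" and T :: "real \<Rightarrow> real"
  assumes n: "1 \<le> n" and d0: "d 0 = a" and dn: "d n = b"
    and d_less: "\<And>i. i < n \<Longrightarrow> d i < d (Suc i)"
    and d_mass: "\<And>i. i < n \<Longrightarrow> emeasure \<rho> {d i..d (Suc i)} = ennreal (1 / real n)"
    and T_meas [measurable]: "T \<in> borel_measurable borel"
    and T_mono: "\<And>i. i < n \<Longrightarrow> mono_on {d i<..<d (Suc i)} T"
    and T_step: "\<And>i. i + 2 \<le> n \<Longrightarrow> distr (density \<rho> (indicator {d i..d (Suc i)})) borel T
          = density \<rho> (indicator {d (Suc i)..d (Suc (Suc i))})"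
    and T_last: "distr (density \<rho> (indicator {d (n - 1)..d n})) borel T = density \<rho> (indicator {d 0..d 1})"
begin

lemma F_d: "j \<le> n \<Longrightarrow> cdf \<rho> (d j) = real j / real n"
proof (induction j)
  case 0 then show ?case by (simp add: d0 F_eq_0)
next
  case (Suc j)
  have "measure \<rho> {d j..d (Suc j)} = 1 / real n"
    using d_mass[of j] Suc by (simp add: measure_def)
  then show ?case using Suc d_less[of j] measure_Icc[of "d j" "d (Suc j)"]
    by (simp add: add_divide_distrib)
qed

lemma d_interior: assumes "k \<in> {1..<n}" shows "a < d k" "d k < b"
proof -
  have "cdf \<rho> (d 0) < cdf \<rho> (d k)" using assms F_d[of 0] F_d[of k] by simp
  then show "a < d k" using F_less_imp d0 by metis
  have "cdf \<rho> (d k) < cdf \<rho> (d n)" using assms F_d[of n] F_d[of k] by (simp add: divide_less_cancel)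
  then show "d k < b" using F_less_imp dn by metis
qed

lemma T_step_mod:
  assumes j: "j < n"
  shows "distr (density \<rho> (indicator {d j..d (Suc j)})) borel T
    = density \<rho> (indicator {d (Suc j mod n)..d (Suc (Suc j mod n))})"
proof (cases "Suc j = n")
  case True
  then have "j = n - 1" by simp
  then show ?thesis using True T_last by simp
next
  case False
  then have "Suc j < n" using j by simp
  then show ?thesis using T_step[of j] by simp
qed

text \<open>In the coordinate \<open>n F\<close> the Seidl map is the shift by 1 modulo
  \<open>n\<close>: here \<open>j\<close> is the cell containing \<open>x\<close> and
  \<open>u\<close> the position within it.\<close>

lemma AE_T:
  "AE x in \<rho>. \<exists>j u. j < n \<and> 0 < u \<and> u < 1 \<and> real n * cdf \<rho> x = u + real j \<and>
     real n * cdf \<rho> (T x) = u + real (Suc j mod n)"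
proof -
  have step: "AE x in \<rho>. \<forall>j\<in>{..<n}. d j < x \<and> x < d (Suc j) \<longrightarrow>
     cdf \<rho> (T x) - cdf \<rho> (d (Suc j mod n)) = cdf \<rho> x - cdf \<rho> (d j)"
  proof (rule AE_finite_allI)
    fix j assume j: "j \<in> {..<n}"
    then have "Suc j mod n < n" by simp
    with transport_step[OF T_meas T_mono T_step_mod, of j] j d_less[of j] d_less[of "Suc j mod n"]
    show "AE x in \<rho>. d j < x \<and> x < d (Suc j) \<longrightarrow>
       cdf \<rho> (T x) - cdf \<rho> (d (Suc j mod n)) = cdf \<rho> x - cdf \<rho> (d j)"
      by (auto elim!: eventually_mono)
  qed simp
  have lev: "AE x in \<rho>. \<forall>j\<in>{..n}. cdf \<rho> x \<noteq> real j / real n"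
    by (rule AE_finite_allI) (auto simp: AE_level)
  show ?thesis using step lev
  proof eventually_elim
    case (elim x)
    define j where "j = nat \<lfloor>real n * cdf \<rho> x\<rfloor>"
    define u where "u = real n * cdf \<rho> x - real j"
    have npos: "real n > 0" using n by simp
    have F: "cdf \<rho> x < 1" "cdf \<rho> x \<ge> 0" using F_range[of x] elim(2)[rule_format, of n] npos by auto
    have jF: "real j \<le> real n * cdf \<rho> x" "real n * cdf \<rho> x < real j + 1"
      using F npos by (auto simp: j_def)
    have "real n * cdf \<rho> x < real n * 1" using F npos by (intro mult_strict_left_mono) auto
    then have jn: "j < n" using jF by linarith
    have nz: "real n * cdf \<rho> x \<noteq> real j"
      using elim(2)[rule_format, of j] jn npos by (auto simp: field_simps)
    then have u: "0 < u" "u < 1" using jF by (auto simp: u_def)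
    have "real n * cdf \<rho> (d j) < real n * cdf \<rho> x" "real n * cdf \<rho> x < real n * cdf \<rho> (d (Suc j))"
      using F_d[of j] F_d[of "Suc j"] jn jF nz npos by auto
    then have "cdf \<rho> (d j) < cdf \<rho> x" "cdf \<rho> x < cdf \<rho> (d (Suc j))" using npos by auto
    then have "d j < x" "x < d (Suc j)" using F_less_imp by auto
    then have "cdf \<rho> (T x) - cdf \<rho> (d (Suc j mod n)) = cdf \<rho> x - cdf \<rho> (d j)"
      using elim(1) jn by auto
    moreover have "Suc j mod n \<le> n" using npos by (simp add: less_imp_le)
    ultimately have "real n * cdf \<rho> (T x) = u + real (Suc j mod n)"
      using F_d[of j] F_d[of "Suc j mod n"] jn npos by (simp add: u_def field_simps)
    then show ?case using jn u by (intro exI[of _ j] exI[of _ u]) (auto simp: u_def)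
  qed
qed

lemma measure_split:
  assumes [measurable]: "C \<in> sets borel"
  shows "measure \<rho> C = (\<Sum>j<n. measure \<rho> ({d j..d (Suc j)} \<inter> C))"
proof -
  have d_mono: "a \<le> d m" if "m \<le> n" for m
    using that
  proof (induction m)
    case (Suc m) then show ?case using d_less[of m] by simp
  qed (simp add: d0)
  have "measure \<rho> ({a..d m} \<inter> C) = (\<Sum>j<m. measure \<rho> ({d j..d (Suc j)} \<inter> C))" if "m \<le> n" for m
    using that
  proof (induction m)
    case 0
    have "measure \<rho> ({a} \<inter> C) \<le> measure \<rho> {a}" by (intro finite_measure_mono) auto
    then show ?case by (simp add: d0 null_singleton order_antisym)
  next
    case (Suc m)
    have dm: "a \<le> d m" "d m < d (Suc m)" using d_mono[of m] d_less[of m] Suc by auto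
    have null: "measure \<rho> ({d m} \<inter> C) = 0"
    proof -
      have "measure \<rho> ({d m} \<inter> C) \<le> measure \<rho> {d m}" by (intro finite_measure_mono) auto
      then show ?thesis by (simp add: null_singleton order_antisym)
    qed
    have "{a..d (Suc m)} \<inter> C = ({a..d m} \<inter> C) \<union> ({d m<..d (Suc m)} \<inter> C)" using dm by auto
    then have 1: "measure \<rho> ({a..d (Suc m)} \<inter> C) = measure \<rho> ({a..d m} \<inter> C) + measure \<rho> ({d m<..d (Suc m)} \<inter> C)"
      by (simp, subst finite_measure_Union[symmetric]) auto
    have "{d m..d (Suc m)} \<inter> C = ({d m} \<inter> C) \<union> ({d m<..d (Suc m)} \<inter> C)" using dm by auto
    then have "measure \<rho> ({d m..d (Suc m)} \<inter> C) = measure \<rho> ({d m} \<inter> C) + measure \<rho> ({d m<..d (Suc m)} \<inter> C)"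
      by (simp, subst finite_measure_Union[symmetric]) auto
    then show ?case using 1 null Suc by simp
  qed
  from this[of n] have "measure \<rho> ({a..b} \<inter> C) = (\<Sum>j<n. measure \<rho> ({d j..d (Suc j)} \<inter> C))"
    by (simp add: dn)
  moreover have "measure \<rho> ({a..b} \<inter> C) = measure \<rho> C"
    using AE_in_interval by (intro finite_measure_eq_AE) auto
  ultimately show ?thesis by simp
qed

text \<open>The cells are carried onto one another cyclically, so splitting the mass of the preimage
  by cells gives the masses of \<open>B\<close> in the cells, rotated by one place.\<close>

lemma T_preserves: "distr \<rho> borel T = \<rho>"
proof (rule measure_eqI)
  fix B assume "B \<in> sets (distr \<rho> borel T)"
  then have B [measurable]: "B \<in> sets borel" by simp
  have [measurable]: "T -` B \<in> sets borel" using measurable_sets[OF T_meas B] by simp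
  have E: "measure \<rho> ({d j..d (Suc j)} \<inter> T -` B)
      = measure \<rho> ({d (Suc j mod n)..d (Suc (Suc j mod n))} \<inter> B)" if "j < n" for j
  proof -
    have "emeasure (distr (density \<rho> (indicator {d j..d (Suc j)})) borel T) B
      = emeasure \<rho> ({d j..d (Suc j)} \<inter> T -` B)"
      by (simp add: emeasure_distr emeasure_density indicator_inter_arith[symmetric])
    moreover have "emeasure (density \<rho> (indicator {p..q})) B = emeasure \<rho> ({p..q} \<inter> B)" for p q :: real
      by (simp add: emeasure_density indicator_inter_arith[symmetric])
    ultimately show ?thesis unfolding T_step_mod[OF that] by (simp add: measure_def)
  qed
  obtain m where m: "n = Suc m" using n by (cases n) auto
  have "measure \<rho> (T -` B) = (\<Sum>j<n. measure \<rho> ({d (Suc j mod n)..d (Suc (Suc j mod n))} \<inter> B))"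
    using measure_split[of "T -` B"] E by simp
  also have "\<dots> = (\<Sum>j<m. measure \<rho> ({d (Suc j)..d (Suc (Suc j))} \<inter> B)) + measure \<rho> ({d 0..d 1} \<inter> B)"
    by (simp add: m)
  also have "\<dots> = (\<Sum>j<n. measure \<rho> ({d j..d (Suc j)} \<inter> B))"
    unfolding m sum.lessThan_Suc_shift by simp
  also have "\<dots> = measure \<rho> B" using measure_split[of B] by simp
  finally show "emeasure (distr \<rho> borel T) B = emeasure \<rho> B"
    by (simp add: emeasure_distr emeasure_eq_measure)
qed simp

lemma T_pow_measurable [measurable]: "T ^^ i \<in> borel_measurable borel"
  by (induction i) auto

lemma T_pow_preserves: "distr \<rho> borel (T ^^ i) = \<rho>"
proof (induction i)
  case 0
  have "distr \<rho> borel (T ^^ 0) = distr \<rho> \<rho> (\<lambda>x. x)" by (intro distr_cong) auto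
  then show ?case by (simp only: distr_id)
next
  case (Suc i)
  have "distr \<rho> borel (T ^^ Suc i) = distr (distr \<rho> borel (T ^^ i)) borel T"
    by (subst distr_distr) (auto simp: comp_def)
  then show ?case by (simp only: Suc T_preserves)
qed

definition orb :: "real \<Rightarrow> nat \<Rightarrow> real" where
  "orb x = (\<lambda>i\<in>{..<n}. (T ^^ i) x)"

lemma orb_measurable [measurable]: "orb \<in> measurable borel (Rn n)"
  unfolding orb_def by (rule measurable_restrict) auto

text \<open>Every iterate preserves \<open>\<rho>\<close>, so a null set is avoided by all points of
  almost every orbit.\<close>

lemma AE_orb_pointwise:
  assumes "AE x in \<rho>. Q x"
  shows "AE x in \<rho>. \<forall>i<n. Q (orb x i)"
proof -
  have "AE x in \<rho>. \<forall>i\<in>{..<n}. Q ((T ^^ i) x)"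
  proof (rule AE_finite_allI)
    fix i
    show "AE x in \<rho>. Q ((T ^^ i) x)"
      by (rule AE_distrD[of "T ^^ i" \<rho> borel]) (use assms in \<open>simp_all only: T_pow_preserves, measurable\<close>)
  qed simp
  then show ?thesis by eventually_elim (auto simp: orb_def)
qed

lemma AE_orb_shift:
  "AE x in \<rho>. \<exists>u j. 0 < u \<and> u < 1 \<and> j < n \<and> (\<forall>i<n. real n * cdf \<rho> (orb x i) = u + real ((j + i) mod n))"
  using AE_orb_pointwise[OF AE_T]
proof eventually_elim
  case (elim x)
  obtain j u where ju: "j < n" "0 < u" "u < 1" "real n * cdf \<rho> x = u + real j"
    using elim[rule_format, of 0] n by (auto simp: orb_def)
  have "real n * cdf \<rho> (orb x i) = u + real ((j + i) mod n)" if "i < n" for i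
    using that
  proof (induction i)
    case 0 then show ?case using ju by (simp add: orb_def)
  next
    case (Suc i)
    then have IH: "real n * cdf \<rho> (orb x i) = u + real ((j + i) mod n)" and i: "i < n" by simp_all
    obtain j' u' where ju': "j' < n" "0 < u'" "u' < 1" "real n * cdf \<rho> (orb x i) = u' + real j'"
      "real n * cdf \<rho> (T (orb x i)) = u' + real (Suc j' mod n)"
      using elim i by blast
    have "u + real ((j + i) mod n) = u' + real j'" using IH ju' by simp
    \<comment> \<open>Both \<open>u\<close> and \<open>u'\<close> lie strictly between 0 and 1, so
      equal sums have equal integer parts; the fractional part is constant along the orbit.\<close>
    moreover from this have "j' = (j + i) mod n" using ju ju' by linarith
    ultimately have "j' = (j + i) mod n" "u' = u" by simp_all
    moreover have "T (orb x i) = orb x (Suc i)" using Suc by (simp add: orb_def)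
    ultimately show ?case using ju' by (simp add: mod_Suc_eq)
  qed
  then show ?case using ju by blast
qed

lemma bij_shift_mod: "bij_betw (\<lambda>i. (j + i) mod n) {..<n} {..<n}"
proof -
  have "inj_on (\<lambda>i. (j + i) mod n) {..<n}"
  proof (rule inj_onI)
    fix x y assume xy: "x \<in> {..<n}" "y \<in> {..<n}" "(j + x) mod n = (j + y) mod n"
    have "\<not> x < y" if "y < n" "(j + x) mod n = (j + y) mod n" for x y
    proof
      assume "x < y"
      then have "n dvd y - x"
        using that(2) mod_eq_dvd_iff_nat[where m = "j + y" and n = "j + x" and q = n] by auto
      then show False using \<open>x < y\<close> \<open>y < n\<close> by (auto dest!: dvd_imp_le)
    qed
    from this[of y x] this[of x y] xy show "x = y" by auto
  qed
  moreover have "(\<lambda>i. (j + i) mod n) ` {..<n} \<subseteq> {..<n}" using n by auto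
  ultimately show ?thesis
    by (simp add: bij_betw_def endo_inj_surj)
qed

lemma AE_orb_equispaced: "AE x in \<rho>. equispaced n (orb x)"
  using AE_orb_shift
proof eventually_elim
  case (elim x)
  then obtain u j where "0 < u" "u < 1" "\<forall>i<n. real n * cdf \<rho> (orb x i) = u + real ((j + i) mod n)"
    by blast
  then show ?case unfolding equispaced_def using bij_shift_mod[of j] by blast
qed

lemma orb_coupling: "distr \<rho> (Rn n) orb \<in> couplings n \<rho>"
proof -
  have "distr (distr \<rho> (Rn n) orb) borel (\<lambda>x. x i) = \<rho>" if "i < n" for i
  proof -
    have "distr (distr \<rho> (Rn n) orb) borel (\<lambda>x. x i) = distr \<rho> borel (\<lambda>x. orb x i)"
      using that by (subst distr_distr) (auto simp: comp_def)
    also have "\<dots> = distr \<rho> borel (T ^^ i)" using that by (intro distr_cong) (auto simp: orb_def)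
    finally show ?thesis by (simp add: T_pow_preserves)
  qed
  then show ?thesis by (auto simp: couplings_def prob_space_distr)
qed

text \<open>Each open cell contains exactly one point, since \<open>u\<close> is strictly between 0
  and 1. The permutation \<open>\<tau>\<close>, inverse to \<open>\<sigma>\<close>, lists the points
  by cell, which is the interlacing with the \<open>d k\<close> that makes the energy inequality
  sharp.\<close>

lemma equispaced_interlaced:
  assumes eq: "equispaced n y"
  obtains \<tau> where "bij_betw \<tau> {..<n} {..<n}" "\<And>j. j < n \<Longrightarrow> d j < y (\<tau> j)" "\<And>j. j < n \<Longrightarrow> y (\<tau> j) < d (Suc j)"
    "\<And>i. i < n \<Longrightarrow> a < y i \<and> y i < b" "inj_on y {..<n}"
proof -
  obtain u \<sigma> where u: "0 < u" "u < 1" and \<sigma>: "bij_betw \<sigma> {..<n} {..<n}"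
    and F: "\<And>i. i < n \<Longrightarrow> real n * cdf \<rho> (y i) = u + real (\<sigma> i)"
    using eq by (auto simp: equispaced_def)
  have npos: "real n > 0" using n by simp
  have \<sigma>n: "\<sigma> i < n" if "i < n" for i using bij_betwE[OF \<sigma>] that by auto
  have pos: "d (\<sigma> i) < y i \<and> y i < d (Suc (\<sigma> i))" if i: "i < n" for i
  proof -
    have "real n * cdf \<rho> (d (\<sigma> i)) = real (\<sigma> i)" "real n * cdf \<rho> (d (Suc (\<sigma> i))) = real (\<sigma> i) + 1"
      using F_d[of "\<sigma> i"] F_d[of "Suc (\<sigma> i)"] \<sigma>n[OF i] npos by simp_all
    then have "real n * cdf \<rho> (d (\<sigma> i)) < real n * cdf \<rho> (y i)" "real n * cdf \<rho> (y i) < real n * cdf \<rho> (d (Suc (\<sigma> i)))"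
      using F[OF i] u by simp_all
    then show ?thesis using npos F_less_imp by simp
  qed
  define \<tau> where "\<tau> = inv_into {..<n} \<sigma>"
  have \<tau>: "bij_betw \<tau> {..<n} {..<n}" unfolding \<tau>_def using \<sigma> by (rule bij_betw_inv_into)
  have st: "\<tau> j < n" "\<sigma> (\<tau> j) = j" if "j < n" for j
    using bij_betwE[OF \<tau>] bij_betw_inv_into_right[OF \<sigma>] that by (auto simp: \<tau>_def)
  have "a < y i \<and> y i < b" if "i < n" for i
  proof -
    have "0 < real n * cdf \<rho> (y i)" using F[OF that] u by simp
    then have "cdf \<rho> a < cdf \<rho> (y i)" using npos F_eq_0[of a] by (simp add: zero_less_mult_iff)
    moreover have "real (\<sigma> i) + 1 \<le> real n" using \<sigma>n[OF that] by linarith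
    then have "real n * cdf \<rho> (y i) < real n * 1" using F[OF that] u by linarith
    then have "cdf \<rho> (y i) < cdf \<rho> b" using npos F_eq_1[of b] by simp
    ultimately show ?thesis using F_less_imp by blast
  qed
  moreover have "inj_on y {..<n}"
  proof (rule inj_onI)
    fix i j assume "i \<in> {..<n}" "j \<in> {..<n}" "y i = y j"
    then show "i = j" using F[of i] F[of j] bij_betw_imp_inj_on[OF \<sigma>] by (auto dest: inj_onD)
  qed
  moreover have "d j < y (\<tau> j)" "y (\<tau> j) < d (Suc j)" if "j < n" for j
    using pos[of "\<tau> j"] st[OF that] by auto
  ultimately show ?thesis using that[OF \<tau>] by blast
qed

end

lemma seidl_planE:
  assumes "seidl_plan a b n \<rho> \<gamma>" "nonatomic_prob a b \<rho>" "1 \<le> n"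
  obtains d T where "seidl a b \<rho> n d T" "\<gamma> = distr \<rho> (Rn n) (seidl.orb n T)"
proof -
  obtain d T where *: "d 0 = a" "d n = b" "\<forall>i<n. d i < d (Suc i)"
        "\<forall>i<n. emeasure \<rho> {d i..d (Suc i)} = ennreal (1 / real n)"
        "T \<in> borel_measurable borel"
        "\<forall>i<n. mono_on {d i<..<d (Suc i)} T"
        "\<forall>i. i + 2 \<le> n \<longrightarrow>
           distr (density \<rho> (indicator {d i..d (Suc i)})) borel T
             = density \<rho> (indicator {d (Suc i)..d (Suc (Suc i))})"
        "distr (density \<rho> (indicator {d (n - 1)..d n})) borel T
             = density \<rho> (indicator {d 0..d 1})"
        "\<gamma> = distr \<rho> (Rn n) (\<lambda>x. \<lambda>i\<in>{..<n}. (T ^^ i) x)"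
    using assms(1) unfolding seidl_plan_def by blast
  then interpret seidl a b \<rho> n d T
    using assms by unfold_locales auto
  have "orb = (\<lambda>x. \<lambda>i\<in>{..<n}. (T ^^ i) x)" by (simp add: orb_def fun_eq_iff)
  then show ?thesis using that[of d T] *(9) seidl_axioms by simp
qed

section \<open>Comparison of couplings with the Seidl plan\<close>

definition pair_sum :: "nat \<Rightarrow> (real \<Rightarrow> real \<Rightarrow> real) \<Rightarrow> (nat \<Rightarrow> real) \<Rightarrow> real" where
  "pair_sum n v y = (\<Sum>i<n. \<Sum>j\<in>{..<n}-{i}. v (min (y i) (y j)) (max (y i) (y j)))"

lemma couplingsD:
  assumes "\<gamma> \<in> couplings n \<rho>"
  shows "prob_space \<gamma>" "sets \<gamma> = sets (Rn n)" "space \<gamma> = space (Rn n)"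
    "\<And>i. i < n \<Longrightarrow> distr \<gamma> borel (\<lambda>x. x i) = \<rho>"
  using assms sets_eq_imp_space_eq[of \<gamma> "Rn n"] by (auto simp: couplings_def)

lemma coupling_component:
  "\<gamma> \<in> couplings n \<rho> \<Longrightarrow> i < n \<Longrightarrow> (\<lambda>x. x i) \<in> borel_measurable \<gamma>"
  using measurable_cong_sets[OF couplingsD(2) refl] measurable_component_singleton[of i "{..<n}"] by blast

lemma AE_coupling:
  assumes "\<gamma> \<in> couplings n \<rho>" "AE x in \<rho>. Q x"
  shows "AE y in \<gamma>. \<forall>i<n. Q (y i)"
proof -
  have "AE y in \<gamma>. \<forall>i\<in>{..<n}. Q (y i)"
  proof (rule AE_finite_allI)
    fix i assume "i \<in> {..<n}"
    then have "distr \<gamma> borel (\<lambda>x. x i) = \<rho>" "(\<lambda>x. x i) \<in> measurable \<gamma> borel"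
      using couplingsD(4)[OF assms(1)] coupling_component[OF assms(1)] by auto
    with assms(2) show "AE y in \<gamma>. Q (y i)" by (auto dest: AE_distrD)
  qed simp
  then show ?thesis by eventually_elim auto
qed

lemma integral_coupling_sum:
  fixes U :: "real \<Rightarrow> real"
  assumes \<gamma>: "\<gamma> \<in> couplings n \<rho>" and U [measurable]: "U \<in> borel_measurable borel" and b: "\<And>x. \<bar>U x\<bar> \<le> C"
  shows "integrable \<gamma> (\<lambda>y. \<Sum>i<n. U (y i))" "(\<integral>y. (\<Sum>i<n. U (y i)) \<partial>\<gamma>) = real n * (\<integral>x. U x \<partial>\<rho>)"
proof -
  interpret prob_space \<gamma> using couplingsD[OF \<gamma>] by simp
  have i: "integrable \<gamma> (\<lambda>y. U (y i))" if "i < n" for i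
  proof (rule integrable_const_bound[of _ C])
    show "(\<lambda>y. U (y i)) \<in> borel_measurable \<gamma>" using coupling_component[OF \<gamma> that] by measurable
  qed (use b in auto)
  have e: "(\<integral>y. U (y i) \<partial>\<gamma>) = (\<integral>x. U x \<partial>\<rho>)" if "i < n" for i
    using integral_distr[OF coupling_component[OF \<gamma> that] U] couplingsD(4)[OF \<gamma> that] by simp
  show "integrable \<gamma> (\<lambda>y. \<Sum>i<n. U (y i))" using i by auto
  show "(\<integral>y. (\<Sum>i<n. U (y i)) \<partial>\<gamma>) = real n * (\<integral>x. U x \<partial>\<rho>)"
    using i e by (subst Bochner_Integration.integral_sum) auto
qed

lemma integer_gap: "0 \<le> (real N - of_int \<kappa>) * (real N - of_int \<kappa> - 1)"
proof -
  define z where "z = int N - \<kappa>"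
  have "0 \<le> z * (z - 1)"
    by (cases "z \<le> 0") (auto simp: mult_nonpos_nonpos)
  then have "0 \<le> real_of_int (z * (z - 1))" by (metis of_int_0_le_iff)
  then show ?thesis by (simp add: z_def)
qed

context seidl
begin

text \<open>At level \<open>N\<close> the bound \<open>lower\<close> splits into one-point
  functions, whose integral is the same under every coupling, a constant, and the nonnegative terms
  \<open>H\<close>, which vanish on Seidl orbits. \<open>B\<close> is the event that
  \<open>{s2..<t1}\<close> is overfull: there every cell of the rectangle between
  \<open>s1, s2\<close> and \<open>t1, t2\<close> has \<open>H \<ge> 2\<close>, and the weights of
  these cells add up to the mixed difference in the conclusion. Because this term does not depend on
  \<open>N\<close>, it survives the limit.\<close>

lemma plan_le_gap:
  assumes pc: "pair_cost a b v P" and \<gamma>: "\<gamma> \<in> couplings n \<rho>"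
    and v_meas: "(\<lambda>z. v (fst z) (snd z)) \<in> borel_measurable borel"
    and C: "integrable \<gamma> C"
    and ok: "AE y in \<gamma>. \<forall>i<n. \<forall>j<n. i \<noteq> j \<longrightarrow> y i = y j \<longrightarrow> y i \<in> P"
    and le: "AE y in \<gamma>. pair_sum n v y \<le> C y"
    and Q: "p1 < p2" "p2 < q1" "q1 < q2" "q2 \<le> 2 ^ N0"
  defines "s1 \<equiv> dyadic a b N0 p1" and "s2 \<equiv> dyadic a b N0 p2"
    and "t1 \<equiv> dyadic a b N0 q1" and "t2 \<equiv> dyadic a b N0 q2"
  defines "B \<equiv> {y \<in> space \<gamma>. real (occ n {s2..<t1} y) - 1 > real n * (cdf \<rho> t2 - cdf \<rho> s1)}"
  shows "integrable \<rho> (\<lambda>x. pair_sum n v (orb x)) \<and> (\<integral>x. pair_sum n v (orb x) \<partial>\<rho>) \<le>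
    (\<integral>y. C y \<partial>\<gamma>) - 2 * (v s1 t2 + v s2 t1 - v s1 t1 - v s2 t2) * measure \<gamma> B"
proof -
  interpret pc: pair_cost a b v P by fact
  interpret \<gamma>: prob_space \<gamma> using couplingsD[OF \<gamma>] by simp
  define \<gamma>S where "\<gamma>S = distr \<rho> (Rn n) orb"
  have \<gamma>S: "\<gamma>S \<in> couplings n \<rho>" unfolding \<gamma>S_def by (rule orb_coupling)
  let ?m = "\<lambda>N pq. pc.mix N (fst pq) (snd pq)"
  \<comment> \<open>The expected number of points in the block, rounded down; by
    \<open>equispaced_occ\<close> Seidl orbits have \<open>\<kappa>\<close> or
    \<open>\<kappa> + 1\<close> points there, the two zeros of \<open>H\<close>.\<close>
  define \<kappa> where "\<kappa> N pq = \<lfloor>real n * (cdf \<rho> (dyadic a b N (snd pq)) - cdf \<rho> (dyadic a b N (Suc (fst pq))))\<rfloor>" for N pq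
  define H where "H N pq y = (real (occ n (pc.block N pq) y) - of_int (\<kappa> N pq)) *
     (real (occ n (pc.block N pq) y) - of_int (\<kappa> N pq) - 1)" for N pq y
  \<comment> \<open>From \<open>N^2 - N = 2 \<kappa> N - \<kappa> (\<kappa> + 1) + H\<close>, where
    \<open>N\<close> is the number of points in the block: the term linear in \<open>N\<close> is a
    sum over points and goes into \<open>U\<close>, the constant goes into \<open>K\<close>.\<close>
  define U where "U N x = pc.phi n d x + (\<Sum>pq\<in>pc.idx N. ?m N pq * (2 * of_int (\<kappa> N pq)) * indicator (pc.block N pq) x)" for N x
  define K where "K N = pc.offset n d - (\<Sum>pq\<in>pc.idx N. ?m N pq * (of_int (\<kappa> N pq) * (of_int (\<kappa> N pq) + 1)))" for N
  have meq: "measurable \<gamma>' M' = measurable (Rn n) M'" if "\<gamma>' \<in> couplings n \<rho>" for \<gamma>' and M' :: "real measure"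
    using couplingsD(2)[OF that] by (rule measurable_cong_sets) simp
  have block_borel [measurable]: "pc.block N pq \<in> sets borel" for N pq by (simp add: pc.block_def)
  obtain C1 where C1: "C1 \<ge> 0" "\<And>x. \<bar>pc.phi n d x\<bar> \<le> C1"
    using pc.phi_bounded[of n d] d_interior by auto
  have U_meas [measurable]: "U N \<in> borel_measurable borel" for N
    unfolding U_def by measurable
  have U_bound: "\<bar>U N x\<bar> \<le> C1 + (\<Sum>pq\<in>pc.idx N. \<bar>?m N pq * (2 * of_int (\<kappa> N pq))\<bar>)" for N x
  proof -
    have "\<bar>U N x\<bar> \<le> \<bar>pc.phi n d x\<bar> + (\<Sum>pq\<in>pc.idx N. \<bar>?m N pq * (2 * of_int (\<kappa> N pq)) * indicator (pc.block N pq) x\<bar>)"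
      unfolding U_def by (rule order_trans[OF abs_triangle_ineq]) (intro add_left_mono sum_abs)
    also have "\<dots> \<le> C1 + (\<Sum>pq\<in>pc.idx N. \<bar>?m N pq * (2 * of_int (\<kappa> N pq))\<bar>)"
      using C1 by (intro add_mono sum_mono) (auto simp: indicator_def)
    finally show ?thesis .
  qed
  have lower_eq: "pc.lower n d N y = (\<Sum>i<n. U N (y i)) + K N + (\<Sum>pq\<in>pc.idx N. ?m N pq * H N pq y)" for N y
  proof -
    have "?m N pq * (real (occ n (pc.block N pq) y) ^ 2 - real (occ n (pc.block N pq) y)) =
       (\<Sum>i<n. ?m N pq * (2 * of_int (\<kappa> N pq)) * indicator (pc.block N pq) (y i))
       - ?m N pq * (of_int (\<kappa> N pq) * (of_int (\<kappa> N pq) + 1)) + ?m N pq * H N pq y" for pq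
      unfolding sum_distrib_left[symmetric] sum_indicator_eq_occ H_def
      by (simp add: algebra_simps power2_eq_square)
    then have "(\<Sum>pq\<in>pc.idx N. ?m N pq * (real (occ n (pc.block N pq) y) ^ 2 - real (occ n (pc.block N pq) y))) =
      (\<Sum>pq\<in>pc.idx N. (\<Sum>i<n. ?m N pq * (2 * of_int (\<kappa> N pq)) * indicator (pc.block N pq) (y i))
       - ?m N pq * (of_int (\<kappa> N pq) * (of_int (\<kappa> N pq) + 1)) + ?m N pq * H N pq y)"
      by (intro sum.cong) simp_all
    also have "\<dots> = (\<Sum>i<n. \<Sum>pq\<in>pc.idx N. ?m N pq * (2 * of_int (\<kappa> N pq)) * indicator (pc.block N pq) (y i))
       - (\<Sum>pq\<in>pc.idx N. ?m N pq * (of_int (\<kappa> N pq) * (of_int (\<kappa> N pq) + 1)))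
       + (\<Sum>pq\<in>pc.idx N. ?m N pq * H N pq y)"
      unfolding sum.distrib sum_subtractf by (subst sum.swap) (rule refl)
    finally show ?thesis
      unfolding pc.lower_def U_def K_def sum.distrib by linarith
  qed
  have H_nonneg: "0 \<le> H N pq y" for N pq y unfolding H_def by (rule integer_gap)
  have m_nonneg: "pq \<in> pc.idx N \<Longrightarrow> 0 \<le> ?m N pq" for N pq
    using pc.mix_nonneg[of "fst pq" "snd pq" N] by simp
  have lin_int: "integrable \<gamma>' (\<lambda>y. \<Sum>i<n. U N (y i))"
      "(\<integral>y. (\<Sum>i<n. U N (y i)) \<partial>\<gamma>') = real n * (\<integral>x. U N x \<partial>\<rho>)" if "\<gamma>' \<in> couplings n \<rho>" for \<gamma>' N
    using integral_coupling_sum[OF that U_meas U_bound] by auto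
  have lower_orb: "AE x in \<rho>. pc.lower n d N (orb x) = (\<Sum>i<n. U N (orb x i)) + K N" for N
  proof -
    have "AE x in \<rho>. \<forall>pq\<in>pc.idx N. \<forall>i<n. cdf \<rho> (orb x i) \<noteq> cdf \<rho> (dyadic a b N (Suc (fst pq))) \<and>
        cdf \<rho> (orb x i) \<noteq> cdf \<rho> (dyadic a b N (snd pq))"
      by (intro AE_finite_allI AE_orb_pointwise AE_conjI AE_level) simp
    with AE_orb_equispaced show ?thesis
    proof eventually_elim
      case (elim x)
      have "H N pq (orb x) = 0" if pq: "pq \<in> pc.idx N" for pq
      proof -
        have "dyadic a b N (Suc (fst pq)) \<le> dyadic a b N (snd pq)"
          using pq a_less_b by (auto simp: pc.idx_def)
        from equispaced_occ[OF elim(1) this] elim(2) pq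
        have "int (occ n (pc.block N pq) (orb x)) = \<kappa> N pq \<or> int (occ n (pc.block N pq) (orb x)) = \<kappa> N pq + 1"
          by (auto simp: pc.block_def \<kappa>_def)
        then have "real (occ n (pc.block N pq) (orb x)) = of_int (\<kappa> N pq) \<or>
            real (occ n (pc.block N pq) (orb x)) = of_int (\<kappa> N pq) + 1"
          by linarith
        then show ?thesis by (auto simp: H_def)
      qed
      then show ?case unfolding lower_eq by simp
    qed
  qed
  have lower_int: "integrable \<rho> (\<lambda>x. pc.lower n d N (orb x)) \<and>
      (\<integral>x. pc.lower n d N (orb x) \<partial>\<rho>) = real n * (\<integral>x. U N x \<partial>\<rho>) + K N" for N
  proof -
    have [measurable]: "pc.lower n d N \<in> borel_measurable (Rn n)"
      unfolding pc.lower_def by measurable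
    have m: "(\<lambda>x. pc.lower n d N (orb x)) \<in> borel_measurable \<rho>" by measurable
    have Um: "(\<lambda>y. \<Sum>i<n. U N (y i)) \<in> borel_measurable (Rn n)" by measurable
    have i: "integrable \<rho> (\<lambda>x. \<Sum>i<n. U N (orb x i))"
      using lin_int(1)[OF \<gamma>S, of N] Um unfolding \<gamma>S_def by (subst (asm) integrable_distr_eq) auto
    have e: "(\<integral>x. (\<Sum>i<n. U N (orb x i)) \<partial>\<rho>) = real n * (\<integral>x. U N x \<partial>\<rho>)"
      using lin_int(2)[OF \<gamma>S, of N] Um unfolding \<gamma>S_def by (subst (asm) integral_distr) auto
    have "(\<lambda>x. (\<Sum>i<n. U N (orb x i)) + K N) \<in> borel_measurable \<rho>" using i by auto
    then have "integrable \<rho> (\<lambda>x. pc.lower n d N (orb x)) \<longleftrightarrow> integrable \<rho> (\<lambda>x. (\<Sum>i<n. U N (orb x i)) + K N)"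
      using lower_orb[of N] m by (intro integrable_cong_AE) auto
    moreover have "(\<integral>x. pc.lower n d N (orb x) \<partial>\<rho>) = (\<integral>x. (\<Sum>i<n. U N (orb x i)) + K N \<partial>\<rho>)"
      using lower_orb[of N] m i by (intro integral_cong_AE) auto
    ultimately show ?thesis using i e prob_space by simp
  qed
  have B_meas: "B \<in> sets \<gamma>"
  proof -
    have "(\<lambda>y. real (occ n {s2..<t1} y)) \<in> borel_measurable \<gamma>"
      unfolding meq[OF \<gamma>] by measurable
    then show ?thesis unfolding B_def by measurable
  qed
  define gap where "gap = v s1 t2 + v s2 t1 - v s1 t1 - v s2 t2"
  have gap_le: "2 * gap * indicator B y \<le> (\<Sum>pq\<in>pc.idx N. ?m N pq * H N pq y)" if N: "N0 \<le> N" for N y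
  proof (cases "y \<in> B")
    case False
    then show ?thesis using H_nonneg m_nonneg by (auto intro!: sum_nonneg)
  next
    case True
    \<comment> \<open>Number of level-\<open>N\<close> steps in one step of level \<open>N0\<close>;
      the fixed rectangle becomes an \<open>r\<close>-fold refined rectangle of cells.\<close>
    define r :: nat where "r = 2 ^ (N - N0)"
    have r: "r > 0" by (simp add: r_def)
    have ref: "dyadic a b N0 p = dyadic a b N (p * r)" for p
      unfolding r_def by (rule dyadic_refine[OF N])
    have r2: "q2 * r \<le> 2 ^ N"
    proof -
      have "q2 * r \<le> 2 ^ N0 * r" using Q by simp
      also have "\<dots> = 2 ^ N" using N by (simp add: r_def flip: power_add)
      finally show ?thesis .
    qed
    let ?Q = "{p1 * r..<p2 * r} \<times> {q1 * r..<q2 * r}"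
    have p2q1: "p2 * r < q1 * r" using Q r by simp
    have sub: "?Q \<subseteq> pc.idx N"
    proof (safe, unfold pc.idx_def, safe)
      fix p q assume "p \<in> {p1 * r..<p2 * r}" "q \<in> {q1 * r..<q2 * r}"
      then have "p < p2 * r" "q1 * r \<le> q" "q < q2 * r" by simp_all
      with p2q1 r2 show "Suc p < q" "q < 2 ^ N" by linarith+
    qed
    \<comment> \<open>Such a block lies between \<open>{s2..<t1}\<close> and
      \<open>{s1..t2}\<close>: it inherits the large count of the inner interval, while its expected
      count is at most that of the outer one. Hence it has at least \<open>\<kappa> + 2\<close>
      points.\<close>
    have H2: "2 \<le> H N pq y" if pq: "pq \<in> ?Q" for pq
    proof -
      obtain p q where pq': "pq = (p, q)" "p1 * r \<le> p" "p < p2 * r" "q1 * r \<le> q" "q < q2 * r"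
        using pq by auto
      have s: "s1 \<le> dyadic a b N (Suc p)" "dyadic a b N (Suc p) \<le> s2"
        "t1 \<le> dyadic a b N q" "dyadic a b N q \<le> t2"
        unfolding s1_def s2_def t1_def t2_def ref using pq' a_less_b by auto
      have "{i. i < n \<and> y i \<in> {s2..<t1}} \<subseteq> {i. i < n \<and> y i \<in> pc.block N pq}"
        using s pq' by (auto simp: pc.block_def)
      then have o: "occ n {s2..<t1} y \<le> occ n (pc.block N pq) y"
        unfolding occ_def by (intro card_mono) auto
      have "real n * (cdf \<rho> (dyadic a b N q) - cdf \<rho> (dyadic a b N (Suc p))) \<le> real n * (cdf \<rho> t2 - cdf \<rho> s1)"
        using F_mono[OF s(1)] F_mono[OF s(4)] by (intro mult_left_mono) auto
      also have "\<dots> < real (occ n {s2..<t1} y) - 1" using True by (simp add: B_def)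
      also have "\<dots> \<le> real (occ n (pc.block N pq) y) - 1" using o by simp
      finally have "\<kappa> N pq < int (occ n (pc.block N pq) y) - 1"
        unfolding \<kappa>_def pq' fst_conv snd_conv by linarith
      then have "2 \<le> int (occ n (pc.block N pq) y) - \<kappa> N pq" by linarith
      then have 2: "2 \<le> real (occ n (pc.block N pq) y) - of_int (\<kappa> N pq)" by linarith
      have "2 * 1 \<le> H N pq y" unfolding H_def using 2 by (intro mult_mono) auto
      then show ?thesis by simp
    qed
    have "2 * gap = 2 * (\<Sum>pq\<in>?Q. ?m N pq)"
    proof -
      have "(\<Sum>pq\<in>?Q. ?m N pq) = (\<Sum>p=p1*r..<p2*r. \<Sum>q=q1*r..<q2*r. pc.mix N p q)"
        by (simp add: sum.cartesian_product case_prod_unfold)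
      also have "\<dots> = gap"
        using Q by (subst pc.sum_mix) (auto simp: gap_def s1_def s2_def t1_def t2_def ref pc.M_def)
      finally show ?thesis by simp
    qed
    also have "\<dots> \<le> (\<Sum>pq\<in>?Q. ?m N pq * H N pq y)"
      unfolding sum_distrib_left
    proof (rule sum_mono)
      fix pq assume "pq \<in> ?Q"
      then show "2 * ?m N pq \<le> ?m N pq * H N pq y"
        using H2[of pq] m_nonneg[of pq N] sub mult_left_mono[of 2 "H N pq y" "?m N pq"] by auto
    qed
    also have "\<dots> \<le> (\<Sum>pq\<in>pc.idx N. ?m N pq * H N pq y)"
      using sub H_nonneg m_nonneg by (intro sum_mono2) auto
    finally show ?thesis using True by simp
  qed
  have upper: "(\<integral>x. pc.lower n d N (orb x) \<partial>\<rho>) \<le> (\<integral>y. C y \<partial>\<gamma>) - 2 * gap * measure \<gamma> B" if N: "N0 \<le> N" for N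
  proof -
    have "AE y in \<gamma>. (\<Sum>i<n. U N (y i)) + K N + 2 * gap * indicator B y \<le> C y"
      using ok le AE_coupling[OF \<gamma> AE_interior]
    proof eventually_elim
      case (elim y)
      have "pc.lower n d N y \<le> pair_sum n v y"
        unfolding pair_sum_def using elim n by (intro pc.lower_le) auto
      then show ?case using gap_le[OF N, of y] elim unfolding lower_eq by linarith
    qed
    moreover have i1: "integrable \<gamma> (\<lambda>y. (\<Sum>i<n. U N (y i)) + K N + 2 * gap * indicator B y)"
      using lin_int(1)[OF \<gamma>, of N] B_meas
      by (intro Bochner_Integration.integrable_add integrable_mult_right integrable_real_indicator)
         (auto simp: \<gamma>.emeasure_eq_measure)
    ultimately have "(\<integral>y. (\<Sum>i<n. U N (y i)) + K N + 2 * gap * indicator B y \<partial>\<gamma>) \<le> (\<integral>y. C y \<partial>\<gamma>)"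
      using C by (intro integral_mono_AE) auto
    also have "(\<integral>y. (\<Sum>i<n. U N (y i)) + K N + 2 * gap * indicator B y \<partial>\<gamma>) =
        real n * (\<integral>x. U N x \<partial>\<rho>) + K N + 2 * gap * measure \<gamma> B"
    proof -
      have "integrable \<gamma> (\<lambda>y. (\<Sum>i<n. U N (y i)) + K N)" using lin_int(1)[OF \<gamma>, of N] by simp
      moreover have "integrable \<gamma> (\<lambda>y. 2 * gap * indicator B y)"
        using B_meas by (intro integrable_mult_right integrable_real_indicator) (auto simp: \<gamma>.emeasure_eq_measure)
      ultimately have "(\<integral>y. (\<Sum>i<n. U N (y i)) + K N + 2 * gap * indicator B y \<partial>\<gamma>) =
        (\<integral>y. (\<Sum>i<n. U N (y i)) + K N \<partial>\<gamma>) + (\<integral>y. 2 * gap * indicator B y \<partial>\<gamma>)"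
        by (rule Bochner_Integration.integral_add)
      also have "\<dots> = real n * (\<integral>x. U N x \<partial>\<rho>) + K N + 2 * gap * measure \<gamma> B"
        using lin_int[OF \<gamma>, of N] B_meas by (simp add: \<gamma>.prob_space)
      finally show ?thesis .
    qed
    finally show ?thesis using lower_int[of N] by simp
  qed
  have "integrable \<rho> (\<lambda>x. pair_sum n v (orb x)) \<and>
      (\<integral>x. pair_sum n v (orb x) \<partial>\<rho>) \<le> (\<integral>y. C y \<partial>\<gamma>) - 2 * gap * measure \<gamma> B"
  \<comment> \<open>The uniform lower bound comes from dropping the block part, nonnegative since
    \<open>m^2 - m \<ge> 0\<close> for naturals; the bounded \<open>phi\<close> and the constant
    \<open>offset\<close> remain.\<close>
  proof (rule integral_le_of_AE_limit[where f = "\<lambda>N x. pc.lower n d N (orb x)" and C = "real n * C1 + \<bar>pc.offset n d\<bar>"])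
    show "finite_measure \<rho>" by unfold_locales
    show "integrable \<rho> (\<lambda>x. pc.lower n d N (orb x))" for N using lower_int by simp
    have vm: "(\<lambda>x. v (f x) (g x)) \<in> borel_measurable borel"
      if "f \<in> borel_measurable borel" "g \<in> borel_measurable borel" for f g :: "real \<Rightarrow> real"
    proof -
      have "(\<lambda>x. (f x, g x)) \<in> measurable borel borel" using that by (rule borel_measurable_Pair)
      from measurable_compose[OF this v_meas] show ?thesis by simp
    qed
    have om: "(\<lambda>x. orb x i) \<in> borel_measurable borel" if "i < n" for i
      using that by (intro measurable_compose[OF orb_measurable measurable_component_singleton]) simp
    have "(\<lambda>x. pair_sum n v (orb x)) \<in> borel_measurable borel"
      unfolding pair_sum_def by (intro borel_measurable_sum vm borel_measurable_min borel_measurable_max om) auto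
    then show "(\<lambda>x. pair_sum n v (orb x)) \<in> borel_measurable \<rho>" by simp
    show "AE x in \<rho>. - (real n * C1 + \<bar>pc.offset n d\<bar>) \<le> pc.lower n d N (orb x)" for N
    proof (rule AE_I2)
      fix x
      have "0 \<le> (\<Sum>pq\<in>pc.idx N. ?m N pq * (real (occ n (pc.block N pq) (orb x)) ^ 2 - real (occ n (pc.block N pq) (orb x))))"
      proof (intro sum_nonneg mult_nonneg_nonneg m_nonneg)
        fix pq
        show "0 \<le> real (occ n (pc.block N pq) (orb x)) ^ 2 - real (occ n (pc.block N pq) (orb x))"
          using integer_gap[of "occ n (pc.block N pq) (orb x)" 0] by (simp add: power2_eq_square algebra_simps)
      qed
      moreover have "- (real n * C1) \<le> (\<Sum>i<n. pc.phi n d (orb x i))"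
      proof -
        have "(\<Sum>i<n. - C1) \<le> (\<Sum>i<n. pc.phi n d (orb x i))"
          using C1(2) by (intro sum_mono) (simp add: abs_le_iff minus_le_iff)
        then show ?thesis by simp
      qed
      ultimately show "- (real n * C1 + \<bar>pc.offset n d\<bar>) \<le> pc.lower n d N (orb x)"
        unfolding pc.lower_def by linarith
    qed
    show "AE x in \<rho>. (\<lambda>N. pc.lower n d N (orb x)) \<longlonglongrightarrow> pair_sum n v (orb x)"
      using AE_orb_equispaced
    proof eventually_elim
      case (elim x)
      obtain \<tau> where \<tau>: "bij_betw \<tau> {..<n} {..<n}" "\<And>j. j < n \<Longrightarrow> d j < orb x (\<tau> j)"
        "\<And>j. j < n \<Longrightarrow> orb x (\<tau> j) < d (Suc j)"
        "\<And>i. i < n \<Longrightarrow> a < orb x i \<and> orb x i < b" "inj_on (orb x) {..<n}"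
        using equispaced_interlaced[OF elim] by blast
      show ?case unfolding pair_sum_def
        using n d_interior \<tau> by (intro pc.lower_tendsto[where \<sigma> = \<tau>]) auto
    qed
    show "eventually (\<lambda>N. (\<integral>x. pc.lower n d N (orb x) \<partial>\<rho>) \<le> (\<integral>y. C y \<partial>\<gamma>) - 2 * gap * measure \<gamma> B) sequentially"
      by (intro eventually_sequentiallyI[of N0] upper)
  qed
  then show ?thesis by (simp add: gap_def)
qed

end

section \<open>Well-ordering costs\<close>

lemma permutes_lessThan_4I:
  assumes "bij_betw \<sigma> {0, 1, 2, 3} {0, 1, 2, 3}" "\<And>k. k \<ge> 4 \<Longrightarrow> \<sigma> k = k"
  shows "\<sigma> permutes {..<4::nat}"
proof -
  have "{..<4::nat} = {0, 1, 2, 3}" by auto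
  then show ?thesis using assms by (intro bij_imp_permutes) auto
qed

text \<open>Representatives of the three ways to pair four points: 01|23 (neighbours), 02|13
  (crossing, as in the Seidl plan) and 03|12 (nested).\<close>

lemma permutes_pairings:
  "id permutes {..<4::nat}" "id(1 := 2, 2 := 1) permutes {..<4::nat}" "id(1 := 3, 2 := 1, 3 := 2) permutes {..<4::nat}"
  by (auto intro!: permutes_lessThan_4I simp: bij_betw_def inj_on_def)

lemma well_orderingD:
  assumes "well_ordering J w" "x1 \<in> J" "x2 \<in> J" "x3 \<in> J" "x4 \<in> J" "x1 \<le> x2" "x2 \<le> x3" "x3 \<le> x4"
  shows "w x1 x3 + w x2 x4 \<le> w x1 x2 + w x3 x4" "w x1 x3 + w x2 x4 \<le> w x1 x4 + w x2 x3"
proof -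
  define x where "x = (\<lambda>k::nat. [x1, x2, x3, x4] ! k)"
  have eq: "w x1 x3 + w x2 x4 =
      Min ((\<lambda>\<sigma>. w (x (\<sigma> 0)) (x (\<sigma> 1)) + w (x (\<sigma> 2)) (x (\<sigma> 3))) ` {\<sigma>. \<sigma> permutes {..<4::nat}})"
    using assms unfolding well_ordering_def x_def Let_def by blast
  have le: "w x1 x3 + w x2 x4 \<le> w (x (\<sigma> 0)) (x (\<sigma> 1)) + w (x (\<sigma> 2)) (x (\<sigma> 3))"
    if "\<sigma> permutes {..<4::nat}" for \<sigma>
    unfolding eq using that by (intro Min_le) (auto simp: finite_permutations)
  show "w x1 x3 + w x2 x4 \<le> w x1 x2 + w x3 x4"
    using le[OF permutes_pairings(1)] by (simp add: x_def numeral_2_eq_2 numeral_3_eq_3)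
  show "w x1 x3 + w x2 x4 \<le> w x1 x4 + w x2 x3"
    using le[OF permutes_pairings(3)] by (simp add: x_def numeral_2_eq_2 numeral_3_eq_3)
qed

lemma well_orderingI:
  assumes cont: "continuous_on (J \<times> J) (\<lambda>(x, y). w x y)" and sym: "\<forall>x\<in>J. \<forall>y\<in>J. w x y = w y x"
    and le1: "\<And>x1 x2 x3 x4. \<lbrakk>x1 \<in> J; x2 \<in> J; x3 \<in> J; x4 \<in> J; x1 \<le> x2; x2 \<le> x3; x3 \<le> x4\<rbrakk> \<Longrightarrow>
        w x1 x3 + w x2 x4 \<le> w x1 x2 + w x3 x4"
    and le2: "\<And>x1 x2 x3 x4. \<lbrakk>x1 \<in> J; x2 \<in> J; x3 \<in> J; x4 \<in> J; x1 \<le> x2; x2 \<le> x3; x3 \<le> x4\<rbrakk> \<Longrightarrow>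
        w x1 x3 + w x2 x4 \<le> w x1 x4 + w x2 x3"
  shows "well_ordering J w"
  unfolding well_ordering_def Let_def
proof (intro conjI cont sym ballI impI)
  fix x1 x2 x3 x4 assume J: "x1 \<in> J" "x2 \<in> J" "x3 \<in> J" "x4 \<in> J" and x: "x1 \<le> x2 \<and> x2 \<le> x3 \<and> x3 \<le> x4"
  define x where "x = (\<lambda>k::nat. [x1, x2, x3, x4] ! k)"
  have x_simps: "x 0 = x1" "x (Suc 0) = x2" "x 2 = x3" "x 3 = x4"
    by (simp_all add: x_def numeral_2_eq_2 numeral_3_eq_3)
  let ?f = "\<lambda>\<sigma>. w (x (\<sigma> 0)) (x (\<sigma> 1)) + w (x (\<sigma> 2)) (x (\<sigma> 3))"
  have "Min (?f ` {\<sigma>. \<sigma> permutes {..<4::nat}}) = w x1 x3 + w x2 x4"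
  proof (rule Min_eqI)
    show "finite (?f ` {\<sigma>. \<sigma> permutes {..<4::nat}})" by (simp add: finite_permutations)
    show "w x1 x3 + w x2 x4 \<in> ?f ` {\<sigma>. \<sigma> permutes {..<4::nat}}"
      using permutes_pairings(2) by (intro image_eqI[of _ _ "id(1 := 2, 2 := 1)"]) (auto simp: x_simps)
    fix z assume "z \<in> ?f ` {\<sigma>. \<sigma> permutes {..<4::nat}}"
    then obtain \<sigma> where \<sigma>: "\<sigma> permutes {..<4::nat}" and z: "z = ?f \<sigma>" by auto
    have in4: "\<sigma> k \<in> {0, 1, 2, 3}" if "k < 4" for k
    proof -
      have "\<sigma> k < 4" using permutes_in_image[OF \<sigma>, of k] that by simp
      then show ?thesis by auto
    qed
    have inj: "\<sigma> k = \<sigma> l \<longleftrightarrow> k = l" for k l using permutes_inj[OF \<sigma>] by (auto dest: injD)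
    have s: "w x2 x1 = w x1 x2" "w x3 x1 = w x1 x3" "w x4 x1 = w x1 x4" "w x3 x2 = w x2 x3" "w x4 x2 = w x2 x4"
      "w x4 x3 = w x3 x4" using sym J by blast+
    have L: "w x1 x3 + w x2 x4 \<le> w x1 x2 + w x3 x4" "w x1 x3 + w x2 x4 \<le> w x1 x4 + w x2 x3"
      using le1 le2 J x by blast+
    have "\<sigma> 0 \<noteq> \<sigma> 1" "\<sigma> 0 \<noteq> \<sigma> 2" "\<sigma> 0 \<noteq> \<sigma> 3" "\<sigma> 1 \<noteq> \<sigma> 2" "\<sigma> 1 \<noteq> \<sigma> 3" "\<sigma> 2 \<noteq> \<sigma> 3"
      by (simp_all add: inj)
    moreover have "\<sigma> 0 \<in> {0, 1, 2, 3}" "\<sigma> 1 \<in> {0, 1, 2, 3}" "\<sigma> 2 \<in> {0, 1, 2, 3}" "\<sigma> 3 \<in> {0, 1, 2, 3}"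
      by (simp_all only: in4)
    \<comment> \<open>All assignments of four indices are tried; those with repetitions contradict
      injectivity, and by symmetry the remaining 24 fall into the three pairings.\<close>
    ultimately show "w x1 x3 + w x2 x4 \<le> z"
      unfolding z using L by (elim insertE emptyE) (simp_all add: x_simps s add.commute)
  qed
  then show "w x1 x3 + w x2 x4 =
      Min ((\<lambda>\<sigma>. w ([x1, x2, x3, x4] ! \<sigma> 0) ([x1, x2, x3, x4] ! \<sigma> 1) +
        w ([x1, x2, x3, x4] ! \<sigma> 2) ([x1, x2, x3, x4] ! \<sigma> 3)) ` {\<sigma>. \<sigma> permutes {..<4::nat}})"
    by (simp add: x_def)
qed

text \<open>Equality would require \<open>{x1, x3}\<close> to be one of the pairs
  \<open>{x1, x4}\<close> and \<open>{x2, x3}\<close> of the nested pairing, that is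
  \<open>x3 = x4\<close> or \<open>x1 = x2\<close>.\<close>

lemma strictly_well_orderingD:
  assumes "strictly_well_ordering J w" "x1 \<in> J" "x2 \<in> J" "x3 \<in> J" "x4 \<in> J" "x1 < x2" "x2 \<le> x3" "x3 < x4"
    and fin: "w x1 x3 + w x2 x4 \<noteq> \<infinity>"
  shows "w x1 x3 + w x2 x4 < w x1 x4 + w x2 x3"
proof -
  define x where "x = (\<lambda>k::nat. [x1, x2, x3, x4] ! k)"
  have S: "\<forall>\<sigma>. \<sigma> permutes {..<4::nat} \<longrightarrow>
           w x1 x3 + w x2 x4 = w (x (\<sigma> 0)) (x (\<sigma> 1)) + w (x (\<sigma> 2)) (x (\<sigma> 3)) \<longrightarrow>
           (w x1 x3 + w x2 x4 = \<infinity> \<or> {#x1, x3#} = {#x (\<sigma> 0), x (\<sigma> 1)#} \<or> {#x1, x3#} = {#x (\<sigma> 2), x (\<sigma> 3)#})"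
    using assms unfolding strictly_well_ordering_def x_def Let_def by (meson less_imp_le)
  have "w x1 x3 + w x2 x4 \<noteq> w x1 x4 + w x2 x3"
    using S[rule_format, OF permutes_pairings(3)] fin assms(6-8)
    by (auto simp: x_def numeral_2_eq_2 numeral_3_eq_3 add_eq_conv_ex)
  moreover have "w x1 x3 + w x2 x4 \<le> w x1 x4 + w x2 x3"
    using assms by (intro well_orderingD(2)[of J]) (auto simp: strictly_well_ordering_def)
  ultimately show ?thesis by simp
qed

text \<open>\<open>w\<close> may be infinite on the diagonal and, as for a cost on a circle, at the corner \<open>(a, b)\<close>.\<close>

locale wo_cost =
  fixes a b :: real and w :: "real \<Rightarrow> real \<Rightarrow> ereal" and C :: real
  assumes ab: "a < b" and C: "0 \<le> C"
    and w_cont: "continuous_on UNIV (\<lambda>z. w (fst z) (snd z))"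
    and w_sym: "\<And>x y. w x y = w y x"
    and w_ge: "\<And>x y. ereal (- C) \<le> w x y"
    and wo1: "\<And>x1 x2 x3 x4. a \<le> x1 \<Longrightarrow> x1 \<le> x2 \<Longrightarrow> x2 \<le> x3 \<Longrightarrow> x3 \<le> x4 \<Longrightarrow> x4 \<le> b \<Longrightarrow>
        w x1 x3 + w x2 x4 \<le> w x1 x2 + w x3 x4"
    and wo2: "\<And>x1 x2 x3 x4. a \<le> x1 \<Longrightarrow> x1 \<le> x2 \<Longrightarrow> x2 \<le> x3 \<Longrightarrow> x3 \<le> x4 \<Longrightarrow> x4 \<le> b \<Longrightarrow>
        w x1 x3 + w x2 x4 \<le> w x1 x4 + w x2 x3"
    and w_fin: "\<And>x y. a \<le> x \<Longrightarrow> x < y \<Longrightarrow> y \<le> b \<Longrightarrow> a < x \<or> y < b \<Longrightarrow> w x y \<noteq> \<infinity>"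
begin

definition r :: "real \<Rightarrow> real \<Rightarrow> real" where "r x y = real_of_ereal (w x y)"

lemma w_not_minf: "w x y \<noteq> - \<infinity>"
  using w_ge[of x y] by auto

lemma w_eq: "w x y \<noteq> \<infinity> \<Longrightarrow> w x y = ereal (r x y)"
  using w_not_minf[of x y] by (cases "w x y") (auto simp: r_def)

text \<open>Where \<open>w\<close> is infinite, \<open>r\<close> has the default value 0, which
  \<open>C \<ge> 0\<close> covers.\<close>

lemma r_ge: "- C \<le> r x y"
  using w_ge[of x y] C by (cases "w x y") (auto simp: r_def)

lemma r_sym: "r x y = r y x"
  by (simp add: r_def w_sym)

text \<open>Of the four pairs only \<open>x2, x3\<close> can meet the diagonal and only
  \<open>x1, x4\<close> can be the corner. The two disjunctive hypotheses exclude an infinite value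
  in these places, so that the inequality passes to reals.\<close>

lemma r_sub:
  assumes "a \<le> x1" "x1 \<le> x2" "x2 \<le> x3" "x3 \<le> x4" "x4 \<le> b" "x2 < x3 \<or> w x2 x2 \<noteq> \<infinity>" "a < x1 \<or> x4 < b"
  shows "r x1 x3 + r x2 x4 \<le> r x1 x4 + r x2 x3"
proof -
  have fin: "w x y \<noteq> \<infinity>" if "x \<in> {x1, x2}" "y \<in> {x3, x4}" for x y
  proof (cases "x < y")
    case True
    then show ?thesis using that assms by (intro w_fin) auto
  next
    case False
    then have "x2 = x3" "x = x2" "y = x2" using that assms by auto
    then show ?thesis using assms by auto
  qed
  have "ereal (r x1 x3) + ereal (r x2 x4) \<le> ereal (r x1 x4) + ereal (r x2 x3)"
    using wo2[of x1 x2 x3 x4] assms fin by (simp add: w_eq[symmetric])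
  then show ?thesis by simp
qed

lemma r_cross:
  assumes "a \<le> x1" "x1 < x2" "x2 \<le> x3" "x3 < x4" "x4 \<le> b"
  shows "r x1 x3 + r x2 x4 \<le> r x1 x2 + r x3 x4"
proof -
  have "w x1 x3 \<noteq> \<infinity>" "w x2 x4 \<noteq> \<infinity>" "w x1 x2 \<noteq> \<infinity>" "w x3 x4 \<noteq> \<infinity>"
    by (intro w_fin; use assms in simp)+
  then have "ereal (r x1 x3) + ereal (r x2 x4) \<le> ereal (r x1 x2) + ereal (r x3 x4)"
    using wo1[of x1 x2 x3 x4] assms by (simp add: w_eq[symmetric])
  then show ?thesis by simp
qed

lemma r_cont: "continuous_on {(x, y). a \<le> x \<and> x < y \<and> y \<le> b \<and> (a < x \<or> y < b)} (\<lambda>z. r (fst z) (snd z))"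
proof -
  let ?\<Delta> = "{(x, y). a \<le> x \<and> x < y \<and> y \<le> b \<and> (a < x \<or> y < b)}"
  have "continuous_on ?\<Delta> (\<lambda>z. w (fst z) (snd z))"
    using w_cont by (rule continuous_on_subset) simp
  moreover have "\<bar>w (fst z) (snd z)\<bar> \<noteq> \<infinity>" if "z \<in> ?\<Delta>" for z
    using that w_fin[of "fst z" "snd z"] w_not_minf[of "fst z" "snd z"] by auto
  ultimately have "continuous_on ?\<Delta> (real_of_ereal \<circ> (\<lambda>z. w (fst z) (snd z)))"
    by (subst continuous_on_iff_real[symmetric]) auto
  then show ?thesis by (simp add: r_def comp_def)
qed

lemma r_measurable: "(\<lambda>z. r (fst z) (snd z)) \<in> borel_measurable borel"
proof -
  have "(\<lambda>z. w (fst z) (snd z)) \<in> borel_measurable borel"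
    using w_cont by (rule borel_measurable_continuous_onI)
  then show ?thesis unfolding r_def by measurable
qed

text \<open>Near the corner \<open>r\<close> is replaced by a sum of a function of \<open>x\<close>
  and a function of \<open>y\<close> that agrees with \<open>r\<close> along
  \<open>x = \<alpha>\<close> and \<open>y = \<beta>\<close>. Its mixed differences are zero, the
  least allowed, and it is determined by values of \<open>r\<close> away from the corner; by
  \<open>r_sub\<close> it lies below \<open>r\<close>.\<close>

definition cut :: "real \<Rightarrow> real \<Rightarrow> real \<Rightarrow> real \<Rightarrow> real" where
  "cut \<alpha> \<beta> x y = (if x < \<alpha> \<and> \<beta> < y then r x \<beta> + r \<alpha> y - r \<alpha> \<beta> else r x y)"

lemma cut_measurable: "(\<lambda>z. cut \<alpha> \<beta> (fst z) (snd z)) \<in> borel_measurable borel"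
proof -
  have rm [measurable]: "(\<lambda>z. r (f z) (g z)) \<in> borel_measurable (borel \<Otimes>\<^sub>M borel)"
    if "f \<in> borel_measurable (borel \<Otimes>\<^sub>M borel)" "g \<in> borel_measurable (borel \<Otimes>\<^sub>M borel)" for f g :: "real \<times> real \<Rightarrow> real"
  proof -
    have "(\<lambda>z. (f z, g z)) \<in> measurable (borel \<Otimes>\<^sub>M borel) borel" using that by (rule borel_measurable_Pair)
    from measurable_compose[OF this r_measurable] show ?thesis by simp
  qed
  show ?thesis unfolding cut_def borel_prod[symmetric] by measurable
qed

lemma cut_le:
  assumes "a < x" "x \<le> y" "y < b" "\<alpha> < \<beta>" "a < \<alpha>" "\<beta> < b"
  shows "cut \<alpha> \<beta> x y \<le> r x y"
  using assms r_sub[of x \<alpha> \<beta> y] by (auto simp: cut_def)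

lemma cut_pair_cost:
  assumes \<alpha>: "a < \<alpha>" and \<alpha>\<beta>: "\<alpha> < \<beta>" and \<beta>: "\<beta> < b"
  shows "pair_cost a b (cut \<alpha> \<beta>) {x. w x x \<noteq> \<infinity>}"
proof
  show "a < b" by (rule ab)
next
  fix x1 x2 x3 x4 assume x: "a \<le> x1" "x1 \<le> x2" "x2 \<le> x3" "x3 \<le> x4" "x4 \<le> b"
    and ok: "x2 < x3 \<or> x2 \<in> {x. w x x \<noteq> \<infinity>}"
  show "cut \<alpha> \<beta> x1 x3 + cut \<alpha> \<beta> x2 x4 \<le> cut \<alpha> \<beta> x1 x4 + cut \<alpha> \<beta> x2 x3"
  proof (cases "x1 < \<alpha> \<and> \<beta> < x4")
    case False
    then show ?thesis using x ok \<alpha> \<beta> r_sub[of x1 x2 x3 x4] by (auto simp: cut_def)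
  next
    case corner: True
    \<comment> \<open>The cases say which parts of the rectangle from \<open>x1, x2\<close> and
      \<open>x3, x4\<close> reach out of the corner region. The part inside contributes nothing, so
      the inequality for \<open>r\<close> is applied to the rest.\<close>
    consider "x2 < \<alpha>" "\<beta> < x3" | "\<alpha> \<le> x2" "\<beta> < x3" | "x2 < \<alpha>" "x3 \<le> \<beta>" | "\<alpha> \<le> x2" "x3 \<le> \<beta>"
      by linarith
    then show ?thesis
    proof cases
      case 1
      then show ?thesis using corner by (simp add: cut_def)
    next
      case 2
      then show ?thesis using corner x ok \<alpha> r_sub[of \<alpha> x2 x3 x4] by (simp add: cut_def)
    next
      case 3
      then show ?thesis using corner x ok \<beta> r_sub[of x1 x2 x3 \<beta>] by (simp add: cut_def)
    next
      case 4
      \<comment> \<open>The part outside the corner region is L-shaped and is split at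
        \<open>x = \<alpha>\<close> into two rectangles, one inequality for each.\<close>
      then have "r \<alpha> x3 + r x2 x4 \<le> r \<alpha> x4 + r x2 x3" using x ok corner \<alpha> by (intro r_sub) auto
      moreover have "r x1 x3 + r \<alpha> \<beta> \<le> r x1 \<beta> + r \<alpha> x3"
      proof (rule r_sub)
        show "\<alpha> < x3 \<or> w \<alpha> \<alpha> \<noteq> \<infinity>"
        proof (cases "\<alpha> < x3")
          case False
          then have "x2 = \<alpha>" "x3 = \<alpha>" using 4 x by auto
          then show ?thesis using ok by simp
        qed simp
      qed (use x corner \<alpha> \<beta> 4 in auto)
      ultimately show ?thesis using corner 4 by (simp add: cut_def)
    qed
  qed
next
  fix x y assume xy: "a < x" "x \<le> y" "y < b"
  \<comment> \<open>Up to constants \<open>D x\<close> is \<open>r x \<beta> - r a x\<close> to the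
    left of \<open>\<alpha>\<close>, \<open>r x b - r a x\<close> in the middle and
    \<open>r x b - r \<alpha> x\<close> to the right of \<open>\<beta>\<close>. Each piece increases
    by \<open>r_cross\<close>, and the pieces share their end points.\<close>
  define D where "D x = cut \<alpha> \<beta> x b - cut \<alpha> \<beta> a x" for x
  have l: "D x \<le> D y" if "a < x" "x \<le> y" "y \<le> \<alpha>" for x y
    using that \<alpha>\<beta> \<beta> \<alpha> r_cross[of a x y \<beta>] by (cases "x = y") (auto simp: D_def cut_def)
  have m: "D x \<le> D y" if "\<alpha> \<le> x" "x \<le> y" "y \<le> \<beta>" for x y
    using that \<alpha>\<beta> \<beta> \<alpha> r_cross[of a x y b] by (cases "x = y") (auto simp: D_def cut_def)
  have u: "D x \<le> D y" if "\<beta> \<le> x" "x \<le> y" "y < b" for x y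
    using that \<alpha>\<beta> \<beta> \<alpha> r_cross[of \<alpha> x y b] by (cases "x = y") (auto simp: D_def cut_def)
  have lm: "D x \<le> D y" if "a < x" "x \<le> y" "y \<le> \<beta>" for x y
    using that l[of x y] m[of x y] l[of x \<alpha>] m[of \<alpha> y] \<alpha>\<beta> \<alpha> by fastforce
  have "D x \<le> D y"
    using xy lm[of x y] u[of x y] lm[of x \<beta>] u[of \<beta> y] \<beta> by fastforce
  then show "cut \<alpha> \<beta> x b - cut \<alpha> \<beta> a x \<le> cut \<alpha> \<beta> y b - cut \<alpha> \<beta> a y" by (simp add: D_def)
next
  let ?\<Delta> = "{(x, y). a \<le> x \<and> x < y \<and> y \<le> b}"
  let ?S = "?\<Delta> \<inter> {z. fst z \<le> \<alpha> \<and> \<beta> \<le> snd z}" and ?T = "?\<Delta> \<inter> {z. \<alpha> \<le> fst z \<or> snd z \<le> \<beta>}"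
  let ?P = "\<lambda>z::real \<times> real. fst z < \<alpha> \<and> \<beta> < snd z"
  have rc: "continuous_on A (\<lambda>z. r (f z) (g z))"
    if "continuous_on A f" "continuous_on A g" "\<And>z. z \<in> A \<Longrightarrow> a \<le> f z \<and> f z < g z \<and> g z \<le> b \<and> (a < f z \<or> g z < b)"
    for A and f g :: "real \<times> real \<Rightarrow> real"
  proof -
    have "continuous_on A (\<lambda>z. (f z, g z))" using that by (intro continuous_intros)
    from continuous_on_compose2[OF r_cont this] have
      "(\<lambda>z. (f z, g z)) ` A \<subseteq> {(x, y). a \<le> x \<and> x < y \<and> y \<le> b \<and> (a < x \<or> y < b)} \<Longrightarrow> ?thesis" by simp
    then show ?thesis using that(3) by blast
  qed
  \<comment> \<open>Two relatively closed sets cover the triangle; on their overlap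
    \<open>x = \<alpha>\<close> or \<open>y = \<beta>\<close>, where both formulas agree.\<close>
  have U: "?S \<union> ?T = ?\<Delta>" by auto
  have cl: "closed {z. fst z \<le> \<alpha> \<and> \<beta> \<le> snd z}" "closed {z. \<alpha> \<le> fst z \<or> snd z \<le> \<beta>}"
    by (intro closed_Collect_conj closed_Collect_disj closed_Collect_le continuous_intros)+
  have "continuous_on (?S \<union> ?T) (\<lambda>z. if ?P z then r (fst z) \<beta> + r \<alpha> (snd z) - r \<alpha> \<beta> else r (fst z) (snd z))"
  proof (rule continuous_on_cases_local)
    show "closedin (top_of_set (?S \<union> ?T)) ?S" "closedin (top_of_set (?S \<union> ?T)) ?T"
      unfolding U using cl by (auto intro!: closedin_closed_Int)
    show "continuous_on ?S (\<lambda>z. r (fst z) \<beta> + r \<alpha> (snd z) - r \<alpha> \<beta>)"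
      using \<alpha> \<alpha>\<beta> \<beta> by (intro continuous_intros rc) auto
    show "continuous_on ?T (\<lambda>z. r (fst z) (snd z))"
      using \<alpha> \<alpha>\<beta> \<beta> by (intro rc continuous_intros) auto
    show "r (fst z) \<beta> + r \<alpha> (snd z) - r \<alpha> \<beta> = r (fst z) (snd z)" if "z \<in> ?S \<and> \<not> ?P z \<or> z \<in> ?T \<and> ?P z" for z
      using that by (auto simp: not_less)
  qed
  then show "continuous_on ?\<Delta> (\<lambda>(x, y). cut \<alpha> \<beta> x y)"
    unfolding U by (simp add: cut_def case_prod_unfold)
qed

text \<open>Fatou needs a lower bound uniform in \<open>k\<close>, and
  \<open>r x \<beta> - r \<alpha> \<beta>\<close> has to be controlled for this. So
  \<open>\<alpha> k\<close> is chosen after \<open>\<beta> k\<close>, so close to \<open>a\<close>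
  that \<open>r x (\<beta> k)\<close> is within 1 of \<open>r a (\<beta> k)\<close> for
  \<open>x \<le> \<alpha> k\<close>; two such comparisons turn \<open>C\<close> into
  \<open>C + 2\<close>. That \<open>\<alpha> k\<close> tends to \<open>a\<close> makes the cutoff
  invisible at any fixed \<open>x > a\<close> from some \<open>k\<close> on.\<close>

lemma cut_sequence:
  obtains \<alpha> \<beta> :: "nat \<Rightarrow> real" where "\<And>k. a < \<alpha> k" "\<And>k. \<alpha> k < \<beta> k" "\<And>k. \<beta> k < b" "\<alpha> \<longlonglongrightarrow> a"
    "\<And>k x y. a \<le> x \<Longrightarrow> - (C + 2) \<le> cut (\<alpha> k) (\<beta> k) x y"
proof -
  define \<beta> where "\<beta> k = b - (b - a) / (real k + 2)" for k :: nat
  have \<beta>: "(a + b) / 2 \<le> \<beta> k" "\<beta> k < b" for k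
  proof -
    have "(b - a) / (real k + 2) \<le> (b - a) / 2" using ab by (intro divide_left_mono) auto
    then show "(a + b) / 2 \<le> \<beta> k" unfolding \<beta>_def by argo
    show "\<beta> k < b" using ab by (simp add: \<beta>_def)
  qed
  have "\<exists>\<alpha>. a < \<alpha> \<and> \<alpha> < \<beta> k \<and> \<alpha> \<le> a + (b - a) / (real k + 3) \<and> (\<forall>x. a \<le> x \<and> x \<le> \<alpha> \<longrightarrow> \<bar>r x (\<beta> k) - r a (\<beta> k)\<bar> < 1)" for k
  proof -
    have a\<beta>: "a < \<beta> k" using \<beta>[of k] ab by (simp add: field_simps)
    have "continuous_on {a..<\<beta> k} (\<lambda>x. r (fst (x, \<beta> k)) (snd (x, \<beta> k)))"
      using \<beta>[of k] by (intro continuous_on_compose2[OF r_cont] continuous_intros) auto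
    then have "continuous_on {a..<\<beta> k} (\<lambda>x. r x (\<beta> k))" by simp
    then obtain \<delta> where \<delta>: "\<delta> > 0" "\<And>x. x \<in> {a..<\<beta> k} \<Longrightarrow> dist x a < \<delta> \<Longrightarrow> dist (r x (\<beta> k)) (r a (\<beta> k)) < 1"
      unfolding continuous_on_iff using a\<beta> by (metis atLeastLessThan_iff order_refl zero_less_one)
    define \<alpha> where "\<alpha> = min (a + \<delta> / 2) (min ((a + \<beta> k) / 2) (a + (b - a) / (real k + 3)))"
    have "a < \<alpha>" using \<delta> a\<beta> ab by (simp add: \<alpha>_def)
    moreover have "\<alpha> < \<beta> k" using a\<beta> unfolding \<alpha>_def by (simp add: min_less_iff_disj)
    moreover have "\<bar>r x (\<beta> k) - r a (\<beta> k)\<bar> < 1" if "a \<le> x" "x \<le> \<alpha>" for x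
      using \<delta>(2)[of x] \<delta>(1) that \<open>\<alpha> < \<beta> k\<close> by (auto simp: dist_real_def \<alpha>_def)
    ultimately show ?thesis by (intro exI[of _ \<alpha>]) (auto simp: \<alpha>_def)
  qed
  then obtain \<alpha> where \<alpha>: "\<And>k. a < \<alpha> k" "\<And>k. \<alpha> k < \<beta> k" "\<And>k. \<alpha> k \<le> a + (b - a) / (real k + 3)"
    "\<And>k x. a \<le> x \<Longrightarrow> x \<le> \<alpha> k \<Longrightarrow> \<bar>r x (\<beta> k) - r a (\<beta> k)\<bar> < 1"
    by metis
  have "\<alpha> \<longlonglongrightarrow> a"
  proof (rule tendsto_sandwich[of "\<lambda>_. a" _ _ "\<lambda>k. a + (b - a) / (real k + 3)"])
    have "(\<lambda>k. (b - a) / (real k + 3)) \<longlonglongrightarrow> 0"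
      by (intro real_tendsto_divide_at_top[OF tendsto_const] filterlim_tendsto_add_at_top[OF tendsto_const, where c = 3, simplified add.commute])
         (rule filterlim_real_sequentially)
    then show "(\<lambda>k. a + (b - a) / (real k + 3)) \<longlonglongrightarrow> a"
      using tendsto_add[OF tendsto_const, of _ 0 _ a] by simp
  qed (use \<alpha> in \<open>auto intro!: always_eventually less_imp_le\<close>)
  moreover have "- (C + 2) \<le> cut (\<alpha> k) (\<beta> k) x y" if "a \<le> x" for k x y
  proof (cases "x < \<alpha> k \<and> \<beta> k < y")
    case True
    have "\<bar>r x (\<beta> k) - r a (\<beta> k)\<bar> < 1" "\<bar>r (\<alpha> k) (\<beta> k) - r a (\<beta> k)\<bar> < 1"
      using \<alpha>(4)[of x k] \<alpha>(4)[of "\<alpha> k" k] \<alpha>(1)[of k] True that by auto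
    then show ?thesis using True r_ge[of "\<alpha> k" y] by (simp add: cut_def)
  next
    case False
    then have "cut (\<alpha> k) (\<beta> k) x y = r x y" by (auto simp: cut_def)
    then show ?thesis using r_ge[of x y] by simp
  qed
  ultimately show ?thesis using that \<alpha>(1,2) \<beta>(2) by blast
qed

end

section \<open>Removing the cutoff\<close>

locale seidl_cost = seidl a b \<rho> n d T + wo_cost a b w C
  for a b :: real and \<rho> n d T w C
begin

lemma cost_n_eq:
  assumes "\<forall>i<n. \<forall>j<n. i \<noteq> j \<longrightarrow> w (y i) (y j) \<noteq> \<infinity>"
  shows "cost_n n w y = ereal (pair_sum n r y)"
proof -
  have "w (y i) (y j) = ereal (r (min (y i) (y j)) (max (y i) (y j)))"
    if "i \<in> {..<n}" "j \<in> {..<n} - {i}" for i j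
    using w_eq[of "y i" "y j"] assms that by (auto simp: min_def max_def r_sym)
  then show ?thesis
    unfolding cost_n_def pair_sum_def by (simp add: sum_ereal[symmetric] del: sum_ereal)
qed

lemma cost_n_infty:
  assumes "cost_n n w y \<noteq> \<infinity>"
  shows "\<forall>i<n. \<forall>j<n. i \<noteq> j \<longrightarrow> w (y i) (y j) \<noteq> \<infinity>"
  using assms by (auto simp: cost_n_def sum_Pinfty)

lemma pair_sum_measurable:
  assumes v: "(\<lambda>z. v (fst z) (snd z)) \<in> borel_measurable borel"
  shows "pair_sum n v \<in> borel_measurable (Rn n)"
proof -
  have vm: "(\<lambda>y. v (f y) (g y)) \<in> borel_measurable (Rn n)"
    if "f \<in> borel_measurable (Rn n)" "g \<in> borel_measurable (Rn n)" for f g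
  proof -
    have "(\<lambda>x. (f x, g x)) \<in> measurable (Rn n) borel" using that by (rule borel_measurable_Pair)
    from measurable_compose[OF this v] show ?thesis by simp
  qed
  show ?thesis
    unfolding pair_sum_def
    by (intro borel_measurable_sum vm borel_measurable_min borel_measurable_max measurable_component_singleton) auto
qed

lemma AE_orb_fin: "AE x in \<rho>. \<forall>i<n. \<forall>j<n. i \<noteq> j \<longrightarrow> w (orb x i) (orb x j) \<noteq> \<infinity>"
  using AE_orb_equispaced
proof eventually_elim
  case (elim x)
  from equispaced_interlaced[OF this] have ins: "\<And>i. i < n \<Longrightarrow> a < orb x i \<and> orb x i < b" and inj: "inj_on (orb x) {..<n}"
    by blast+
  show ?case
  proof (intro allI impI)
    fix i j assume ij: "i < n" "j < n" "i \<noteq> j"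
    then have "orb x i \<noteq> orb x j" using inj_onD[OF inj, of i j] by auto
    then show "w (orb x i) (orb x j) \<noteq> \<infinity>"
      using ins[OF ij(1)] ins[OF ij(2)] w_fin[of "orb x i" "orb x j"] w_fin[of "orb x j" "orb x i"] w_sym[of "orb x i" "orb x j"]
      by (cases "orb x i < orb x j") auto
  qed
qed

lemma pair_sum_cut_le:
  assumes y: "\<And>i. i < n \<Longrightarrow> a < y i \<and> y i < b" and "a < \<alpha>" "\<alpha> < \<beta>" "\<beta> < b"
  shows "pair_sum n (cut \<alpha> \<beta>) y \<le> pair_sum n r y"
  unfolding pair_sum_def
proof (intro sum_mono)
  fix i j assume "i \<in> {..<n}" "j \<in> {..<n} - {i}"
  then show "cut \<alpha> \<beta> (min (y i) (y j)) (max (y i) (y j)) \<le> r (min (y i) (y j)) (max (y i) (y j))"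
    using assms(2-) y[of i] y[of j] by (intro cut_le) auto
qed

text \<open>Second passage to the limit. The competitor's side is already in terms of
  \<open>r\<close>, since cut costs lie below \<open>r\<close>; on the Seidl side almost every orbit
  stays in the open interval, so its cut cost is eventually equal to the true one.\<close>

lemma optimal_gap:
  assumes \<gamma>: "\<gamma> \<in> couplings n \<rho>"
    and fin: "AE y in \<gamma>. \<forall>i<n. \<forall>j<n. i \<noteq> j \<longrightarrow> w (y i) (y j) \<noteq> \<infinity>"
    and int: "integrable \<gamma> (pair_sum n r)"
    and Q: "0 < p1" "p1 < p2" "p2 < q1" "q1 < q2" "q2 \<le> 2 ^ N0"
  defines "s1 \<equiv> dyadic a b N0 p1" and "s2 \<equiv> dyadic a b N0 p2"
    and "t1 \<equiv> dyadic a b N0 q1" and "t2 \<equiv> dyadic a b N0 q2"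
  defines "B \<equiv> {y \<in> space \<gamma>. real (occ n {s2..<t1} y) - 1 > real n * (cdf \<rho> t2 - cdf \<rho> s1)}"
  shows "integrable \<rho> (\<lambda>x. pair_sum n r (orb x)) \<and> (\<integral>x. pair_sum n r (orb x) \<partial>\<rho>) \<le>
    (\<integral>y. pair_sum n r y \<partial>\<gamma>) - 2 * (r s1 t2 + r s2 t1 - r s1 t1 - r s2 t2) * measure \<gamma> B"
proof -
  obtain \<alpha> \<beta> :: "nat \<Rightarrow> real" where \<alpha>: "\<And>k. a < \<alpha> k" "\<And>k. \<alpha> k < \<beta> k" "\<And>k. \<beta> k < b" "\<alpha> \<longlonglongrightarrow> a"
    and cut_ge: "\<And>k x y. a \<le> x \<Longrightarrow> - (C + 2) \<le> cut (\<alpha> k) (\<beta> k) x y"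
    using cut_sequence by blast
  define v where "v k = cut (\<alpha> k) (\<beta> k)" for k
  have s1: "a < s1" unfolding s1_def using dyadic_less_iff[OF ab, of N0 0 p1] Q by simp
  have s12: "s1 < s2" using Q ab by (simp add: s1_def s2_def)
  have gap: "integrable \<rho> (\<lambda>x. pair_sum n (v k) (orb x)) \<and> (\<integral>x. pair_sum n (v k) (orb x) \<partial>\<rho>) \<le>
    (\<integral>y. pair_sum n r y \<partial>\<gamma>) - 2 * (v k s1 t2 + v k s2 t1 - v k s1 t1 - v k s2 t2) * measure \<gamma> B" for k
    unfolding s1_def s2_def t1_def t2_def B_def
  proof (rule plan_le_gap)
    show "pair_cost a b (v k) {x. w x x \<noteq> \<infinity>}" unfolding v_def using \<alpha> by (intro cut_pair_cost) auto
    show "(\<lambda>z. v k (fst z) (snd z)) \<in> borel_measurable borel" unfolding v_def by (rule cut_measurable)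
    show "AE y in \<gamma>. \<forall>i<n. \<forall>j<n. i \<noteq> j \<longrightarrow> y i = y j \<longrightarrow> y i \<in> {x. w x x \<noteq> \<infinity>}"
      using fin by eventually_elim auto
    show "AE y in \<gamma>. pair_sum n (v k) y \<le> pair_sum n r y"
      using AE_coupling[OF \<gamma> AE_interior] by eventually_elim (use \<alpha> in \<open>auto simp: v_def intro!: pair_sum_cut_le\<close>)
  qed (use \<gamma> int Q in auto)
  have ev: "eventually (\<lambda>k. \<alpha> k < x) sequentially" if "a < x" for x
    using order_tendstoD(2)[OF \<alpha>(4) that] .
  have v_eq: "v k x y = r x y" if "\<alpha> k < x" for k x y
    using that by (simp add: v_def cut_def)
  show ?thesis
  proof (rule integral_le_of_AE_limit[where f = "\<lambda>k x. pair_sum n (v k) (orb x)" and C = "real n * real n * (C + 2)"])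
    show "finite_measure \<rho>" by unfold_locales
    show "integrable \<rho> (\<lambda>x. pair_sum n (v k) (orb x))" for k using gap by simp
    show "(\<lambda>x. pair_sum n r (orb x)) \<in> borel_measurable \<rho>"
      using measurable_compose[OF orb_measurable pair_sum_measurable[OF r_measurable]] by simp
    show "AE x in \<rho>. - (real n * real n * (C + 2)) \<le> pair_sum n (v k) (orb x)" for k
      using AE_orb_pointwise[OF AE_interior]
    proof eventually_elim
      case (elim x)
      have "(\<Sum>i<n. \<Sum>j\<in>{..<n}-{i}. - (C + 2)) \<le> pair_sum n (v k) (orb x)"
        unfolding pair_sum_def v_def
      proof (intro sum_mono cut_ge)
        fix i j assume "i \<in> {..<n}" "j \<in> {..<n} - {i}"
        then show "a \<le> min (orb x i) (orb x j)" using elim by auto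
      qed
      moreover have "(\<Sum>i<n. \<Sum>j\<in>{..<n}-{i}. - (C + 2)) \<ge> (\<Sum>i<n. \<Sum>j<n. - (C + 2))"
        using C by (intro sum_mono) (auto simp: sum_diff1)
      ultimately show ?case by (simp add: algebra_simps)
    qed
    show "AE x in \<rho>. (\<lambda>k. pair_sum n (v k) (orb x)) \<longlonglongrightarrow> pair_sum n r (orb x)"
      using AE_orb_pointwise[OF AE_interior]
    proof eventually_elim
      case (elim x)
      have "eventually (\<lambda>k. \<forall>i\<in>{..<n}. \<alpha> k < orb x i) sequentially"
        using elim ev by (intro eventually_ball_finite) auto
      then have "eventually (\<lambda>k. pair_sum n (v k) (orb x) = pair_sum n r (orb x)) sequentially"
        by eventually_elim (auto simp: pair_sum_def intro!: sum.cong v_eq)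
      then show ?case by (rule tendsto_eventually)
    qed
    show "eventually (\<lambda>k. (\<integral>x. pair_sum n (v k) (orb x) \<partial>\<rho>) \<le>
      (\<integral>y. pair_sum n r y \<partial>\<gamma>) - 2 * (r s1 t2 + r s2 t1 - r s1 t1 - r s2 t2) * measure \<gamma> B) sequentially"
      \<comment> \<open>Since \<open>p1 > 0\<close>, the corner \<open>s1\<close> lies to the right
        of \<open>a\<close>, so for large \<open>k\<close> the mixed difference of the cut cost is
        that of \<open>r\<close>. Hence the bound is only available eventually.\<close>
      using ev[OF s1]
    proof eventually_elim
      case (elim k)
      then have "\<alpha> k < s2" using s12 by simp
      with elim show ?case using gap[of k] by (simp add: v_eq)
    qed
  qed
qed

end

section \<open>Optimality of the Seidl plan\<close>

lemma ereal_integral_eq_integral: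
  assumes g: "integrable M g" and f: "AE x in M. f x = ereal (g x)"
  shows "ereal_integral M f = ereal (\<integral>x. g x \<partial>M)"
proof -
  have P: "(\<integral>\<^sup>+ x. e2ennreal (f x) \<partial>M) = (\<integral>\<^sup>+ x. ennreal (g x) \<partial>M)"
    using f by (intro nn_integral_cong_AE) (auto elim!: eventually_mono)
  have N: "(\<integral>\<^sup>+ x. e2ennreal (- f x) \<partial>M) = (\<integral>\<^sup>+ x. ennreal (- g x) \<partial>M)"
    using f by (intro nn_integral_cong_AE) (auto elim!: eventually_mono)
  have fin: "(\<integral>\<^sup>+ x. ennreal (g x) \<partial>M) \<noteq> \<infinity>" "(\<integral>\<^sup>+ x. ennreal (- g x) \<partial>M) \<noteq> \<infinity>"
    using g by (auto simp: real_integrable_def)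
  have e: "enn2ereal X = ereal (enn2real X)" if "X \<noteq> \<infinity>" for X :: ennreal
    using that by (cases X) (auto simp: enn2ereal_ennreal)
  show ?thesis
    unfolding ereal_integral_def P N using fin g
    by (simp add: e real_lebesgue_integral_def)
qed

text \<open>The lower bound makes the negative part integrable, so the difference in
  \<open>ereal_integral\<close> is infinite only through the positive part.\<close>

lemma ereal_integral_finite:
  assumes "prob_space M" and f [measurable]: "f \<in> borel_measurable M" and lb: "\<And>x. x \<in> space M \<Longrightarrow> ereal (- K) \<le> f x"
    and fin: "ereal_integral M f \<noteq> \<infinity>"
  shows "AE x in M. f x \<noteq> \<infinity>" "integrable M (\<lambda>x. real_of_ereal (f x))"
proof -
  interpret prob_space M by fact
  define k where "k = max 0 K"
  have k: "0 \<le> k" "K \<le> k" by (auto simp: k_def)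
  have "(\<integral>\<^sup>+ x. e2ennreal (- f x) \<partial>M) \<le> (\<integral>\<^sup>+ x. ennreal k \<partial>M)"
  proof (rule nn_integral_mono)
    fix x assume "x \<in> space M"
    then have "- f x \<le> ereal k" using lb[of x] k by (cases "f x") auto
    then have "e2ennreal (- f x) \<le> e2ennreal (ereal k)" by (rule e2ennreal_mono)
    also have "e2ennreal (ereal k) = ennreal k" by simp
    finally show "e2ennreal (- f x) \<le> ennreal k" .
  qed
  also have "\<dots> < \<infinity>" by (simp add: emeasure_space_1 ennreal_mult_less_top)
  finally have N: "(\<integral>\<^sup>+ x. e2ennreal (- f x) \<partial>M) < \<infinity>" .
  have P: "(\<integral>\<^sup>+ x. e2ennreal (f x) \<partial>M) \<noteq> \<infinity>"
  proof
    assume "(\<integral>\<^sup>+ x. e2ennreal (f x) \<partial>M) = \<infinity>"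
    moreover obtain N where "(\<integral>\<^sup>+ x. e2ennreal (- f x) \<partial>M) = ennreal N" "0 \<le> N"
      using N by (cases "\<integral>\<^sup>+ x. e2ennreal (- f x) \<partial>M") auto
    ultimately show False using fin by (simp add: ereal_integral_def enn2ereal_ennreal)
  qed
  have "AE x in M. e2ennreal (f x) \<noteq> \<infinity>" using P by (intro nn_integral_PInf_AE) auto
  then show AEf: "AE x in M. f x \<noteq> \<infinity>" by eventually_elim auto
  show "integrable M (\<lambda>x. real_of_ereal (f x))"
    unfolding real_integrable_def
  proof (intro conjI)
    have "(\<integral>\<^sup>+ x. ennreal (real_of_ereal (f x)) \<partial>M) \<le> (\<integral>\<^sup>+ x. e2ennreal (f x) \<partial>M)"
    proof (rule nn_integral_mono)
      fix x assume "x \<in> space M"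
      then show "ennreal (real_of_ereal (f x)) \<le> e2ennreal (f x)"
        using lb[of x] by (cases "f x") auto
    qed
    then show "(\<integral>\<^sup>+ x. ennreal (real_of_ereal (f x)) \<partial>M) \<noteq> \<infinity>" using P by (auto simp: top_unique)
    have "(\<integral>\<^sup>+ x. ennreal (- real_of_ereal (f x)) \<partial>M) \<le> (\<integral>\<^sup>+ x. e2ennreal (- f x) \<partial>M)"
    proof (rule nn_integral_mono)
      fix x assume "x \<in> space M"
      then show "ennreal (- real_of_ereal (f x)) \<le> e2ennreal (- f x)"
        using lb[of x] by (cases "f x") auto
    qed
    then show "(\<integral>\<^sup>+ x. ennreal (- real_of_ereal (f x)) \<partial>M) \<noteq> \<infinity>" using N by auto
  qed simp
qed

lemma measurable_cost_n:
  assumes w: "(\<lambda>z. w (fst z) (snd z)) \<in> borel_measurable borel"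
  shows "cost_n n w \<in> borel_measurable (Rn n)"
proof -
  have "(\<lambda>y. w (y i) (y j)) \<in> borel_measurable (Rn n)" if "i < n" "j < n" for i j
  proof -
    have "(\<lambda>y. (y i, y j)) \<in> measurable (Rn n) borel"
      using that by (intro borel_measurable_Pair measurable_component_singleton) auto
    from measurable_compose[OF this w] show ?thesis by simp
  qed
  then show ?thesis
    unfolding cost_n_def by (intro borel_measurable_ereal_sum) auto
qed

context seidl_cost
begin

lemma w_measurable: "(\<lambda>z. w (fst z) (snd z)) \<in> borel_measurable borel"
  using w_cont by (rule borel_measurable_continuous_onI)

lemma cost_n_ge: "ereal (- (real n * real n * C)) \<le> cost_n n w y"
proof -
  have "ereal (- (real n * real n * C)) \<le> ereal (\<Sum>i<n. \<Sum>j\<in>{..<n}-{i}. - C)"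
  proof -
    have "(\<Sum>i<n. \<Sum>j<n. - C) \<le> (\<Sum>i<n. \<Sum>j\<in>{..<n}-{i}. - C)"
      using C by (intro sum_mono) (auto simp: sum_diff1 left_diff_distrib)
    then show ?thesis by (simp add: mult.assoc)
  qed
  also have "\<dots> \<le> cost_n n w y"
    unfolding cost_n_def sum_ereal[symmetric] by (intro sum_mono w_ge)
  finally show ?thesis .
qed

text \<open>The inner interval holds more than \<open>n\<close> times the mass of the surrounding
  one, plus 1, which no equispaced configuration does. The margin on both sides leaves room for a
  full rectangle of cells and a positive mixed difference.\<close>

definition crowded :: "nat \<Rightarrow> nat \<Rightarrow> nat \<Rightarrow> nat \<Rightarrow> nat \<Rightarrow> (nat \<Rightarrow> real) set" where
  "crowded N p1 p2 q1 q2 = {y \<in> space (Rn n).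
     real (occ n {dyadic a b N p2..<dyadic a b N q1} y) - 1 > real n * (cdf \<rho> (dyadic a b N q2) - cdf \<rho> (dyadic a b N p1))}"

definition dyadic_gap :: "nat \<Rightarrow> nat \<Rightarrow> nat \<Rightarrow> nat \<Rightarrow> nat \<Rightarrow> real" where
  "dyadic_gap N p1 p2 q1 q2 = r (dyadic a b N p1) (dyadic a b N q2) + r (dyadic a b N p2) (dyadic a b N q1)
     - r (dyadic a b N p1) (dyadic a b N q1) - r (dyadic a b N p2) (dyadic a b N q2)"

text \<open>One pair of reals serves all rectangles at once: a single rectangle gives optimality,
  and letting it range over all of them gives the null events for uniqueness.\<close>

lemma ot_cost_gap:
  assumes \<gamma>: "\<gamma> \<in> couplings n \<rho>" and fin: "ot_cost n w \<gamma> \<noteq> \<infinity>"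
  obtains x y where "ot_cost n w (distr \<rho> (Rn n) orb) = ereal x" "ot_cost n w \<gamma> = ereal y"
    "\<And>N p1 p2 q1 q2. 0 < p1 \<Longrightarrow> p1 < p2 \<Longrightarrow> p2 < q1 \<Longrightarrow> q1 < q2 \<Longrightarrow> q2 \<le> 2 ^ N \<Longrightarrow>
       x \<le> y - 2 * dyadic_gap N p1 p2 q1 q2 * measure \<gamma> (crowded N p1 p2 q1 q2)"
proof -
  have sp: "space \<gamma> = space (Rn n)" using couplingsD[OF \<gamma>] by simp
  have meas: "cost_n n w \<in> borel_measurable \<gamma>"
    using measurable_cost_n[OF w_measurable] measurable_cong_sets[OF couplingsD(2)[OF \<gamma>] refl] by blast
  note fin' = ereal_integral_finite[OF couplingsD(1)[OF \<gamma>] meas cost_n_ge fin[unfolded ot_cost_def]]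
  have AEf: "AE y in \<gamma>. \<forall>i<n. \<forall>j<n. i \<noteq> j \<longrightarrow> w (y i) (y j) \<noteq> \<infinity>"
    using fin'(1) by eventually_elim (rule cost_n_infty)
  have AEeq: "AE y in \<gamma>. cost_n n w y = ereal (pair_sum n r y)"
    using AEf by eventually_elim (rule cost_n_eq)
  have rm: "pair_sum n r \<in> borel_measurable \<gamma>"
    using pair_sum_measurable[OF r_measurable] measurable_cong_sets[OF couplingsD(2)[OF \<gamma>] refl] by blast
  have "integrable \<gamma> (pair_sum n r) \<longleftrightarrow> integrable \<gamma> (\<lambda>y. real_of_ereal (cost_n n w y))"
    using rm meas AEeq by (intro integrable_cong_AE) (auto elim!: eventually_mono)
  then have int: "integrable \<gamma> (pair_sum n r)" using fin'(2) by simp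
  have c\<gamma>: "ot_cost n w \<gamma> = ereal (\<integral>y. pair_sum n r y \<partial>\<gamma>)"
    unfolding ot_cost_def by (rule ereal_integral_eq_integral[OF int AEeq])
  have gap: "integrable \<rho> (\<lambda>x. pair_sum n r (orb x)) \<and> (\<integral>x. pair_sum n r (orb x) \<partial>\<rho>) \<le> (\<integral>y. pair_sum n r y \<partial>\<gamma>) -
      2 * dyadic_gap N p1 p2 q1 q2 * measure \<gamma> (crowded N p1 p2 q1 q2)"
    if "0 < p1" "p1 < p2" "p2 < q1" "q1 < q2" "q2 \<le> 2 ^ N" for N p1 p2 q1 q2
    using optimal_gap[OF \<gamma> AEf int that] unfolding crowded_def sp dyadic_gap_def .
  \<comment> \<open>Any admissible rectangle will do here; 1, 2, 3, 4 at level 3 is one, as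
    \<open>4 \<le> 2 ^ 3\<close>.\<close>
  have iS: "integrable \<rho> (\<lambda>x. pair_sum n r (orb x))" using gap[of 1 2 3 4 3] by simp
  have "ot_cost n w (distr \<rho> (Rn n) orb) = ereal (\<integral>x. pair_sum n r (orb x) \<partial>\<rho>)"
  proof -
    have "(\<integral>\<^sup>+ y. e2ennreal (cost_n n w y) \<partial>distr \<rho> (Rn n) orb) = (\<integral>\<^sup>+ x. e2ennreal (cost_n n w (orb x)) \<partial>\<rho>)"
      "(\<integral>\<^sup>+ y. e2ennreal (- cost_n n w y) \<partial>distr \<rho> (Rn n) orb) = (\<integral>\<^sup>+ x. e2ennreal (- cost_n n w (orb x)) \<partial>\<rho>)"
      using measurable_cost_n[OF w_measurable, of n] by (auto intro!: nn_integral_distr)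
    then have "ot_cost n w (distr \<rho> (Rn n) orb) = ereal_integral \<rho> (\<lambda>x. cost_n n w (orb x))"
      by (simp add: ot_cost_def ereal_integral_def)
    also have "\<dots> = ereal (\<integral>x. pair_sum n r (orb x) \<partial>\<rho>)"
    proof (rule ereal_integral_eq_integral[OF iS])
      show "AE x in \<rho>. cost_n n w (orb x) = ereal (pair_sum n r (orb x))"
        using AE_orb_fin by eventually_elim (rule cost_n_eq)
    qed
    finally show ?thesis .
  qed
  then show ?thesis using that[OF _ c\<gamma>] gap by blast
qed

lemma dyadic_gap_nonneg:
  assumes "0 < p1" "p1 < p2" "p2 < q1" "q1 < q2" "q2 \<le> 2 ^ N"
  shows "0 \<le> dyadic_gap N p1 p2 q1 q2"
proof -
  have "a < dyadic a b N p1" "dyadic a b N q2 \<le> b"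
    using dyadic_less_iff[OF ab, of N 0 p1] dyadic_le_iff[OF ab, of N q2 "2 ^ N"] assms by simp_all
  then have "r (dyadic a b N p1) (dyadic a b N q1) + r (dyadic a b N p2) (dyadic a b N q2)
    \<le> r (dyadic a b N p1) (dyadic a b N q2) + r (dyadic a b N p2) (dyadic a b N q1)"
    using assms ab by (intro r_sub) auto
  then show ?thesis by (simp add: dyadic_gap_def)
qed

lemma orb_optimal: "is_OT_minimizer n w \<rho> (distr \<rho> (Rn n) orb)"
proof -
  have "ot_cost n w (distr \<rho> (Rn n) orb) \<le> ot_cost n w \<gamma>" if \<gamma>: "\<gamma> \<in> couplings n \<rho>" for \<gamma>
  proof (cases "ot_cost n w \<gamma> = \<infinity>")
    case False
    then show ?thesis
    proof (rule ot_cost_gap[OF \<gamma>])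
      fix x y assume *: "ot_cost n w (distr \<rho> (Rn n) orb) = ereal x" "ot_cost n w \<gamma> = ereal y"
        "\<And>N p1 p2 q1 q2. 0 < p1 \<Longrightarrow> p1 < p2 \<Longrightarrow> p2 < q1 \<Longrightarrow> q1 < q2 \<Longrightarrow> q2 \<le> 2 ^ N \<Longrightarrow>
         x \<le> y - 2 * dyadic_gap N p1 p2 q1 q2 * measure \<gamma> (crowded N p1 p2 q1 q2)"
      have "0 \<le> 2 * dyadic_gap 3 1 2 3 4 * measure \<gamma> (crowded 3 1 2 3 4)"
        using dyadic_gap_nonneg[of 1 2 3 4 3] by (intro mult_nonneg_nonneg) (auto simp: measure_nonneg)
      moreover have "x \<le> y - 2 * dyadic_gap 3 1 2 3 4 * measure \<gamma> (crowded 3 1 2 3 4)"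
        by (rule *(3)) auto
      ultimately have "x \<le> y" by linarith
      then show ?thesis using * by simp
    qed
  qed simp
  then have "ot_cost n w (distr \<rho> (Rn n) orb) = F_OT n w \<rho>"
    unfolding F_OT_def using orb_coupling by (intro antisym INF_greatest INF_lower) auto
  then show ?thesis using orb_coupling by (simp add: is_OT_minimizer_def)
qed

end

section \<open>Symmetrization\<close>

lemma perm_coords_measurable [measurable]:
  assumes "\<sigma> permutes {..<n}"
  shows "perm_coords n \<sigma> \<in> measurable (Rn n) (Rn n)"
proof -
  have "\<sigma> i \<in> {..<n}" if "i \<in> {..<n}" for i using permutes_in_image[OF assms, of i] that by simp
  then show ?thesis unfolding perm_coords_def
    by (intro measurable_restrict measurable_component_singleton) auto
qed

text \<open>Permuting coordinates is precomposition, so the order of composition is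
  reversed.\<close>

lemma perm_coords_comp:
  assumes "\<sigma> permutes {..<n}"
  shows "perm_coords n \<sigma> (perm_coords n \<pi> y) = perm_coords n (\<pi> \<circ> \<sigma>) y"
  using permutes_in_image[OF assms] by (auto simp: perm_coords_def fun_eq_iff)

lemma perm_coords_apply: "i < n \<Longrightarrow> perm_coords n \<sigma> y i = y (\<sigma> i)"
  by (simp add: perm_coords_def)

abbreviation "perms n \<equiv> {\<sigma>. \<sigma> permutes {..<n::nat}}"

lemma finite_perms: "finite (perms n)" "card (perms n) = fact n"
  by (simp_all add: finite_permutations card_permutations)

lemma ennreal_average: "(\<Sum>\<sigma>\<in>perms n. c) / of_nat (fact n) = (c :: ennreal)"
proof -
  have "of_nat (fact n) * c / of_nat (fact n) = c * (of_nat (fact n) / of_nat (fact n))"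
    by (simp add: ennreal_times_divide mult.commute)
  also have "\<dots> = c"
    using of_nat_less_top[of "fact n"] by (subst ennreal_divide_self) (auto simp: less_top)
  finally show ?thesis by (simp add: finite_perms)
qed

lemma sum_perms_comp:
  assumes \<pi>: "\<pi> permutes {..<n}"
  shows "(\<Sum>\<sigma>\<in>perms n. f (\<pi> \<circ> \<sigma>)) = (\<Sum>\<sigma>\<in>perms n. f \<sigma>)" "(\<Sum>\<sigma>\<in>perms n. f (\<sigma> \<circ> \<pi>)) = (\<Sum>\<sigma>\<in>perms n. f \<sigma>)"
proof -
  show "(\<Sum>\<sigma>\<in>perms n. f (\<pi> \<circ> \<sigma>)) = (\<Sum>\<sigma>\<in>perms n. f \<sigma>)"
    by (rule sum.reindex_bij_witness[of _ "\<lambda>\<sigma>. inv \<pi> \<circ> \<sigma>" "\<lambda>\<sigma>. \<pi> \<circ> \<sigma>"])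
       (auto simp: o_assoc permutes_inv_o[OF \<pi>] intro: permutes_compose permutes_inv[OF \<pi>] \<pi>)
  show "(\<Sum>\<sigma>\<in>perms n. f (\<sigma> \<circ> \<pi>)) = (\<Sum>\<sigma>\<in>perms n. f \<sigma>)"
    by (rule sum.reindex_bij_witness[of _ "\<lambda>\<sigma>. \<sigma> \<circ> inv \<pi>" "\<lambda>\<sigma>. \<sigma> \<circ> \<pi>"])
       (auto simp: o_assoc[symmetric] permutes_inv_o[OF \<pi>] intro: permutes_compose permutes_inv[OF \<pi>] \<pi>)
qed

lemma cost_n_perm:
  assumes "\<sigma> permutes {..<n}"
  shows "cost_n n w (perm_coords n \<sigma> y) = cost_n n w y"
proof -
  have im: "\<sigma> i < n \<longleftrightarrow> i < n" for i using permutes_in_image[OF assms, of i] by simp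
  have "cost_n n w (perm_coords n \<sigma> y) = (\<Sum>i\<in>{..<n}. \<Sum>j\<in>{..<n}-{i}. w (y (\<sigma> i)) (y (\<sigma> j)))"
    unfolding cost_n_def by (intro sum.cong) (auto simp: perm_coords_apply)
  also have "\<dots> = (\<Sum>i\<in>{..<n}. \<Sum>j\<in>{..<n}-{\<sigma> i}. w (y (\<sigma> i)) (y j))"
  proof (rule sum.cong[OF refl])
    fix i assume i: "i \<in> {..<n}"
    have "bij_betw \<sigma> ({..<n} - {i}) ({..<n} - {\<sigma> i})"
      using permutes_imp_bij[OF assms] i by (intro bij_betw_DiffI) (auto simp: bij_betw_def)
    then show "(\<Sum>j\<in>{..<n}-{i}. w (y (\<sigma> i)) (y (\<sigma> j))) = (\<Sum>j\<in>{..<n}-{\<sigma> i}. w (y (\<sigma> i)) (y j))"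
      by (rule sum.reindex_bij_betw)
  qed
  also have "\<dots> = cost_n n w y"
    unfolding cost_n_def by (rule sum.reindex_bij_betw[OF permutes_imp_bij[OF assms]])
  finally show ?thesis .
qed

context
  fixes n :: nat and \<gamma> :: "(nat \<Rightarrow> real) measure"
  assumes prob: "prob_space \<gamma>" and sets_\<gamma>: "sets \<gamma> = sets (Rn n)"
begin

lemma measurable_\<gamma>: "measurable \<gamma> N = measurable (Rn n) N"
  using sets_\<gamma> by (rule measurable_cong_sets) simp

lemma perm_coords_pair_measurable:
  "(\<lambda>z. perm_coords n (fst z) (snd z)) \<in> measurable (uniform_count_measure (perms n) \<Otimes>\<^sub>M \<gamma>) (Rn n)"
proof -
  have "(\<lambda>z. perm_coords n (fst z) (snd z)) \<in> measurable (count_space (perms n) \<Otimes>\<^sub>M \<gamma>) (Rn n)"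
    using finite_perms(1)[of n]
    by (intro measurable_pair_measure_countable1 countable_finite) (auto simp: measurable_\<gamma> perm_coords_measurable)
  moreover have "sets (uniform_count_measure (perms n) \<Otimes>\<^sub>M \<gamma>) = sets (count_space (perms n) \<Otimes>\<^sub>M \<gamma>)"
    by (intro sets_pair_measure_cong) (auto simp: sets_uniform_count_measure)
  ultimately show ?thesis using measurable_cong_sets by blast
qed

lemma nn_integral_mixture:
  assumes f: "f \<in> borel_measurable (Rn n)"
  shows "(\<integral>\<^sup>+ y. f y \<partial>distr (uniform_count_measure (perms n) \<Otimes>\<^sub>M \<gamma>) (Rn n) (\<lambda>z. perm_coords n (fst z) (snd z)))
    = (\<Sum>\<sigma>\<in>perms n. \<integral>\<^sup>+ y. f (perm_coords n \<sigma> y) \<partial>\<gamma>) / of_nat (fact n)"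
proof -
  interpret \<gamma>: prob_space \<gamma> by (rule prob)
  interpret U: prob_space "uniform_count_measure (perms n)"
    using finite_perms(1)[of n] by (intro prob_space_uniform_count_measure) (auto intro: permutes_id)
  interpret P: pair_sigma_finite "uniform_count_measure (perms n)" \<gamma> ..
  have "(\<lambda>z. f (perm_coords n (fst z) (snd z))) \<in> borel_measurable (uniform_count_measure (perms n) \<Otimes>\<^sub>M \<gamma>)"
    using measurable_compose[OF perm_coords_pair_measurable f] .
  from \<gamma>.nn_integral_fst[OF this]
  have "(\<integral>\<^sup>+ z. f (perm_coords n (fst z) (snd z)) \<partial>(uniform_count_measure (perms n) \<Otimes>\<^sub>M \<gamma>))
    = (\<integral>\<^sup>+ \<sigma>. \<integral>\<^sup>+ y. f (perm_coords n \<sigma> y) \<partial>\<gamma> \<partial>uniform_count_measure (perms n))"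
    by simp
  also have "\<dots> = (\<Sum>\<sigma>\<in>perms n. ennreal (1 / real (fact n)) * (\<integral>\<^sup>+ y. f (perm_coords n \<sigma> y) \<partial>\<gamma>))"
    unfolding uniform_count_measure_def using finite_perms[of n]
    by (subst nn_integral_point_measure_finite) auto
  also have "\<dots> = (\<Sum>\<sigma>\<in>perms n. \<integral>\<^sup>+ y. f (perm_coords n \<sigma> y) \<partial>\<gamma>) / of_nat (fact n)"
  proof -
    have "ennreal (1 / real (fact n)) = 1 / of_nat (fact n)"
      using divide_ennreal[of 1 "real (fact n)"] ennreal_of_nat_eq_real_of_nat[of "fact n"] by (simp only: ennreal_1) simp
    then show ?thesis
      by (simp add: divide_ennreal_def sum_distrib_left mult.commute)
  qed
  finally show ?thesis
    using f by (subst nn_integral_distr) (auto simp: perm_coords_pair_measurable)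
qed

text \<open>Symmetrizing means shuffling the coordinates by an independent, uniformly random
  permutation. As an image measure the right side is a measure without further proof, and its
  integrals follow from Fubini.\<close>

lemma symmetrization_eq:
  "symmetrization n \<gamma> = distr (uniform_count_measure (perms n) \<Otimes>\<^sub>M \<gamma>) (Rn n) (\<lambda>z. perm_coords n (fst z) (snd z))"
    (is "_ = ?D")
proof -
  have "emeasure ?D A = (\<Sum>\<sigma>\<in>perms n. emeasure (distr \<gamma> (Rn n) (perm_coords n \<sigma>)) A) / of_nat (fact n)"
    if A: "A \<in> sets (Rn n)" for A
  proof -
    have "emeasure ?D A = (\<integral>\<^sup>+ y. indicator A y \<partial>?D)" using A by simp
    also have "\<dots> = (\<Sum>\<sigma>\<in>perms n. \<integral>\<^sup>+ y. indicator A (perm_coords n \<sigma> y) \<partial>\<gamma>) / of_nat (fact n)"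
      using A by (intro nn_integral_mixture) simp
    also have "(\<Sum>\<sigma>\<in>perms n. \<integral>\<^sup>+ y. indicator A (perm_coords n \<sigma> y) \<partial>\<gamma>)
      = (\<Sum>\<sigma>\<in>perms n. emeasure (distr \<gamma> (Rn n) (perm_coords n \<sigma>)) A)"
    proof (rule sum.cong[OF refl])
      fix \<sigma> assume "\<sigma> \<in> perms n"
      then have m: "perm_coords n \<sigma> \<in> measurable \<gamma> (Rn n)" by (simp add: measurable_\<gamma> perm_coords_measurable)
      show "(\<integral>\<^sup>+ y. indicator A (perm_coords n \<sigma> y) \<partial>\<gamma>) = emeasure (distr \<gamma> (Rn n) (perm_coords n \<sigma>)) A"
        using A nn_integral_distr[OF m, of "indicator A"] by simp
    qed
    finally show ?thesis .
  qed
  then have "symmetrization n \<gamma> = measure_of (space (Rn n)) (sets (Rn n)) (emeasure ?D)"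
    unfolding symmetrization_def by (intro measure_of_eq) (auto simp: sets.space_closed sets.sigma_sets_eq)
  also have "\<dots> = ?D" using measure_of_of_measure[of ?D] by simp
  finally show ?thesis .
qed

lemma sets_symmetrization: "sets (symmetrization n \<gamma>) = sets (Rn n)"
  by (simp add: symmetrization_eq)

lemma nn_integral_symmetrization:
  "f \<in> borel_measurable (Rn n) \<Longrightarrow>
    (\<integral>\<^sup>+ y. f y \<partial>symmetrization n \<gamma>) = (\<Sum>\<sigma>\<in>perms n. \<integral>\<^sup>+ y. f (perm_coords n \<sigma> y) \<partial>\<gamma>) / of_nat (fact n)"
  unfolding symmetrization_eq by (rule nn_integral_mixture)

lemma nn_integral_symmetrization_invariant:
  assumes f: "f \<in> borel_measurable (Rn n)"
    and inv: "\<And>\<sigma> y. \<sigma> permutes {..<n} \<Longrightarrow> f (perm_coords n \<sigma> y) = f y"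
  shows "(\<integral>\<^sup>+ y. f y \<partial>symmetrization n \<gamma>) = (\<integral>\<^sup>+ y. f y \<partial>\<gamma>)"
proof -
  have "(\<Sum>\<sigma>\<in>perms n. \<integral>\<^sup>+ y. f (perm_coords n \<sigma> y) \<partial>\<gamma>) = (\<Sum>\<sigma>\<in>perms n. \<integral>\<^sup>+ y. f y \<partial>\<gamma>)"
    using inv by (intro sum.cong nn_integral_cong) auto
  then show ?thesis by (simp only: nn_integral_symmetrization[OF f] ennreal_average)
qed

lemma symmetric_symmetrization: "symmetric_measure n (symmetrization n \<gamma>)"
  unfolding symmetric_measure_def
proof (intro allI impI)
  fix \<tau> assume \<tau>: "\<tau> permutes {..<n}"
  have m: "perm_coords n \<tau> \<in> measurable (symmetrization n \<gamma>) (Rn n)"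
    using perm_coords_measurable[OF \<tau>] measurable_cong_sets[OF sets_symmetrization refl] by blast
  show "distr (symmetrization n \<gamma>) (Rn n) (perm_coords n \<tau>) = symmetrization n \<gamma>"
  proof (rule measure_eqI)
    fix A assume "A \<in> sets (distr (symmetrization n \<gamma>) (Rn n) (perm_coords n \<tau>))"
    then have A [measurable]: "A \<in> sets (Rn n)" by simp
    have "emeasure (distr (symmetrization n \<gamma>) (Rn n) (perm_coords n \<tau>)) A
      = (\<integral>\<^sup>+ y. indicator A (perm_coords n \<tau> y) \<partial>symmetrization n \<gamma>)"
      using A nn_integral_distr[OF m, of "indicator A"] by simp
    also have "\<dots> = (\<Sum>\<sigma>\<in>perms n. \<integral>\<^sup>+ y. indicator A (perm_coords n \<tau> (perm_coords n \<sigma> y)) \<partial>\<gamma>) / of_nat (fact n)"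
      using A by (intro nn_integral_symmetrization measurable_compose[OF perm_coords_measurable[OF \<tau>]]) simp
    also have "(\<Sum>\<sigma>\<in>perms n. \<integral>\<^sup>+ y. indicator A (perm_coords n \<tau> (perm_coords n \<sigma> y)) \<partial>\<gamma>)
      = (\<Sum>\<sigma>\<in>perms n. \<integral>\<^sup>+ y. indicator A (perm_coords n \<sigma> y) \<partial>\<gamma>)"
      unfolding perm_coords_comp[OF \<tau>] by (rule sum_perms_comp(2)[OF \<tau>])
    also have "\<dots> / of_nat (fact n) = (\<integral>\<^sup>+ y. indicator A y \<partial>symmetrization n \<gamma>)"
      by (subst nn_integral_symmetrization) auto
    also have "\<dots> = emeasure (symmetrization n \<gamma>) A" using A sets_symmetrization by simp
    finally show "emeasure (distr (symmetrization n \<gamma>) (Rn n) (perm_coords n \<tau>)) A = emeasure (symmetrization n \<gamma>) A" .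
  qed (simp add: sets_symmetrization)
qed

lemma ot_cost_symmetrization:
  assumes "(\<lambda>z. w (fst z) (snd z)) \<in> borel_measurable borel"
  shows "ot_cost n w (symmetrization n \<gamma>) = ot_cost n w \<gamma>"
proof -
  have [measurable]: "cost_n n w \<in> borel_measurable (Rn n)" by (rule measurable_cost_n[OF assms])
  have "(\<integral>\<^sup>+ y. e2ennreal (cost_n n w y) \<partial>symmetrization n \<gamma>) = (\<integral>\<^sup>+ y. e2ennreal (cost_n n w y) \<partial>\<gamma>)"
    by (rule nn_integral_symmetrization_invariant) (auto simp: cost_n_perm)
  moreover have "(\<integral>\<^sup>+ y. e2ennreal (- cost_n n w y) \<partial>symmetrization n \<gamma>) = (\<integral>\<^sup>+ y. e2ennreal (- cost_n n w y) \<partial>\<gamma>)"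
    by (rule nn_integral_symmetrization_invariant) (auto simp: cost_n_perm)
  ultimately show ?thesis by (simp add: ot_cost_def ereal_integral_def)
qed

end

lemma symmetrization_coupling:
  assumes \<gamma>: "\<gamma> \<in> couplings n \<rho>" and \<rho>: "sets \<rho> = sets borel"
  shows "symmetrization n \<gamma> \<in> couplings n \<rho>"
proof -
  note c = couplingsD[OF \<gamma>]
  interpret \<gamma>: prob_space \<gamma> by (rule c)
  note ss = sets_symmetrization[OF c(1,2)]
  have sp: "space (symmetrization n \<gamma>) = space (Rn n)" using ss by (rule sets_eq_imp_space_eq)
  have "prob_space (symmetrization n \<gamma>)"
  proof
    have "emeasure (symmetrization n \<gamma>) (space (symmetrization n \<gamma>)) = (\<integral>\<^sup>+ y. 1 \<partial>symmetrization n \<gamma>)" by simp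
    also have "\<dots> = (\<integral>\<^sup>+ y. 1 \<partial>\<gamma>)" by (intro nn_integral_symmetrization_invariant[OF c(1,2)]) auto
    finally show "emeasure (symmetrization n \<gamma>) (space (symmetrization n \<gamma>)) = 1" by (simp add: \<gamma>.emeasure_space_1)
  qed
  moreover have "distr (symmetrization n \<gamma>) borel (\<lambda>x. x i) = \<rho>" if i: "i < n" for i
  proof (rule measure_eqI)
    fix A assume "A \<in> sets (distr (symmetrization n \<gamma>) borel (\<lambda>x. x i))"
    then have A [measurable]: "A \<in> sets borel" by simp
    have comp: "(\<lambda>x. x i) \<in> borel_measurable (Rn n)" using i by (intro measurable_component_singleton) auto
    then have m: "(\<lambda>x. x i) \<in> borel_measurable (symmetrization n \<gamma>)"
      using measurable_cong_sets[OF ss refl] by blast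
    have "emeasure (distr (symmetrization n \<gamma>) borel (\<lambda>x. x i)) A = (\<integral>\<^sup>+ y. indicator A (y i) \<partial>symmetrization n \<gamma>)"
      using A nn_integral_distr[OF m, of "indicator A"] by simp
    also have "\<dots> = (\<Sum>\<sigma>\<in>perms n. \<integral>\<^sup>+ y. indicator A (perm_coords n \<sigma> y i) \<partial>\<gamma>) / of_nat (fact n)"
      using A by (intro nn_integral_symmetrization[OF c(1,2)] measurable_compose[OF comp]) simp
    also have "(\<Sum>\<sigma>\<in>perms n. \<integral>\<^sup>+ y. indicator A (perm_coords n \<sigma> y i) \<partial>\<gamma>) = (\<Sum>\<sigma>\<in>perms n. emeasure \<rho> A)"
    proof (rule sum.cong[OF refl])
      fix \<sigma> assume "\<sigma> \<in> perms n"
      then have "\<sigma> i < n" using permutes_in_image[of \<sigma> "{..<n}" i] i by simp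
      moreover have "(indicator A :: real \<Rightarrow> ennreal) \<in> borel_measurable \<rho>" using A \<rho> by simp
      ultimately have "(\<integral>\<^sup>+ y. indicator A (y (\<sigma> i)) \<partial>\<gamma>) = (\<integral>\<^sup>+ y. indicator A y \<partial>\<rho>)"
        using nn_integral_distr[OF coupling_component[OF \<gamma>], of "\<sigma> i" "indicator A"] c(4)[of "\<sigma> i"] by simp
      then show "(\<integral>\<^sup>+ y. indicator A (perm_coords n \<sigma> y i) \<partial>\<gamma>) = emeasure \<rho> A"
        using i A \<rho> by (simp add: perm_coords_apply)
    qed
    also have "\<dots> / of_nat (fact n) = emeasure \<rho> A" by (rule ennreal_average)
    finally show "emeasure (distr (symmetrization n \<gamma>) borel (\<lambda>x. x i)) A = emeasure \<rho> A" .
  qed (simp add: \<rho>)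
  ultimately show ?thesis using ss by (simp add: couplings_def)
qed

section \<open>Uniqueness\<close>

lemma sum_bij_lessThan:
  assumes "bij_betw \<sigma> {..<n} {..<n}"
  shows "2 * (\<Sum>i<n. real (\<sigma> i)) = real n * (real n - 1)"
proof -
  have "(\<Sum>i<n. real (\<sigma> i)) = (\<Sum>k<n. real k)" by (rule sum.reindex_bij_betw[OF assms])
  moreover have "2 * (\<Sum>k<n. real k) = real n * (real n - 1)"
    by (induction n) (auto simp: algebra_simps)
  ultimately show ?thesis by simp
qed

text \<open>Applied to \<open>\<tau> i = n F (y i)\<close>. A stretch containing \<open>m\<close>
  points must have \<open>\<tau>\<close>-length at least \<open>m - 1\<close>, and the total length
  available is \<open>n\<close>; so the point of rank \<open>k\<close>, counted from 0, is confined
  to \<open>[k, k + 1]\<close>. The same spacing between two points shows that fractional parts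
  increase with rank, which is the last conclusion.\<close>

lemma floor_is_rank:
  fixes y \<tau> :: "nat \<Rightarrow> real"
  assumes dense: "\<And>i j. i < n \<Longrightarrow> j < n \<Longrightarrow> y i \<le> y j \<Longrightarrow>
      real (card {k. k < n \<and> y i \<le> y k \<and> y k \<le> y j}) - 1 \<le> \<tau> j - \<tau> i"
    and range: "\<And>i. i < n \<Longrightarrow> 0 \<le> \<tau> i \<and> \<tau> i \<le> real n"
    and frac: "\<And>i. i < n \<Longrightarrow> \<tau> i \<notin> \<int>"
  obtains \<sigma> where "bij_betw \<sigma> {..<n} {..<n}" "\<And>i. i < n \<Longrightarrow> \<lfloor>\<tau> i\<rfloor> = int (\<sigma> i)"
    "\<And>i j. i < n \<Longrightarrow> j < n \<Longrightarrow> 0 \<le> (real (\<sigma> i) - real (\<sigma> j)) * ((\<tau> i - real (\<sigma> i)) - (\<tau> j - real (\<sigma> j)))"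
proof -
  define \<sigma> where "\<sigma> i = card {k. k < n \<and> y k < y i}" for i
  have inj: "y i \<noteq> y j" if ij: "i < n" "j < n" "i \<noteq> j" for i j
  proof
    assume eq: "y i = y j"
    have "card {i, j} \<le> card {k. k < n \<and> y i \<le> y k \<and> y k \<le> y j}"
      using eq ij by (intro card_mono) auto
    then have "1 \<le> \<tau> j - \<tau> i" using dense[of i j] ij eq by simp
    moreover have "card {i, j} \<le> card {k. k < n \<and> y j \<le> y k \<and> y k \<le> y i}"
      using eq ij by (intro card_mono) auto
    then have "1 \<le> \<tau> i - \<tau> j" using dense[of j i] ij eq by simp
    ultimately show False by linarith
  qed
  have lower: "real (\<sigma> i) \<le> \<tau> i" if i: "i < n" for i
  proof -
    \<comment> \<open>Measuring from the lowest point gives the lower bound by the rank; measuring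
      up to the highest point gives the upper bound below.\<close>
    obtain i0 where i0: "i0 < n" "\<And>k. k < n \<Longrightarrow> y i0 \<le> y k"
      using ex_min_if_finite[of "y ` {..<n}"] i by (auto simp: not_less)
    have "card (insert i {k. k < n \<and> y k < y i}) \<le> card {k. k < n \<and> y i0 \<le> y k \<and> y k \<le> y i}"
      using i i0 by (intro card_mono) auto
    then have "real (\<sigma> i) + 1 \<le> real (card {k. k < n \<and> y i0 \<le> y k \<and> y k \<le> y i})"
      by (simp add: \<sigma>_def)
    then show ?thesis using dense[OF i0(1) i i0(2)[OF i]] range[OF i0(1)] by linarith
  qed
  have upper: "\<tau> i \<le> real (\<sigma> i) + 1" if i: "i < n" for i
  proof -
    have "finite (y ` {..<n})" "y ` {..<n} \<noteq> {}" using i by auto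
    then have "Max (y ` {..<n}) \<in> y ` {..<n}" by (rule Max_in)
    then obtain i1 where "i1 < n" and "Max (y ` {..<n}) = y i1" by auto
    then have i1: "i1 < n" "\<And>k. k < n \<Longrightarrow> y k \<le> y i1"
      using Max_ge[of "y ` {..<n}"] by auto
    have "card ({..<n} - {k. k < n \<and> y k < y i}) \<le> card {k. k < n \<and> y i \<le> y k \<and> y k \<le> y i1}"
      using i i1 by (intro card_mono) auto
    moreover have "card ({..<n} - {k. k < n \<and> y k < y i}) = n - \<sigma> i"
      unfolding \<sigma>_def by (subst card_Diff_subset) auto
    ultimately have "real n - real (\<sigma> i) \<le> real (card {k. k < n \<and> y i \<le> y k \<and> y k \<le> y i1})"
      by linarith
    then show ?thesis using dense[OF i i1(1) i1(2)[OF i]] range[OF i1(1)] by linarith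
  qed
  have less: "\<sigma> i < \<sigma> j \<and> real (\<sigma> j) - real (\<sigma> i) \<le> \<tau> j - \<tau> i" if ij: "i < n" "j < n" "y i < y j" for i j
  proof
    have "{k. k < n \<and> y k < y i} \<subset> {k. k < n \<and> y k < y j}" using ij by auto
    then show "\<sigma> i < \<sigma> j" unfolding \<sigma>_def by (intro psubset_card_mono) auto
    have "card (insert j {k. k < n \<and> y k < y j} - {k. k < n \<and> y k < y i})
      \<le> card {k. k < n \<and> y i \<le> y k \<and> y k \<le> y j}"
      using ij by (intro card_mono) auto
    moreover have "card (insert j {k. k < n \<and> y k < y j} - {k. k < n \<and> y k < y i}) = Suc (\<sigma> j) - \<sigma> i"
      unfolding \<sigma>_def using ij by (subst card_Diff_subset) auto
    ultimately have "real (Suc (\<sigma> j)) - real (\<sigma> i) \<le> real (card {k. k < n \<and> y i \<le> y k \<and> y k \<le> y j})"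
      by linarith
    then show "real (\<sigma> j) - real (\<sigma> i) \<le> \<tau> j - \<tau> i" using dense[OF ij(1,2)] ij(3) by simp
  qed
  have "\<sigma> i < n" if "i < n" for i
  proof -
    have "{k. k < n \<and> y k < y i} \<subset> {..<n}" using that by auto
    from psubset_card_mono[OF _ this] show ?thesis by (simp add: \<sigma>_def)
  qed
  moreover have "inj_on \<sigma> {..<n}"
  proof (rule inj_onI, rule ccontr)
    fix i j assume "i \<in> {..<n}" "j \<in> {..<n}" "\<sigma> i = \<sigma> j" "i \<noteq> j"
    then show False using inj[of i j] less[of i j] less[of j i] by (cases "y i < y j") auto
  qed
  ultimately have bij: "bij_betw \<sigma> {..<n} {..<n}"
    using endo_inj_surj[of "{..<n}" \<sigma>] by (auto simp: bij_betw_def)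
  have fl: "\<lfloor>\<tau> i\<rfloor> = int (\<sigma> i)" if i: "i < n" for i
  proof -
    \<comment> \<open>The closed upper end is the only value at which the integer part would not be
      the rank.\<close>
    have "\<tau> i \<noteq> real (\<sigma> i) + 1" using frac[OF i] by (metis Ints_1 Ints_add Ints_of_nat)
    then show ?thesis using lower[OF i] upper[OF i] by linarith
  qed
  have "0 \<le> (real (\<sigma> i) - real (\<sigma> j)) * ((\<tau> i - real (\<sigma> i)) - (\<tau> j - real (\<sigma> j)))" if ij: "i < n" "j < n" for i j
  proof (cases "i = j")
    case False
    then consider "y i < y j" | "y j < y i" using inj[OF ij] by linarith
    then show ?thesis
    proof cases
      case 1
      then show ?thesis using less[OF ij 1] by (intro mult_nonpos_nonpos) auto
    next
      case 2
      then show ?thesis using less[OF ij(2,1) 2] by (intro mult_nonneg_nonneg) auto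
    qed
  qed simp
  then show ?thesis using that[OF bij fl] by blast
qed

text \<open>Converts a sum over pairs, whose terms have a sign when ranks and fractional parts are
  ordered alike, into a sum over single points weighted by twice the centred rank. Integrals of the
  latter depend on the marginals only.\<close>

lemma chebyshev_sum_eq:
  fixes u :: "nat \<Rightarrow> real"
  assumes "bij_betw \<sigma> {..<n} {..<n}"
  shows "(\<Sum>i<n. \<Sum>j<n. (real (\<sigma> i) - real (\<sigma> j)) * (u i - u j)) =
    real n * (\<Sum>i<n. (2 * real (\<sigma> i) - (real n - 1)) * u i)"
proof -
  define Z V W where "Z = (\<Sum>i<n. real (\<sigma> i))" and "V = (\<Sum>i<n. u i)" and "W = (\<Sum>i<n. real (\<sigma> i) * u i)"
  have 1: "(\<Sum>i<n. \<Sum>j<n. (real (\<sigma> i) - real (\<sigma> j)) * (u i - u j)) = real n * W - V * Z - (Z * V - real n * W)"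
    by (simp add: Z_def V_def W_def algebra_simps sum.distrib sum_subtractf
        sum_distrib_left[symmetric] sum_distrib_right[symmetric])
  have "2 * Z = real n * (real n - 1)" unfolding Z_def by (rule sum_bij_lessThan[OF assms])
  then have 2: "(2 * Z) * V = real n * (real n - 1) * V" by simp
  have 3: "(\<Sum>i<n. (2 * real (\<sigma> i) - (real n - 1)) * u i) = 2 * W - (real n - 1) * V"
    by (simp add: V_def W_def algebra_simps sum.distrib sum_subtractf sum_distrib_left)
  show ?thesis unfolding 1 3 using 2 by (simp add: algebra_simps)
qed

locale strict_seidl_cost = seidl_cost +
  assumes strict: "\<And>x1 x2 x3 x4. a \<le> x1 \<Longrightarrow> x1 < x2 \<Longrightarrow> x2 \<le> x3 \<Longrightarrow> x3 < x4 \<Longrightarrow> x4 \<le> b \<Longrightarrow>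
      w x1 x3 + w x2 x4 \<noteq> \<infinity> \<Longrightarrow> w x1 x3 + w x2 x4 < w x1 x4 + w x2 x3"
begin

lemma dyadic_gap_pos:
  assumes "0 < p1" "p1 < p2" "p2 < q1" "q1 < q2" "q2 \<le> 2 ^ N"
  shows "0 < dyadic_gap N p1 p2 q1 q2"
proof -
  define s1 s2 t1 t2 where "s1 = dyadic a b N p1" and "s2 = dyadic a b N p2" and "t1 = dyadic a b N q1"
    and "t2 = dyadic a b N q2"
  have o: "a < s1" "s1 < s2" "s2 < t1" "t1 < t2" "t2 \<le> b"
    unfolding s1_def s2_def t1_def t2_def
    using dyadic_less_iff[OF ab, of N 0 p1] dyadic_le_iff[OF ab, of N q2 "2 ^ N"] assms ab by simp_all
  have e: "w s1 t1 = ereal (r s1 t1)" "w s2 t2 = ereal (r s2 t2)" "w s1 t2 = ereal (r s1 t2)" "w s2 t1 = ereal (r s2 t1)"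
    by (rule w_eq[OF w_fin]; use o in simp)+
  have "w s1 t1 + w s2 t2 < w s1 t2 + w s2 t1" using o e by (intro strict) auto
  then show ?thesis unfolding dyadic_gap_def e s1_def[symmetric] s2_def[symmetric] t1_def[symmetric] t2_def[symmetric] by simp
qed

text \<open>With equal costs, the term kept in \<open>ot_cost_gap\<close> must vanish although the
  mixed difference is positive. The rectangles are countable, so one null set serves all of
  them.\<close>

lemma minimizer_AE_events:
  assumes \<gamma>: "\<gamma> \<in> couplings n \<rho>" and cost: "ot_cost n w \<gamma> = ot_cost n w (distr \<rho> (Rn n) orb)" "ot_cost n w \<gamma> \<noteq> \<infinity>"
  shows "AE y in \<gamma>. \<forall>N p1 p2 q1 q2. 0 < p1 \<longrightarrow> p1 < p2 \<longrightarrow> p2 < q1 \<longrightarrow> q1 < q2 \<longrightarrow> q2 \<le> 2 ^ N \<longrightarrow> y \<notin> crowded N p1 p2 q1 q2"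
  unfolding AE_all_countable
proof (intro allI)
  fix N p1 p2 q1 q2 :: nat
  interpret \<gamma>: prob_space \<gamma> using couplingsD[OF \<gamma>] by simp
  show "AE y in \<gamma>. 0 < p1 \<longrightarrow> p1 < p2 \<longrightarrow> p2 < q1 \<longrightarrow> q1 < q2 \<longrightarrow> q2 \<le> 2 ^ N \<longrightarrow> y \<notin> crowded N p1 p2 q1 q2"
  proof (cases "0 < p1 \<and> p1 < p2 \<and> p2 < q1 \<and> q1 < q2 \<and> q2 \<le> 2 ^ N")
    case False
    then show ?thesis by auto
  next
    case True
    define G where "G = dyadic_gap N p1 p2 q1 q2"
    have G: "G > 0" unfolding G_def using True by (intro dyadic_gap_pos) auto
    have "crowded N p1 p2 q1 q2 \<in> sets (Rn n)" unfolding crowded_def by measurable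
    then have B: "crowded N p1 p2 q1 q2 \<in> sets \<gamma>" using couplingsD(2)[OF \<gamma>] by simp
    have "measure \<gamma> (crowded N p1 p2 q1 q2) \<le> 0"
    proof (rule ot_cost_gap[OF \<gamma> cost(2)])
      fix x y assume *: "ot_cost n w (distr \<rho> (Rn n) orb) = ereal x" "ot_cost n w \<gamma> = ereal y"
        "\<And>N p1 p2 q1 q2. 0 < p1 \<Longrightarrow> p1 < p2 \<Longrightarrow> p2 < q1 \<Longrightarrow> q1 < q2 \<Longrightarrow> q2 \<le> 2 ^ N \<Longrightarrow>
         x \<le> y - 2 * dyadic_gap N p1 p2 q1 q2 * measure \<gamma> (crowded N p1 p2 q1 q2)"
      have "x = y" using * cost by simp
      moreover have "x \<le> y - 2 * G * measure \<gamma> (crowded N p1 p2 q1 q2)"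
        unfolding G_def by (rule *(3)) (use True in auto)
      ultimately have "G * measure \<gamma> (crowded N p1 p2 q1 q2) \<le> G * 0" by simp
      then show ?thesis using G by (simp only: mult_le_cancel_left_pos)
    qed
    then have "emeasure \<gamma> (crowded N p1 p2 q1 q2) = 0"
      by (simp add: \<gamma>.emeasure_eq_measure order_antisym measure_nonneg ennreal_neg)
    then show ?thesis using B by (intro AE_I[of _ _ "crowded N p1 p2 q1 q2"]) auto
  qed
qed

text \<open>The cells of \<open>y i\<close> and \<open>y j\<close>, with one further cell on each
  side as margin, form a rectangle whose event fails. As \<open>N\<close> grows the outer ends tend
  to \<open>y i\<close> and \<open>y j\<close>, and the distribution function is continuous.\<close>

lemma no_events_dense:
  assumes y: "y \<in> space (Rn n)" and int: "\<forall>i<n. a < y i \<and> y i < b"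
    and ev: "\<forall>N p1 p2 q1 q2. 0 < p1 \<longrightarrow> p1 < p2 \<longrightarrow> p2 < q1 \<longrightarrow> q1 < q2 \<longrightarrow> q2 \<le> 2 ^ N \<longrightarrow> y \<notin> crowded N p1 p2 q1 q2"
    and i: "i < n" and j: "j < n" and le: "y i \<le> y j"
  shows "real (card {k. k < n \<and> y i \<le> y k \<and> y k \<le> y j}) - 1 \<le> real n * cdf \<rho> (y j) - real n * cdf \<rho> (y i)"
proof -
  define h where "h N = (b - a) / 2 ^ N" for N :: nat
  have hpos: "h N > 0" for N using ab by (simp add: h_def)
  have step: "dyadic a b N (Suc p) = dyadic a b N p + h N" for N p
    by (simp add: dyadic_def h_def field_simps)
  have "\<exists>p q. dyadic a b N p \<le> y i \<and> y i < dyadic a b N p + h N \<and> dyadic a b N q \<le> y j \<and> y j < dyadic a b N q + h N" for N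
    using dyadic_cell[of a b "y i" N] dyadic_cell[of a b "y j" N] int i j ab step by (metis less_imp_le)
  then obtain p q where pq: "\<And>N. dyadic a b N (p N) \<le> y i \<and> y i < dyadic a b N (p N) + h N \<and>
      dyadic a b N (q N) \<le> y j \<and> y j < dyadic a b N (q N) + h N"
    by metis
  have h0: "h \<longlonglongrightarrow> 0" unfolding h_def by (simp add: LIMSEQ_divide_realpow_zero)
  have s: "(\<lambda>N. dyadic a b N (p N) - h N) \<longlonglongrightarrow> y i"
  proof (rule tendsto_sandwich[of "\<lambda>N. y i - 2 * h N" _ _ "\<lambda>N. y i - h N"])
    show "(\<lambda>N. y i - 2 * h N) \<longlonglongrightarrow> y i"
      using tendsto_diff[OF tendsto_const tendsto_mult[OF tendsto_const h0], of "y i" 2] by simp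
    show "(\<lambda>N. y i - h N) \<longlonglongrightarrow> y i"
      using tendsto_diff[OF tendsto_const h0, of "y i"] by simp
  qed (use pq in \<open>auto intro!: always_eventually simp: less_imp_le field_simps intro: less_imp_le\<close>)
  have t: "(\<lambda>N. dyadic a b N (q N) + 2 * h N) \<longlonglongrightarrow> y j"
  proof (rule tendsto_sandwich[of "\<lambda>N. y j + h N" _ _ "\<lambda>N. y j + 2 * h N"])
    show "(\<lambda>N. y j + 2 * h N) \<longlonglongrightarrow> y j"
      using tendsto_add[OF tendsto_const tendsto_mult[OF tendsto_const h0], of "y j" 2] by simp
    show "(\<lambda>N. y j + h N) \<longlonglongrightarrow> y j"
      using tendsto_add[OF tendsto_const h0, of "y j"] by simp
  qed (use pq in \<open>auto intro!: always_eventually simp: less_imp_le field_simps intro: less_imp_le\<close>)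
  have lim: "(\<lambda>N. real n * cdf \<rho> (dyadic a b N (q N) + 2 * h N) - real n * cdf \<rho> (dyadic a b N (p N) - h N))
    \<longlonglongrightarrow> real n * cdf \<rho> (y j) - real n * cdf \<rho> (y i)"
    using isCont_tendsto_compose[OF F_cont s] isCont_tendsto_compose[OF F_cont t] by (intro tendsto_intros)
  have "eventually (\<lambda>N. a < dyadic a b N (p N) - h N) sequentially"
    using order_tendstoD(1)[OF s, of a] int i by auto
  moreover have "eventually (\<lambda>N. dyadic a b N (q N) + 2 * h N < b) sequentially"
    using order_tendstoD(2)[OF t, of b] int j by auto
  ultimately have "eventually (\<lambda>N. real (card {k. k < n \<and> y i \<le> y k \<and> y k \<le> y j}) - 1 \<le>
     real n * cdf \<rho> (dyadic a b N (q N) + 2 * h N) - real n * cdf \<rho> (dyadic a b N (p N) - h N)) sequentially"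
  proof eventually_elim
    case (elim N)
    \<comment> \<open>The left margin is the cell before that of \<open>y i\<close>, so the index
      must have a predecessor \<open>p'\<close>, itself positive; for large \<open>N\<close> both
      hold since \<open>y i > a\<close>.\<close>
    have p0: "p N \<noteq> 0"
    proof
      assume "p N = 0"
      then show False using elim(1) hpos[of N] by simp
    qed
    then obtain p' where p': "p N = Suc p'" by (cases "p N") auto
    have s1: "dyadic a b N p' = dyadic a b N (p N) - h N" using step[of N p'] p' by simp
    have t1: "dyadic a b N (Suc (q N)) = dyadic a b N (q N) + h N"
      and t2: "dyadic a b N (Suc (Suc (q N))) = dyadic a b N (q N) + 2 * h N" using step by simp_all
    have "dyadic a b N 0 < dyadic a b N p'" using elim(1) s1 by simp
    then have 1: "0 < p'" using ab by (simp only: dyadic_less_iff)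
    have "dyadic a b N (p N) < dyadic a b N (Suc (q N))" using pq[of N] le t1 by linarith
    then have 2: "p N < Suc (q N)" using ab by (simp only: dyadic_less_iff)
    have "dyadic a b N (Suc (Suc (q N))) \<le> dyadic a b N (2 ^ N)" using elim(2) t2 by simp
    then have 3: "Suc (Suc (q N)) \<le> 2 ^ N" using ab by (simp only: dyadic_le_iff)
    have "y \<notin> crowded N p' (p N) (Suc (q N)) (Suc (Suc (q N)))"
      using ev 1 2 3 p' by simp
    then have "real (occ n {dyadic a b N (p N)..<dyadic a b N (Suc (q N))} y) - 1 \<le>
      real n * (cdf \<rho> (dyadic a b N (Suc (Suc (q N)))) - cdf \<rho> (dyadic a b N p'))"
      using y by (simp add: crowded_def)
    moreover have "card {k. k < n \<and> y i \<le> y k \<and> y k \<le> y j} \<le> occ n {dyadic a b N (p N)..<dyadic a b N (Suc (q N))} y"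
      unfolding occ_def using pq[of N] t1 by (intro card_mono) auto
    ultimately show ?case unfolding s1 t2 by (simp add: right_diff_distrib)
  qed
  then show ?thesis
    using tendsto_lowerbound[OF lim] by simp
qed

text \<open>The Chebyshev sum of a minimizing configuration is nonnegative by
  \<open>floor_is_rank\<close>, yet its mean equals that on Seidl orbits, which is 0: there the
  fractional part is common and centred ranks sum to 0. So it vanishes almost everywhere, and with
  it each product, forcing equal fractional parts.\<close>

lemma minimizer_equispaced:
  assumes \<gamma>: "\<gamma> \<in> couplings n \<rho>" and cost: "ot_cost n w \<gamma> = ot_cost n w (distr \<rho> (Rn n) orb)" "ot_cost n w \<gamma> \<noteq> \<infinity>"
  shows "AE y in \<gamma>. equispaced n y"
proof -
  interpret \<gamma>: prob_space \<gamma> using couplingsD[OF \<gamma>] by simp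
  have npos: "real n > 0" using n by simp
  \<comment> \<open>Twice the centred rank times the fractional part, both read off from
    \<open>n F x\<close>; as a function of one point it has the same integral under every
    coupling.\<close>
  define U where "U x = (2 * real_of_int \<lfloor>real n * cdf \<rho> x\<rfloor> - (real n - 1)) * (real n * cdf \<rho> x - real_of_int \<lfloor>real n * cdf \<rho> x\<rfloor>)" for x
  have [measurable]: "U \<in> borel_measurable borel" unfolding U_def by measurable
  have U_bound: "\<bar>U x\<bar> \<le> 3 * real n" for x
  proof -
    define z where "z = \<lfloor>real n * cdf \<rho> x\<rfloor>"
    have "0 \<le> real n * cdf \<rho> x" "real n * cdf \<rho> x \<le> real n * 1"
      using F_range[of x] mult_left_mono[of "cdf \<rho> x" 1 "real n"] by auto
    then have z: "0 \<le> z" "z \<le> int n" unfolding z_def by (auto simp: floor_le_iff)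
    then have "\<bar>2 * real_of_int z - (real n - 1)\<bar> \<le> 3 * real n" using npos n by linarith
    moreover have "\<bar>real n * cdf \<rho> x - real_of_int z\<bar> \<le> 1" unfolding z_def by linarith
    ultimately have "\<bar>2 * real_of_int z - (real n - 1)\<bar> * \<bar>real n * cdf \<rho> x - real_of_int z\<bar> \<le> 3 * real n * 1"
      by (intro mult_mono) auto
    then show ?thesis unfolding U_def z_def[symmetric] by (simp add: abs_mult)
  qed
  note int\<gamma> = integral_coupling_sum[OF \<gamma> \<open>U \<in> _\<close> U_bound]
  note intS = integral_coupling_sum[OF orb_coupling \<open>U \<in> _\<close> U_bound]
  have "(\<integral>y. (\<Sum>i<n. U (y i)) \<partial>distr \<rho> (Rn n) orb) = (\<integral>x. (\<Sum>i<n. U (orb x i)) \<partial>\<rho>)"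
    by (rule integral_distr) measurable
  also have "\<dots> = (\<integral>x. 0 \<partial>\<rho>)"
  proof (rule integral_cong_AE)
    show "AE x in \<rho>. (\<Sum>i<n. U (orb x i)) = 0"
      using AE_orb_equispaced
    proof eventually_elim
      case (elim x)
      then obtain u \<sigma> where u: "0 < u" "u < 1" and \<sigma>: "bij_betw \<sigma> {..<n} {..<n}"
        and F: "\<And>i. i < n \<Longrightarrow> real n * cdf \<rho> (orb x i) = u + real (\<sigma> i)"
        by (auto simp: equispaced_def)
      have "U (orb x i) = (2 * real (\<sigma> i) - (real n - 1)) * u" if "i < n" for i
      proof -
        have "\<lfloor>u + real (\<sigma> i)\<rfloor> = int (\<sigma> i)" using u by linarith
        then show ?thesis unfolding U_def F[OF that] by simp
      qed
      then have "(\<Sum>i<n. U (orb x i)) = (\<Sum>i<n. (2 * real (\<sigma> i) - (real n - 1)) * u)" by simp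
      also have "\<dots> = (2 * (\<Sum>i<n. real (\<sigma> i)) - real n * (real n - 1)) * u"
        by (simp add: sum_distrib_right[symmetric] sum_subtractf sum_distrib_left)
      also have "\<dots> = 0" unfolding sum_bij_lessThan[OF \<sigma>] by simp
      finally show ?case .
    qed
    show "(\<lambda>x. \<Sum>i<n. U (orb x i)) \<in> borel_measurable \<rho>" by measurable
  qed simp
  finally have "(\<integral>y. (\<Sum>i<n. U (y i)) \<partial>\<gamma>) = 0" using int\<gamma> intS by simp
  moreover have key: "AE y in \<gamma>. \<exists>\<sigma>. bij_betw \<sigma> {..<n} {..<n} \<and> (\<forall>i<n. \<lfloor>real n * cdf \<rho> (y i)\<rfloor> = int (\<sigma> i)) \<and>
      (\<forall>i<n. real n * cdf \<rho> (y i) \<notin> \<int>) \<and>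
      (\<forall>i<n. \<forall>j<n. 0 \<le> (real (\<sigma> i) - real (\<sigma> j)) * ((real n * cdf \<rho> (y i) - real (\<sigma> i)) - (real n * cdf \<rho> (y j) - real (\<sigma> j))))"
  proof -
    have "AE x in \<rho>. real n * cdf \<rho> x \<notin> \<int>"
    proof -
      have "AE x in \<rho>. \<forall>z::int. cdf \<rho> x \<noteq> real_of_int z / real n"
        by (subst AE_all_countable) (simp add: AE_level)
      then show ?thesis
        by eventually_elim (use npos in \<open>auto elim!: Ints_cases simp: field_simps\<close>)
    qed
    from AE_coupling[OF \<gamma> this] AE_coupling[OF \<gamma> AE_interior] minimizer_AE_events[OF \<gamma> cost] AE_space
    show ?thesis
    proof eventually_elim
      case (elim y)
      have sp: "y \<in> space (Rn n)" using elim(4) couplingsD(3)[OF \<gamma>] by simp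
      show ?case
      proof (rule floor_is_rank[where \<tau> = "\<lambda>i. real n * cdf \<rho> (y i)" and y = y and n = n])
        show "0 \<le> real n * cdf \<rho> (y i) \<and> real n * cdf \<rho> (y i) \<le> real n" for i
          using F_range[of "y i"] mult_left_mono[of "cdf \<rho> (y i)" 1 "real n"] by auto
      qed (use elim no_events_dense[OF sp] in blast)+
    qed
  qed
  have pos: "AE y in \<gamma>. 0 \<le> (\<Sum>i<n. U (y i)) \<and> ((\<Sum>i<n. U (y i)) = 0 \<longrightarrow> equispaced n y)"
    using key
  proof eventually_elim
    case (elim y)
    then obtain \<sigma> where \<sigma>: "bij_betw \<sigma> {..<n} {..<n}" and fl: "\<And>i. i < n \<Longrightarrow> \<lfloor>real n * cdf \<rho> (y i)\<rfloor> = int (\<sigma> i)"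
      and ni: "\<And>i. i < n \<Longrightarrow> real n * cdf \<rho> (y i) \<notin> \<int>"
      and mono: "\<And>i j. i < n \<Longrightarrow> j < n \<Longrightarrow> 0 \<le> (real (\<sigma> i) - real (\<sigma> j)) *
         ((real n * cdf \<rho> (y i) - real (\<sigma> i)) - (real n * cdf \<rho> (y j) - real (\<sigma> j)))"
      by blast
    define u where "u i = real n * cdf \<rho> (y i) - real (\<sigma> i)" for i
    have "(\<Sum>i<n. U (y i)) = (\<Sum>i<n. (2 * real (\<sigma> i) - (real n - 1)) * u i)"
      by (intro sum.cong) (auto simp: U_def fl u_def)
    then have eq: "real n * (\<Sum>i<n. U (y i)) = (\<Sum>i<n. \<Sum>j<n. (real (\<sigma> i) - real (\<sigma> j)) * (u i - u j))"
      using chebyshev_sum_eq[OF \<sigma>, of u] by simp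
    have nn: "0 \<le> (real (\<sigma> i) - real (\<sigma> j)) * (u i - u j)" if "i < n" "j < n" for i j
      using mono[OF that] by (simp add: u_def)
    have "0 \<le> real n * (\<Sum>i<n. U (y i))" unfolding eq using nn by (intro sum_nonneg) auto
    then have "0 \<le> (\<Sum>i<n. U (y i))" using npos by (simp add: zero_le_mult_iff)
    moreover have "equispaced n y" if "(\<Sum>i<n. U (y i)) = 0"
    proof -
      have "(\<Sum>i<n. \<Sum>j<n. (real (\<sigma> i) - real (\<sigma> j)) * (u i - u j)) = 0" using eq that by simp
      then have row: "\<forall>i\<in>{..<n}. (\<Sum>j<n. (real (\<sigma> i) - real (\<sigma> j)) * (u i - u j)) = 0"
        by (subst (asm) sum_nonneg_eq_0_iff) (use nn in \<open>auto intro!: sum_nonneg\<close>)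
      have z: "(real (\<sigma> i) - real (\<sigma> j)) * (u i - u j) = 0" if ij: "i < n" "j < n" for i j
      proof -
        have "(\<Sum>j<n. (real (\<sigma> i) - real (\<sigma> j)) * (u i - u j)) = 0" using row ij by blast
        then have "\<forall>j\<in>{..<n}. (real (\<sigma> i) - real (\<sigma> j)) * (u i - u j) = 0"
          by (subst (asm) sum_nonneg_eq_0_iff) (use nn ij in \<open>simp_all\<close>)
        then show ?thesis using ij by blast
      qed
      have "u i = u 0" if i: "i < n" for i
      \<comment> \<open>Different points have different ranks, so a vanishing product leaves only
        equality of the fractional parts.\<close>
      proof (cases "i = 0")
        case False
        then have "\<sigma> i \<noteq> \<sigma> 0" using bij_betw_imp_inj_on[OF \<sigma>] i n by (auto dest!: inj_onD)
        then show ?thesis using z[of i 0] i by simp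
      qed simp
      then have "\<forall>i<n. real n * cdf \<rho> (y i) = u 0 + real (\<sigma> i)" by (metis u_def diff_add_cancel)
      moreover have "0 < u 0" "u 0 < 1"
      proof -
        have 0: "0 < n" using n by simp
        have "u 0 \<noteq> 0" using ni[OF 0] by (auto simp: u_def)
        then show "0 < u 0" "u 0 < 1" using fl[OF 0] unfolding u_def by linarith+
      qed
      ultimately show ?thesis unfolding equispaced_def using \<sigma> by blast
    qed
    ultimately show ?case by blast
  qed
  have "AE y in \<gamma>. (\<Sum>i<n. U (y i)) = 0"
    using integral_nonneg_eq_0_iff_AE[OF int\<gamma>(1)] pos \<open>(\<integral>y. (\<Sum>i<n. U (y i)) \<partial>\<gamma>) = 0\<close>
    by (auto elim!: eventually_mono)
  with pos show ?thesis by eventually_elim blast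
qed

text \<open>Equispacing fixes the points only up to level sets of the distribution function; almost
  everywhere these are singletons, so a configuration is determined by its first point up to
  order.\<close>

lemma equispaced_AE_orbit:
  assumes \<gamma>: "\<gamma> \<in> couplings n \<rho>" and eq: "AE y in \<gamma>. equispaced n y"
  shows "AE y in \<gamma>. \<exists>\<pi>. \<pi> permutes {..<n} \<and> y = perm_coords n \<pi> (orb (y 0))"
proof -
  have n0: "0 < n" using n by simp
  from AE_coupling[OF \<gamma> AE_orb_shift] AE_coupling[OF \<gamma> AE_F_injective] eq AE_space
  show ?thesis
  proof eventually_elim
    case (elim y)
    obtain u' j where u': "0 < u'" "u' < 1" "j < n"
      and orb: "\<And>k. k < n \<Longrightarrow> real n * cdf \<rho> (orb (y 0) k) = u' + real ((j + k) mod n)"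
      using elim(1) n0 by blast
    obtain u \<sigma> where u: "0 < u" "u < 1" and \<sigma>: "bij_betw \<sigma> {..<n} {..<n}"
      and F: "\<And>i. i < n \<Longrightarrow> real n * cdf \<rho> (y i) = u + real (\<sigma> i)"
      using elim(3) by (auto simp: equispaced_def)
    have "orb (y 0) 0 = y 0" using n0 by (simp add: orb_def)
    then have "u' + real j = u + real (\<sigma> 0)" using orb[OF n0] F[OF n0] u' by simp
    moreover from this have "j = \<sigma> 0" using u u' by linarith
    ultimately have uu: "u' = u" by simp
    define \<mu> where "\<mu> k = (j + k) mod n" for k
    have \<mu>: "bij_betw \<mu> {..<n} {..<n}" unfolding \<mu>_def by (rule bij_shift_mod)
    \<comment> \<open>\<open>\<mu> k\<close> is the cell of the orbit point \<open>k\<close> and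
      \<open>\<sigma> i\<close> that of \<open>y i\<close>; hence \<open>\<pi> i\<close> is the
      orbit time at which the cell of \<open>y i\<close> is visited.\<close>
    define \<pi> where "\<pi> i = (if i < n then inv_into {..<n} \<mu> (\<sigma> i) else i)" for i
    have "bij_betw (inv_into {..<n} \<mu> \<circ> \<sigma>) {..<n} {..<n}"
      using \<sigma> bij_betw_inv_into[OF \<mu>] by (rule bij_betw_trans)
    moreover have "bij_betw (inv_into {..<n} \<mu> \<circ> \<sigma>) {..<n} {..<n} \<longleftrightarrow> bij_betw \<pi> {..<n} {..<n}"
      by (rule bij_betw_cong) (simp add: \<pi>_def)
    ultimately have "bij_betw \<pi> {..<n} {..<n}" by blast
    then have \<pi>: "\<pi> permutes {..<n}" by (rule bij_imp_permutes) (simp add: \<pi>_def)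
    have yi: "y i = orb (y 0) (\<pi> i)" if i: "i < n" for i
    proof -
      have "\<sigma> i \<in> {..<n}" using bij_betwE[OF \<sigma>] i by auto
      then have "\<mu> (\<pi> i) = \<sigma> i" using bij_betw_inv_into_right[OF \<mu>] i by (simp add: \<pi>_def)
      moreover have "\<pi> i < n" using permutes_in_image[OF \<pi>, of i] i by simp
      ultimately have "real n * cdf \<rho> (orb (y 0) (\<pi> i)) = real n * cdf \<rho> (y i)"
        using orb[of "\<pi> i"] F[OF i] uu by (simp add: \<mu>_def)
      then have "cdf \<rho> (orb (y 0) (\<pi> i)) = cdf \<rho> (y i)" using n0 by simp
      with elim(2) i have "orb (y 0) (\<pi> i) = y i" by blast
      then show ?thesis by (rule sym)
    qed
    have ext: "y \<in> extensional {..<n}"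
      using elim(4) couplingsD(3)[OF \<gamma>] by (auto simp: space_PiM PiE_def)
    have "y = perm_coords n \<pi> (orb (y 0))"
    proof
      fix i
      show "y i = perm_coords n \<pi> (orb (y 0)) i"
      proof (cases "i < n")
        case True
        then show ?thesis unfolding perm_coords_apply[OF True] by (rule yi)
      next
        case False
        then show ?thesis using ext by (simp add: perm_coords_def extensional_def)
      qed
    qed
    then show ?case using \<pi> by blast
  qed
qed

text \<open>A symmetric measure is tested by permutation-invariant functions, and on permuted orbits
  such a function depends on \<open>y 0\<close> alone, whose law is \<open>\<rho>\<close>.\<close>

lemma symmetric_minimizer_unique:
  assumes \<gamma>: "\<gamma> \<in> couplings n \<rho>" and sym: "symmetric_measure n \<gamma>"
    and cost: "ot_cost n w \<gamma> = ot_cost n w (distr \<rho> (Rn n) orb)" "ot_cost n w \<gamma> \<noteq> \<infinity>"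
  shows "\<gamma> = symmetrization n (distr \<rho> (Rn n) orb)"
proof -
  have n0: "0 < n" using n by simp
  let ?S = "distr \<rho> (Rn n) orb"
  note cS = couplingsD[OF orb_coupling]
  note c = couplingsD[OF \<gamma>]
  have orbit: "AE y in \<gamma>. \<exists>\<pi>. \<pi> permutes {..<n} \<and> y = perm_coords n \<pi> (orb (y 0))"
    using equispaced_AE_orbit[OF \<gamma> minimizer_equispaced[OF \<gamma> cost]] .
  show ?thesis
  proof (rule measure_eqI)
    show "sets \<gamma> = sets (symmetrization n ?S)" using c(2) sets_symmetrization[OF cS(1,2)] by simp
    fix A assume "A \<in> sets \<gamma>"
    then have A: "A \<in> sets (Rn n)" using c by simp
    \<comment> \<open>The invariant version of the indicator of \<open>A\<close>; its integral is
      \<open>n!\<close> times the symmetrized mass of \<open>A\<close>.\<close>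
    define h :: "(nat \<Rightarrow> real) \<Rightarrow> ennreal" where "h y = (\<Sum>\<sigma>\<in>perms n. indicator A (perm_coords n \<sigma> y))" for y
    have im: "(\<lambda>y. indicator A (perm_coords n \<sigma> y) :: ennreal) \<in> borel_measurable (Rn n)" if "\<sigma> \<in> perms n" for \<sigma>
      using that A by (intro measurable_compose[OF perm_coords_measurable]) auto
    have h_meas: "h \<in> borel_measurable (Rn n)" unfolding h_def using im by (intro borel_measurable_sum)
    have h_inv: "h (perm_coords n \<pi> y) = h y" if \<pi>: "\<pi> permutes {..<n}" for \<pi> y
    proof -
      have "h (perm_coords n \<pi> y) = (\<Sum>\<sigma>\<in>perms n. indicator A (perm_coords n (\<pi> \<circ> \<sigma>) y))"
        unfolding h_def by (intro sum.cong) (auto simp: perm_coords_comp)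
      also have "\<dots> = h y" unfolding h_def by (rule sum_perms_comp(1)[OF \<pi>])
      finally show ?thesis .
    qed
    have hsum: "(\<integral>\<^sup>+ y. h y \<partial>M) = (\<Sum>\<sigma>\<in>perms n. \<integral>\<^sup>+ y. indicator A (perm_coords n \<sigma> y) \<partial>M)"
      if "sets M = sets (Rn n)" for M
      unfolding h_def using im measurable_cong_sets[OF that refl] by (intro nn_integral_sum) blast
    have comp: "(\<lambda>y. y 0) \<in> borel_measurable \<gamma>" using coupling_component[OF \<gamma> n0] .
    have ho: "(\<lambda>x. h (orb x)) \<in> borel_measurable borel" using measurable_compose[OF orb_measurable h_meas] .
    have "emeasure \<gamma> A = (\<Sum>\<sigma>\<in>perms n. emeasure \<gamma> A) / of_nat (fact n)" by (rule ennreal_average[symmetric])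
    also have "(\<Sum>\<sigma>\<in>perms n. emeasure \<gamma> A) = (\<Sum>\<sigma>\<in>perms n. \<integral>\<^sup>+ y. indicator A (perm_coords n \<sigma> y) \<partial>\<gamma>)"
    proof (rule sum.cong[OF refl])
      fix \<sigma> assume \<sigma>: "\<sigma> \<in> perms n"
      then have m: "perm_coords n \<sigma> \<in> measurable \<gamma> (Rn n)"
        using perm_coords_measurable[of \<sigma> n] measurable_cong_sets[OF c(2) refl] by blast
      have "emeasure \<gamma> A = emeasure (distr \<gamma> (Rn n) (perm_coords n \<sigma>)) A"
        using sym \<sigma> by (simp add: symmetric_measure_def)
      then show "emeasure \<gamma> A = (\<integral>\<^sup>+ y. indicator A (perm_coords n \<sigma> y) \<partial>\<gamma>)"
        using A nn_integral_distr[OF m, of "indicator A"] by simp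
    qed
    also have "\<dots> = (\<integral>\<^sup>+ y. h y \<partial>\<gamma>)" by (rule hsum[OF c(2), symmetric])
    also have "\<dots> = (\<integral>\<^sup>+ y. h (orb (y 0)) \<partial>\<gamma>)"
    proof (rule nn_integral_cong_AE)
      show "AE y in \<gamma>. h y = h (orb (y 0))"
        using orbit by eventually_elim (metis h_inv)
    qed
    also have "\<dots> = (\<integral>\<^sup>+ x. h (orb x) \<partial>distr \<gamma> borel (\<lambda>y. y 0))"
      by (rule nn_integral_distr[OF comp, symmetric]) (simp add: ho)
    also have "\<dots> = (\<integral>\<^sup>+ x. h (orb x) \<partial>\<rho>)" using c(4)[OF n0] by simp
    also have "\<dots> = (\<integral>\<^sup>+ y. h y \<partial>?S)" using h_meas by (intro nn_integral_distr[symmetric]) auto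
    also have "\<dots> = (\<Sum>\<sigma>\<in>perms n. \<integral>\<^sup>+ y. indicator A (perm_coords n \<sigma> y) \<partial>?S)" by (rule hsum) simp
    also have "\<dots> / of_nat (fact n) = (\<integral>\<^sup>+ y. indicator A y \<partial>symmetrization n ?S)"
      using A by (intro nn_integral_symmetrization[OF cS(1,2), symmetric]) simp
    also have "\<dots> = emeasure (symmetrization n ?S) A"
      using A sets_symmetrization[OF cS(1,2)] by simp
    finally show "emeasure \<gamma> A = emeasure (symmetrization n ?S) A" .
  qed
qed

end

section \<open>Finiteness of the cost off the diagonal\<close>

text \<open>The law of \<open>\<Phi> i t\<close> for a random index \<open>i\<close> and an
  independent uniform \<open>t\<close> in the unit interval. It produces the concentrating measure
  below, as well as the four-block measure and its couplings.\<close>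

definition mixture :: "nat pmf \<Rightarrow> 'a measure \<Rightarrow> (nat \<Rightarrow> real \<Rightarrow> 'a) \<Rightarrow> 'a measure" where
  "mixture p N \<Phi> = distr (measure_pmf p \<Otimes>\<^sub>M uniform_measure lborel {0..1}) N (\<lambda>z. \<Phi> (fst z) (snd z))"

lemma prob_space_unit: "prob_space (uniform_measure lborel {0..1::real})"
  by (rule prob_space_uniform_measure) auto

lemma AE_unit: "AE t in uniform_measure lborel {0..1::real}. 0 < t \<and> t < 1 \<and> t \<noteq> c"
proof (rule AE_uniform_measureI)
  have "AE t in lborel. t \<noteq> 0 \<and> t \<noteq> 1 \<and> t \<noteq> c" by (intro AE_conjI AE_lborel_singleton)
  then show "AE t in lborel. t \<in> {0..1::real} \<longrightarrow> 0 < t \<and> t < 1 \<and> t \<noteq> c"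
    by eventually_elim auto
qed simp

lemma mixture_measurable:
  fixes p :: "nat pmf" and \<Phi> :: "nat \<Rightarrow> real \<Rightarrow> 'a"
  assumes "\<And>i. \<Phi> i \<in> measurable borel N"
  shows "(\<lambda>z. \<Phi> (fst z) (snd z)) \<in> measurable (measure_pmf p \<Otimes>\<^sub>M uniform_measure lborel {0..1}) N"
proof -
  have U: "measurable (uniform_measure lborel {0..1::real}) N = measurable borel N"
    by (rule measurable_cong_sets) simp_all
  have 1: "(\<lambda>z. \<Phi> (fst z) (snd z)) \<in> measurable (count_space UNIV \<Otimes>\<^sub>M uniform_measure lborel {0..1}) N"
  proof (rule measurable_pair_measure_countable1)
    show "(\<lambda>t. \<Phi> (fst (i, t)) (snd (i, t))) \<in> measurable (uniform_measure lborel {0..1}) N" for i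
      unfolding U fst_conv snd_conv by (rule assms)
  qed simp
  have "sets (measure_pmf p \<Otimes>\<^sub>M uniform_measure lborel {0..1}) = sets (count_space UNIV \<Otimes>\<^sub>M uniform_measure lborel {0..1::real})"
    by (rule sets_pair_measure_cong) simp_all
  from measurable_cong_sets[OF this refl] 1 show ?thesis by (rule ssubst)
qed

lemma sets_mixture [simp]: "sets (mixture p N \<Phi>) = sets N"
  by (simp add: mixture_def)

lemma prob_space_mixture:
  assumes "\<And>i. \<Phi> i \<in> measurable borel N"
  shows "prob_space (mixture p N \<Phi>)"
proof -
  interpret U: prob_space "uniform_measure lborel {0..1::real}" by (rule prob_space_unit)
  interpret P: pair_prob_space "measure_pmf p" "uniform_measure lborel {0..1::real}" ..
  show ?thesis unfolding mixture_def by (rule P.prob_space_distr[OF mixture_measurable[OF assms]])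
qed

lemma nn_integral_mixture_pmf:
  assumes \<Phi>: "\<And>i. \<Phi> i \<in> measurable borel N" and f: "f \<in> borel_measurable N"
  shows "(\<integral>\<^sup>+ x. f x \<partial>mixture p N \<Phi>) = (\<integral>\<^sup>+ i. \<integral>\<^sup>+ t. f (\<Phi> i t) \<partial>uniform_measure lborel {0..1} \<partial>measure_pmf p)"
proof -
  interpret U: prob_space "uniform_measure lborel {0..1::real}" by (rule prob_space_unit)
  have "(\<lambda>z. f (\<Phi> (fst z) (snd z))) \<in> borel_measurable (measure_pmf p \<Otimes>\<^sub>M uniform_measure lborel {0..1})"
    using measurable_compose[OF mixture_measurable[OF \<Phi>] f] .
  from U.nn_integral_fst[OF this] show ?thesis
    unfolding mixture_def using f by (subst nn_integral_distr[OF mixture_measurable[OF \<Phi>]]) auto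
qed

lemma nonatomic_mixture:
  fixes c s :: "nat \<Rightarrow> real"
  assumes s: "\<And>i. s i \<noteq> 0" and ab: "\<And>i t. 0 < t \<Longrightarrow> t < 1 \<Longrightarrow> c i + s i * t \<in> {a..b}"
  shows "nonatomic_prob a b (mixture p borel (\<lambda>i t. c i + s i * t))" (is "nonatomic_prob a b ?\<rho>")
  unfolding nonatomic_prob_def
proof (intro conjI allI)
  interpret U: prob_space "uniform_measure lborel {0..1::real}" by (rule prob_space_unit)
  have m: "\<And>i. (\<lambda>t. c i + s i * t) \<in> measurable borel borel" by measurable
  show "prob_space ?\<rho>" using m by (rule prob_space_mixture)
  have em: "emeasure ?\<rho> A = (\<integral>\<^sup>+ i. \<integral>\<^sup>+ t. indicator A (c i + s i * t) \<partial>uniform_measure lborel {0..1} \<partial>measure_pmf p)"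
    if "A \<in> sets borel" for A
  proof -
    have "emeasure ?\<rho> A = (\<integral>\<^sup>+ x. indicator A x \<partial>?\<rho>)" using that by simp
    also have "\<dots> = (\<integral>\<^sup>+ i. \<integral>\<^sup>+ t. indicator A (c i + s i * t) \<partial>uniform_measure lborel {0..1} \<partial>measure_pmf p)"
      using that by (intro nn_integral_mixture_pmf m) simp
    finally show ?thesis .
  qed
  have "(\<integral>\<^sup>+ t. indicator {a..b} (c i + s i * t) \<partial>uniform_measure lborel {0..1}) = (1::ennreal)" for i
  proof -
    have "(\<integral>\<^sup>+ t. indicator {a..b} (c i + s i * t) \<partial>uniform_measure lborel {0..1}) = (\<integral>\<^sup>+ t. 1 \<partial>uniform_measure lborel {0..1::real})"
    proof (rule nn_integral_cong_AE)
      show "AE t in uniform_measure lborel {0..1}. indicator {a..b} (c i + s i * t) = (1::ennreal)"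
        using AE_unit[of 0] by eventually_elim (use ab[of _ i] in \<open>auto simp: indicator_def\<close>)
    qed
    then show ?thesis by (simp only: nn_integral_const) (simp add: U.emeasure_space_1[simplified])
  qed
  then show "emeasure ?\<rho> {a..b} = 1"
    using em[of "{a..b}"] by (simp add: measure_pmf.emeasure_space_1)
  fix x
  have "(\<integral>\<^sup>+ t. indicator {x} (c i + s i * t) \<partial>uniform_measure lborel {0..1}) = (0::ennreal)" for i
  proof -
    have "(\<integral>\<^sup>+ t. indicator {x} (c i + s i * t) \<partial>uniform_measure lborel {0..1}) = (\<integral>\<^sup>+ t. (0::ennreal) \<partial>uniform_measure lborel {0..1::real})"
    proof (rule nn_integral_cong_AE)
      show "AE t in uniform_measure lborel {0..1}. indicator {x} (c i + s i * t) = (0::ennreal)"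
        using AE_unit[of "(x - c i) / s i"] by eventually_elim (use s[of i] in \<open>auto simp: indicator_def field_simps\<close>)
    qed
    then show ?thesis by simp
  qed
  then show "emeasure ?\<rho> {x} = 0" using em[of "{x}"] by simp
qed simp

lemma cost_n_2: "cost_n 2 w y = w (y 0) (y 1) + w (y 1) (y 0)"
  by (simp add: cost_n_def numeral_2_eq_2 lessThan_Suc insert_Diff_if add.commute)

text \<open>By the tube lemma \<open>w\<close> exceeds \<open>4 ^ k\<close> whenever one point is
  close enough to \<open>c\<close>, wherever in \<open>{p..q}\<close> the other is. Giving that
  neighbourhood mass at least \<open>1 / 2 ^ Suc k\<close> costs at least \<open>2 ^ k\<close> under
  every coupling, for each \<open>k\<close>.\<close>

lemma F_OT_infinite:
  assumes w_cont: "continuous_on UNIV (\<lambda>z. w (fst z) (snd z))" and w_sym: "\<And>x y. w x y = w y x"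
    and pq: "a \<le> p" "p < q" "q \<le> b" and c: "c \<in> {p..q}" and inf: "\<And>z. z \<in> {p..q} \<Longrightarrow> w c z = \<infinity>"
  obtains \<rho> where "nonatomic_prob a b \<rho>" "F_OT 2 w \<rho> = \<infinity>"
proof -
  \<comment> \<open>A nonzero displacement from \<open>c\<close> to an end of the interval, so that
    the measure stays in \<open>{p..q}\<close> even when \<open>c\<close> is itself an end.\<close>
  define e where "e = (if c < q then q - c else p - c)"
  have e: "e \<noteq> 0" and seg: "0 \<le> \<theta> \<Longrightarrow> \<theta> \<le> 1 \<Longrightarrow> c + e * \<theta> \<in> {p..q}" for \<theta>
  proof -
    show "e \<noteq> 0" using pq c by (auto simp: e_def)
    assume \<theta>: "0 \<le> \<theta>" "\<theta> \<le> 1"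
    have "(q - c) * \<theta> \<le> (q - c) * 1" "(c - p) * \<theta> \<le> (c - p) * 1" "0 \<le> (q - c) * \<theta>" "0 \<le> (c - p) * \<theta>"
      using c \<theta> by (auto intro!: mult_left_le)
    then show "c + e * \<theta> \<in> {p..q}" using c by (auto simp: e_def algebra_simps)
  qed
  have near: "\<exists>\<delta>. 0 < \<delta> \<and> \<delta> \<le> 1 \<and> (\<forall>\<theta> z. 0 \<le> \<theta> \<longrightarrow> \<theta> \<le> \<delta> \<longrightarrow> z \<in> {p..q} \<longrightarrow> ereal (4 ^ k) < w (c + e * \<theta>) z)" for k :: nat
  proof -
    let ?W = "{v. ereal (4 ^ k) < w (fst v) (snd v)}"
    have "open ?W" using w_cont by (intro open_Collect_less continuous_intros) auto
    moreover have "{c} \<times> {p..q} \<subseteq> ?W" using inf by auto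
    ultimately obtain X where X: "open X" "c \<in> X" "X \<times> {p..q} \<subseteq> ?W"
      using Elementary_Topology.tube_lemma[of "{p..q}" ?W c] by auto
    obtain \<epsilon> where \<epsilon>: "\<epsilon> > 0" "\<And>x. dist x c < \<epsilon> \<Longrightarrow> x \<in> X"
      using X(1,2) unfolding open_dist by blast
    define \<delta> where "\<delta> = min 1 (\<epsilon> / (2 * \<bar>e\<bar>))"
    have "ereal (4 ^ k) < w (c + e * \<theta>) z" if "0 \<le> \<theta>" "\<theta> \<le> \<delta>" "z \<in> {p..q}" for \<theta> z
    proof -
      have "\<bar>e\<bar> * \<theta> \<le> \<bar>e\<bar> * (\<epsilon> / (2 * \<bar>e\<bar>))" using that by (intro mult_left_mono) (auto simp: \<delta>_def)
      also have "\<dots> < \<epsilon>" using e \<epsilon> by simp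
      finally have "dist (c + e * \<theta>) c < \<epsilon>" using that by (simp add: dist_real_def abs_mult)
      then have "(c + e * \<theta>, z) \<in> X \<times> {p..q}" using \<epsilon>(2) that by blast
      from subsetD[OF X(3) this] show ?thesis by simp
    qed
    moreover have "0 < \<delta>" "\<delta> \<le> 1" using e \<epsilon> by (auto simp: \<delta>_def)
    ultimately show ?thesis by blast
  qed
  then have "\<exists>\<delta>. \<forall>k. 0 < \<delta> k \<and> \<delta> k \<le> 1 \<and>
      (\<forall>\<theta> z. 0 \<le> \<theta> \<longrightarrow> \<theta> \<le> \<delta> k \<longrightarrow> z \<in> {p..q} \<longrightarrow> ereal (4 ^ k) < w (c + e * \<theta>) z)"
    by (intro choice allI)
  then obtain \<delta> where \<delta>: "\<And>k. 0 < \<delta> k" "\<And>k. \<delta> k \<le> 1"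
    "\<And>k \<theta> z. 0 \<le> \<theta> \<Longrightarrow> \<theta> \<le> \<delta> k \<Longrightarrow> z \<in> {p..q} \<Longrightarrow> ereal (4 ^ k) < w (c + e * \<theta>) z"
    by blast
  define \<Phi> where "\<Phi> = (\<lambda>(k::nat) t. c + e * \<delta> k * t)"
  define \<rho> where "\<rho> = mixture (geometric_pmf (1 / 2)) borel \<Phi>"
  have \<Phi>_pq: "\<Phi> k t \<in> {p..q}" if "0 < t" "t < 1" for k t
    using seg[of "\<delta> k * t"] \<delta>(1,2)[of k] that mult_mono[of "\<delta> k" 1 t 1] by (simp add: \<Phi>_def mult.assoc)
  have \<Phi>_meas: "\<Phi> k \<in> measurable borel borel" for k unfolding \<Phi>_def by measurable
  have na: "nonatomic_prob a b \<rho>"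
    unfolding \<rho>_def \<Phi>_def
  proof (rule nonatomic_mixture)
    show "e * \<delta> i \<noteq> 0" for i using e \<delta>(1)[of i] by auto
    show "c + e * \<delta> i * t \<in> {a..b}" if "0 < t" "t < 1" for i t
      using \<Phi>_pq[OF that, of i] pq by (auto simp: \<Phi>_def)
  qed
  \<comment> \<open>Concentration on \<open>{p..q}\<close>, not merely on \<open>{a..b}\<close>, is
    what places the second point where the blow-up is known.\<close>
  have na_pq: "nonatomic_prob p q \<rho>"
    unfolding \<rho>_def \<Phi>_def
  proof (rule nonatomic_mixture)
    show "e * \<delta> i \<noteq> 0" for i using e \<delta>(1)[of i] by auto
    show "c + e * \<delta> i * t \<in> {p..q}" if "0 < t" "t < 1" for i t
      using \<Phi>_pq[OF that, of i] by (simp add: \<Phi>_def)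
  qed
  interpret pq: nonatomic p q \<rho> by unfold_locales (rule na_pq)
  define E where "E k = (\<lambda>\<theta>. c + e * \<theta>) ` {0..\<delta> k}" for k
  have E_borel: "E k \<in> sets borel" for k
    unfolding E_def by (intro borel_closed compact_imp_closed compact_continuous_image continuous_intros) auto
  have E_mass: "ennreal (1 / 2 ^ Suc k) \<le> emeasure \<rho> (E k)" for k
  proof -
    interpret U: prob_space "uniform_measure lborel {0..1::real}" by (rule prob_space_unit)
    have "(\<integral>\<^sup>+ t. 1 \<partial>uniform_measure lborel {0..1::real}) = (\<integral>\<^sup>+ t. indicator (E k) (\<Phi> k t) \<partial>uniform_measure lborel {0..1})"
    proof (rule nn_integral_cong_AE)
      show "AE t in uniform_measure lborel {0..1}. 1 = (indicator (E k) (\<Phi> k t) :: ennreal)"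
        using AE_unit[of 0]
      proof eventually_elim
        case (elim t)
        then have "\<Phi> k t = c + e * (\<delta> k * t)" "0 \<le> \<delta> k * t" "\<delta> k * t \<le> \<delta> k"
          using \<delta>(1)[of k] by (auto simp: \<Phi>_def mult.assoc)
        then have "\<Phi> k t \<in> E k" unfolding E_def by auto
        then show ?case by simp
      qed
    qed
    then have 1: "(\<integral>\<^sup>+ t. indicator (E k) (\<Phi> k t) \<partial>uniform_measure lborel {0..1}) = (1::ennreal)"
      using U.emeasure_space_1 by simp
    have "ennreal (1 / 2 ^ Suc k) = (\<integral>\<^sup>+ i. indicator {k} i \<partial>measure_pmf (geometric_pmf (1 / 2)))"
      by (simp add: emeasure_pmf_single power_divide)
    also have "\<dots> \<le> (\<integral>\<^sup>+ i. \<integral>\<^sup>+ t. indicator (E k) (\<Phi> i t) \<partial>uniform_measure lborel {0..1} \<partial>measure_pmf (geometric_pmf (1 / 2)))"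
      using 1 by (intro nn_integral_mono) (auto simp: indicator_def)
    also have "\<dots> = (\<integral>\<^sup>+ x. indicator (E k) x \<partial>\<rho>)"
      unfolding \<rho>_def using E_borel by (intro nn_integral_mixture_pmf[symmetric] \<Phi>_meas) simp
    also have "\<dots> = emeasure \<rho> (E k)" using E_borel by (simp add: \<rho>_def)
    finally show ?thesis .
  qed
  have "ot_cost 2 w \<gamma> = \<infinity>" if \<gamma>: "\<gamma> \<in> couplings 2 \<rho>" for \<gamma>
  proof -
    have "ennreal (2 ^ k) \<le> (\<integral>\<^sup>+ y. e2ennreal (cost_n 2 w y) \<partial>\<gamma>)" for k
    proof -
      have comp: "(\<lambda>y. y 0) \<in> borel_measurable \<gamma>" using coupling_component[OF \<gamma>] by simp
      \<comment> \<open>The factor 2 comes from the two orders of the pair.\<close>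
      have "ennreal (2 ^ k) = ennreal (2 * 4 ^ k) * ennreal (1 / 2 ^ Suc k)"
      proof -
        have "(4::real) ^ k = 2 ^ k * 2 ^ k" by (simp flip: power_mult_distrib)
        then show ?thesis by (subst ennreal_mult[symmetric]) auto
      qed
      also have "\<dots> \<le> ennreal (2 * 4 ^ k) * emeasure \<rho> (E k)" using E_mass by (intro mult_left_mono) auto
      also have "emeasure \<rho> (E k) = (\<integral>\<^sup>+ y. indicator (E k) (y 0) \<partial>\<gamma>)"
      proof -
        have "emeasure \<rho> (E k) = (\<integral>\<^sup>+ x. indicator (E k) x \<partial>distr \<gamma> borel (\<lambda>y. y 0))"
          using couplingsD(4)[OF \<gamma>, of 0] E_borel by simp
        also have "\<dots> = (\<integral>\<^sup>+ y. indicator (E k) (y 0) \<partial>\<gamma>)" using E_borel by (intro nn_integral_distr[OF comp]) simp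
        finally show ?thesis .
      qed
      also have "ennreal (2 * 4 ^ k) * (\<integral>\<^sup>+ y. indicator (E k) (y 0) \<partial>\<gamma>) = (\<integral>\<^sup>+ y. ennreal (2 * 4 ^ k) * indicator (E k) (y 0) \<partial>\<gamma>)"
        using E_borel by (intro nn_integral_cmult[symmetric] measurable_compose[OF comp]) simp
      also have "\<dots> \<le> (\<integral>\<^sup>+ y. e2ennreal (cost_n 2 w y) \<partial>\<gamma>)"
      proof (rule nn_integral_mono_AE)
        show "AE y in \<gamma>. ennreal (2 * 4 ^ k) * indicator (E k) (y 0) \<le> e2ennreal (cost_n 2 w y)"
          using AE_coupling[OF \<gamma> pq.AE_in_interval]
        proof eventually_elim
          case (elim y)
          show ?case
          proof (cases "y 0 \<in> E k")
            case True
            then obtain \<theta> where \<theta>: "0 \<le> \<theta>" "\<theta> \<le> \<delta> k" "y 0 = c + e * \<theta>" by (auto simp: E_def)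
            have "y 1 \<in> {p..q}" using elim by simp
            then have "ereal (4 ^ k) \<le> w (y 0) (y 1)" using \<delta>(3)[OF \<theta>(1,2)] \<theta>(3) by (simp add: less_imp_le)
            then have "ereal (4 ^ k) + ereal (4 ^ k) \<le> w (y 0) (y 1) + w (y 1) (y 0)"
              using w_sym[of "y 1" "y 0"] by (intro add_mono) auto
            also have "\<dots> = cost_n 2 w y" by (rule cost_n_2[symmetric])
            finally have "ereal (2 * 4 ^ k) \<le> cost_n 2 w y" by simp
            then have "e2ennreal (ereal (2 * 4 ^ k)) \<le> e2ennreal (cost_n 2 w y)" by (rule e2ennreal_mono)
            then show ?thesis using True by simp
          qed simp
        qed
      qed
      finally show ?thesis .
    qed
    then have "(\<integral>\<^sup>+ y. e2ennreal (cost_n 2 w y) \<partial>\<gamma>) = \<infinity>"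
    proof -
      assume *: "\<And>k. ennreal (2 ^ k) \<le> (\<integral>\<^sup>+ y. e2ennreal (cost_n 2 w y) \<partial>\<gamma>)"
      show ?thesis
      proof (cases "\<integral>\<^sup>+ y. e2ennreal (cost_n 2 w y) \<partial>\<gamma>")
        case (real r)
        obtain k where "r < 2 ^ k" using real_arch_pow[of 2 r] by auto
        then show ?thesis using *[of k] real by (simp add: ennreal_le_iff)
      qed simp
    qed
    then show ?thesis by (simp add: ot_cost_def ereal_integral_def)
  qed
  then have "\<infinity> \<le> F_OT 2 w \<rho>" unfolding F_OT_def by (intro INF_greatest) simp
  then have "F_OT 2 w \<rho> = \<infinity>" by simp
  then show ?thesis using that na by blast
qed

section \<open>Necessity\<close>

text \<open>Near each point there are partners at finite cost. If \<open>y < b\<close>, take such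
  partners \<open>x2\<close> of \<open>x\<close> in \<open>{x..y}\<close> and \<open>x4\<close> of
  \<open>y\<close> in \<open>{y..b}\<close>: the crossing pairs \<open>x, y\<close> and
  \<open>x2, x4\<close> then cost at most two finite terms. If \<open>a < x\<close>, the mirror
  image works.\<close>

lemma well_ordered_finite:
  assumes w_cont: "continuous_on UNIV (\<lambda>z. w (fst z) (snd z))" and w_ge: "\<And>x y. ereal (- C) \<le> w x y" and w_sym: "\<And>x y. w x y = w y x"
    and wo1: "\<And>x1 x2 x3 x4. a \<le> x1 \<Longrightarrow> x1 \<le> x2 \<Longrightarrow> x2 \<le> x3 \<Longrightarrow> x3 \<le> x4 \<Longrightarrow> x4 \<le> b \<Longrightarrow>
        w x1 x3 + w x2 x4 \<le> w x1 x2 + w x3 x4"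
    and fin: "\<And>\<rho>. nonatomic_prob a b \<rho> \<Longrightarrow> F_OT 2 w \<rho> < \<infinity>"
    and xy: "a \<le> x" "x < y" "y \<le> b" "a < x \<or> y < b"
  shows "w x y \<noteq> \<infinity>"
proof
  assume inf: "w x y = \<infinity>"
  have slice: "\<exists>z\<in>{p..q}. w c z \<noteq> \<infinity>" if "a \<le> p" "p < q" "q \<le> b" "c \<in> {p..q}" for p q c
  proof (rule ccontr)
    assume "\<not> (\<exists>z\<in>{p..q}. w c z \<noteq> \<infinity>)"
    then have "\<And>z. z \<in> {p..q} \<Longrightarrow> w c z = \<infinity>" by blast
    from F_OT_infinite[OF w_cont w_sym that this] fin show False by (metis less_irrefl)
  qed
  have not_minf: "w u v \<noteq> - \<infinity>" for u v using w_ge[of u v] by auto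
  have lt: "w u v + w u' v' < \<infinity>" if "w u v \<noteq> \<infinity>" "w u' v' \<noteq> \<infinity>" for u v u' v'
    using that by (simp add: less_top[symmetric])
  have ge: "w u v + w u' v' = \<infinity>" if "w u v = \<infinity> \<or> w u' v' = \<infinity>" for u v u' v'
    using that not_minf[of u v] not_minf[of u' v'] by auto
  from xy(4) show False
  proof
    assume "y < b"
    obtain x2 where x2: "x2 \<in> {x..y}" "w x x2 \<noteq> \<infinity>" using slice[of x y x] xy by auto
    obtain x4 where x4: "x4 \<in> {y..b}" "w y x4 \<noteq> \<infinity>" using slice[of y b y] xy \<open>y < b\<close> by auto
    have "w x y + w x2 x4 \<le> w x x2 + w y x4" using xy x2 x4 by (intro wo1) auto
    then show False using ge[of x y x2 x4] lt[OF x2(2) x4(2)] inf by simp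
  next
    assume "a < x"
    obtain x1 where x1: "x1 \<in> {a..x}" "w x x1 \<noteq> \<infinity>" using slice[of a x x] xy \<open>a < x\<close> by auto
    obtain x3 where x3: "x3 \<in> {x..y}" "w y x3 \<noteq> \<infinity>" using slice[of x y y] xy by auto
    have "w x1 x3 + w x y \<le> w x1 x + w x3 y" using xy x1 x3 by (intro wo1) auto
    then show False using ge[of x1 x3 x y] lt[OF x1(2) x3(2)] inf w_sym[of x1 x] w_sym[of x3 y] by simp
  qed
qed

text \<open>Allows costs to be compared as integrals of nonnegative functions in
  \<open>ennreal\<close>, whether finite or not.\<close>

lemma ereal_integral_shift:
  assumes "prob_space M" and f [measurable]: "f \<in> borel_measurable M" and lb: "\<And>x. x \<in> space M \<Longrightarrow> ereal (- K) \<le> f x" and K: "0 \<le> K"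
  shows "ereal_integral M f = enn2ereal (\<integral>\<^sup>+ x. e2ennreal (f x + ereal K) \<partial>M) - ereal K"
proof (cases "ereal_integral M f = \<infinity>")
  case False
  interpret prob_space M by fact
  have fin: "AE x in M. f x \<noteq> \<infinity>" "integrable M (\<lambda>x. real_of_ereal (f x))"
    using ereal_integral_finite[of M f K] assms(1) f lb False by blast+
  define g where "g x = real_of_ereal (f x)" for x
  have fg: "AE x in M. f x = ereal (g x) \<and> - K \<le> g x"
    using fin(1) AE_space
  proof eventually_elim
    case (elim x)
    then show ?case using lb[of x] by (cases "f x") (auto simp: g_def)
  qed
  have gi: "integrable M g" using fin(2) by (simp add: g_def[abs_def])
  have "ereal_integral M f = ereal (\<integral>x. g x \<partial>M)"
    using fg by (intro ereal_integral_eq_integral[OF gi]) (auto elim: eventually_mono)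
  moreover have "(\<integral>\<^sup>+ x. e2ennreal (f x + ereal K) \<partial>M) = (\<integral>\<^sup>+ x. ennreal (g x + K) \<partial>M)"
    by (rule nn_integral_cong_AE) (use fg in \<open>eventually_elim, simp\<close>)
  moreover have "(\<integral>\<^sup>+ x. ennreal (g x + K) \<partial>M) = ennreal (\<integral>x. g x + K \<partial>M)"
    using gi fg by (intro nn_integral_eq_integral) (auto elim: eventually_mono)
  moreover have "(\<integral>x. g x + K \<partial>M) = (\<integral>x. g x \<partial>M) + K" using gi by (simp add: prob_space)
  moreover have "0 \<le> (\<integral>x. g x + K \<partial>M)" using fg by (intro integral_nonneg_AE) (auto elim: eventually_mono)
  ultimately show ?thesis by (simp add: enn2ereal_ennreal)
next
  case True
  have "(\<integral>\<^sup>+ x. e2ennreal (f x) \<partial>M) = \<infinity>"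
  proof (rule ccontr)
    assume ne: "(\<integral>\<^sup>+ x. e2ennreal (f x) \<partial>M) \<noteq> \<infinity>"
    have "enn2ereal p - enn2ereal q \<noteq> \<infinity>" if "p \<noteq> \<infinity>" for p q :: ennreal
      using that by (cases p; cases q) (auto simp: enn2ereal_ennreal)
    then show False using True ne by (auto simp: ereal_integral_def)
  qed
  moreover have "(\<integral>\<^sup>+ x. e2ennreal (f x) \<partial>M) \<le> (\<integral>\<^sup>+ x. e2ennreal (f x + ereal K) \<partial>M)"
  proof (intro nn_integral_mono e2ennreal_mono)
    fix x
    show "f x \<le> f x + ereal K" using K by (cases "f x") auto
  qed
  ultimately have "(\<integral>\<^sup>+ x. e2ennreal (f x + ereal K) \<partial>M) = \<infinity>" by (simp add: top_unique)
  then show ?thesis using True by simp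
qed

lemma e2ennreal_add: "0 \<le> x \<Longrightarrow> 0 \<le> y \<Longrightarrow> e2ennreal (x + y) = e2ennreal x + e2ennreal y"
  by (cases x; cases y) auto

lemma nn_integral_pmf_of_lessThan_4:
  "(\<integral>\<^sup>+ i. F i \<partial>measure_pmf (pmf_of_set {..<4::nat})) = (F 0 + F 1 + F 2 + F 3) / 4"
  proof -
  have "{..<4::nat} = {0, 1, 2, 3}" by auto
  then show ?thesis by (simp add: nn_integral_pmf_of_set add_ac)
qed

section \<open>The test measure on four short intervals\<close>

locale four_blocks =
  fixes a b h x0 x1 x2 x3 :: real
  assumes order: "0 < h" "a < x0" "x0 + h < x1" "x1 + h < x2" "x2 + h < x3" "x3 + h < b"
begin

definition X :: "nat \<Rightarrow> real" where
  "X i = (if i = 0 then x0 else if i = 1 then x1 else if i = 2 then x2 else x3)"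

lemma X_simps [simp]: "X 0 = x0" "X (Suc 0) = x1" "X 2 = x2" "X 3 = x3"
  by (simp_all add: X_def)

definition \<rho> :: "real measure" where
  "\<rho> = mixture (pmf_of_set {..<4}) borel (\<lambda>i t. X i + h * t)"

lemma nonatomic_\<rho>: "nonatomic_prob a b \<rho>"
  unfolding \<rho>_def
proof (rule nonatomic_mixture)
  show "X i + h * t \<in> {a..b}" if t: "0 < t" "t < 1" for i t
  proof -
    define s where "s = h * t"
    have "0 < s" "s < h" using order t by (auto simp: s_def)
    then have "X i + s \<in> {a..b}" using order by (auto simp: X_def)
    then show ?thesis by (simp add: s_def)
  qed
qed (use order in auto)

definition I :: "(real \<Rightarrow> ennreal) \<Rightarrow> ennreal" where
  "I f = (\<integral>\<^sup>+ t. f (h * t) \<partial>uniform_measure lborel {0..1})"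

lemma I_mono: "(\<And>s. 0 < s \<Longrightarrow> s < h \<Longrightarrow> f s \<le> g s) \<Longrightarrow> I f \<le> I g"
  unfolding I_def
proof (rule nn_integral_mono_AE)
  assume fg: "\<And>s. 0 < s \<Longrightarrow> s < h \<Longrightarrow> f s \<le> g s"
  show "AE t in uniform_measure lborel {0..1}. f (h * t) \<le> g (h * t)"
    using AE_unit[of 0] by eventually_elim (use fg order in auto)
qed

lemma I_cong: "(\<And>s. 0 < s \<Longrightarrow> s < h \<Longrightarrow> f s = g s) \<Longrightarrow> I f = I g"
  using I_mono[of f g] I_mono[of g f] by (simp add: order_antisym)

lemma I_const: "I (\<lambda>_. c) = c"
proof -
  interpret U: prob_space "uniform_measure lborel {0..1::real}" by (rule prob_space_unit)
  show ?thesis using U.emeasure_space_1 by (simp add: I_def)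
qed

lemma I_add:
  assumes [measurable]: "f \<in> borel_measurable borel" "g \<in> borel_measurable borel"
  shows "I (\<lambda>s. f s + g s) = I f + I g"
  unfolding I_def by (rule nn_integral_add) auto

lemma nn_integral_\<rho>:
  assumes "f \<in> borel_measurable borel"
  shows "(\<integral>\<^sup>+ x. f x \<partial>\<rho>) = (I (\<lambda>s. f (x0 + s)) + I (\<lambda>s. f (x1 + s)) + I (\<lambda>s. f (x2 + s)) + I (\<lambda>s. f (x3 + s))) / 4"
  unfolding \<rho>_def I_def by (subst nn_integral_mixture_pmf) (auto simp: nn_integral_pmf_of_lessThan_4 assms)

lemma emeasure_\<rho>:
  assumes "A \<in> sets borel"
  shows "emeasure \<rho> A = (I (\<lambda>s. indicator A (x0 + s)) + I (\<lambda>s. indicator A (x1 + s))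
     + I (\<lambda>s. indicator A (x2 + s)) + I (\<lambda>s. indicator A (x3 + s))) / 4"
proof -
  have "emeasure \<rho> A = (\<integral>\<^sup>+ x. indicator A x \<partial>\<rho>)" using assms by (simp add: \<rho>_def)
  then show ?thesis using nn_integral_\<rho>[of "indicator A"] assms by simp
qed

definition pair :: "real \<Rightarrow> real \<Rightarrow> nat \<Rightarrow> real" where
  "pair x y = (\<lambda>k\<in>{..<2}. if k = 0 then x else y)"

lemma pair_apply [simp]: "pair x y 0 = x" "pair x y (Suc 0) = y"
  by (simp_all add: pair_def)

text \<open>Couples block \<open>i\<close> with block \<open>\<pi> i\<close> at the same offset, so
  that the average over the block is common to all terms and can be taken outside.\<close>

definition pairing :: "(nat \<Rightarrow> nat) \<Rightarrow> (nat \<Rightarrow> real) measure" where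
  "pairing \<pi> = mixture (pmf_of_set {..<4}) (Rn 2) (\<lambda>i t. pair (X i + h * t) (X (\<pi> i) + h * t))"

lemma pairing_measurable: "(\<lambda>t. pair (X i + h * t) (X (\<pi> i) + h * t)) \<in> measurable borel (Rn 2)"
  unfolding pair_def by (rule measurable_restrict) auto

lemma nn_integral_pairing:
  assumes "f \<in> borel_measurable (Rn 2)"
  shows "(\<integral>\<^sup>+ y. f y \<partial>pairing \<pi>) = (I (\<lambda>s. f (pair (x0 + s) (X (\<pi> 0) + s))) + I (\<lambda>s. f (pair (x1 + s) (X (\<pi> 1) + s)))
     + I (\<lambda>s. f (pair (x2 + s) (X (\<pi> 2) + s))) + I (\<lambda>s. f (pair (x3 + s) (X (\<pi> 3) + s)))) / 4"
  unfolding pairing_def I_def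
  by (subst nn_integral_mixture_pmf[OF pairing_measurable assms]) (simp add: nn_integral_pmf_of_lessThan_4)

lemma pairing_coupling:
  assumes \<pi>: "\<pi> permutes {..<4}"
  shows "pairing \<pi> \<in> couplings 2 \<rho>"
proof -
  have "prob_space (pairing \<pi>)" unfolding pairing_def using pairing_measurable by (rule prob_space_mixture)
  moreover have "distr (pairing \<pi>) borel (\<lambda>x. x k) = \<rho>" if k: "k < 2" for k
  proof (rule measure_eqI)
    show "sets (distr (pairing \<pi>) borel (\<lambda>x. x k)) = sets \<rho>" by (simp add: \<rho>_def)
    fix A assume "A \<in> sets (distr (pairing \<pi>) borel (\<lambda>x. x k))"
    then have A: "A \<in> sets borel" by simp
    have c: "(\<lambda>x. x k) \<in> borel_measurable (Rn 2)" using k by (intro measurable_component_singleton) auto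
    have "sets (pairing \<pi>) = sets (Rn 2)" by (simp add: pairing_def)
    from measurable_cong_sets[OF this refl] c have c': "(\<lambda>x. x k) \<in> borel_measurable (pairing \<pi>)" by blast
    define J where "J x = I (\<lambda>s. indicator A (x + s))" for x
    have sum4: "(\<Sum>i<4. J (X (\<sigma> i))) = J (X (\<sigma> 0)) + J (X (\<sigma> 1)) + J (X (\<sigma> 2)) + J (X (\<sigma> 3))" for \<sigma> :: "nat \<Rightarrow> nat"
    proof -
      have "{..<4::nat} = {0, 1, 2, 3}" by auto
      then show ?thesis by (simp add: add_ac)
    qed
    have "emeasure (distr (pairing \<pi>) borel (\<lambda>x. x k)) A = (\<integral>\<^sup>+ y. indicator A (y k) \<partial>pairing \<pi>)"
      using A nn_integral_distr[OF c', of "indicator A"] by simp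
    also have "\<dots> = (if k = 0 then J x0 + J x1 + J x2 + J x3 else J (X (\<pi> 0)) + J (X (\<pi> 1)) + J (X (\<pi> 2)) + J (X (\<pi> 3))) / 4"
      using A k by (subst nn_integral_pairing[OF measurable_compose[OF c]]) (auto simp: J_def less_2_cases_iff)
    also have "\<dots> = (\<Sum>i<4. J (X i)) / 4"
      using sum4[of \<pi>] sum4[of id] sum.reindex_bij_betw[OF permutes_imp_bij[OF \<pi>], of "\<lambda>i. J (X i)"] by simp
    also have "\<dots> = emeasure \<rho> A"
      using A sum4[of id] by (simp add: emeasure_\<rho> J_def)
    finally show "emeasure (distr (pairing \<pi>) borel (\<lambda>x. x k)) A = emeasure \<rho> A" .
  qed
  ultimately show ?thesis by (simp add: couplings_def pairing_def)
qed

text \<open>Exchanges block 0 with block 2 and block 1 with block 3 by translation. The truncations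
  act only off the blocks, where there is no mass; they keep \<open>T\<close> increasing on each
  half and with values in \<open>{a..b}\<close>.\<close>

definition T :: "real \<Rightarrow> real" where
  "T x = (if x < x1 then min (x + (x2 - x0)) x3 else if x < x2 then min (x + (x3 - x1)) b
     else if x < x3 then min (x - (x2 - x0)) x1 else x - (x3 - x1))"

lemma T_measurable [measurable]: "T \<in> borel_measurable borel"
  unfolding T_def by measurable

lemma T_blocks:
  assumes "0 < s" "s < h"
  shows "T (x0 + s) = x2 + s" "T (x1 + s) = x3 + s" "T (x2 + s) = x0 + s" "T (x3 + s) = x1 + s"
  using assms order by (auto simp: T_def)

definition d :: "nat \<Rightarrow> real" where
  "d k = (if k = 0 then a else if k = 1 then x2 else b)"

lemma seidl_plan_blocks: "seidl_plan a b 2 \<rho> (distr \<rho> (Rn 2) (\<lambda>x. \<lambda>i\<in>{..<2}. (T ^^ i) x))"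
  unfolding seidl_plan_def
proof (intro exI[of _ d] exI[of _ T] conjI refl allI impI)
  show "d 0 = a" "d 2 = b" by (simp_all add: d_def)
  show "d i < d (Suc i)" if "i < 2" for i using that order by (auto simp: d_def)
  show "T \<in> borel_measurable borel" by (rule T_measurable)
  show "T ` {a..b} \<subseteq> {a..b}" using order by (auto simp: T_def)
  show "mono_on {d i<..<d (Suc i)} T" if "i < 2" for i
    using that order by (cases "i = 0") (auto simp: d_def T_def intro!: mono_onI)
  have half: "(1 + 1) / 4 = ennreal (1 / 2)"
    using divide_ennreal[of 2 4] by simp
  show "emeasure \<rho> {d i..d (Suc i)} = ennreal (1 / real 2)" if "i < 2" for i
  proof (cases "i = 0")
    case True
    have "I (\<lambda>s. indicator {a..x2} (x0 + s)) = 1" "I (\<lambda>s. indicator {a..x2} (x1 + s)) = 1"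
      by (subst I_const[of 1, symmetric], rule I_cong, use order in \<open>auto simp: indicator_def\<close>)+
    moreover have "I (\<lambda>s. indicator {a..x2} (x2 + s)) = 0" "I (\<lambda>s. indicator {a..x2} (x3 + s)) = 0"
      by (subst I_const[of 0, symmetric], rule I_cong, use order in \<open>auto simp: indicator_def\<close>)+
    ultimately show ?thesis using True half by (simp add: emeasure_\<rho> d_def)
  next
    case False
    have "I (\<lambda>s. indicator {x2..b} (x0 + s)) = 0" "I (\<lambda>s. indicator {x2..b} (x1 + s)) = 0"
      by (subst I_const[of 0, symmetric], rule I_cong, use order in \<open>auto simp: indicator_def\<close>)+
    moreover have "I (\<lambda>s. indicator {x2..b} (x2 + s)) = 1" "I (\<lambda>s. indicator {x2..b} (x3 + s)) = 1"
      by (subst I_const[of 1, symmetric], rule I_cong, use order in \<open>auto simp: indicator_def\<close>)+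
    ultimately show ?thesis using False that half by (simp add: emeasure_\<rho> d_def)
  qed
  have E: "emeasure (density \<rho> (indicator {p..q})) B = emeasure \<rho> ({p..q} \<inter> B)" if "B \<in> sets borel" for p q :: real and B
  proof -
    have s: "B \<in> sets \<rho>" "{p..q} \<in> sets \<rho>" using that by (simp_all add: \<rho>_def)
    then have "emeasure (density \<rho> (indicator {p..q})) B = (\<integral>\<^sup>+ x. indicator {p..q} x * indicator B x \<partial>\<rho>)"
      by (intro emeasure_density) auto
    also have "\<dots> = (\<integral>\<^sup>+ x. indicator ({p..q} \<inter> B) x \<partial>\<rho>)" by (simp add: indicator_inter_arith)
    also have "\<dots> = emeasure \<rho> ({p..q} \<inter> B)" using s by (intro nn_integral_indicator) auto
    finally show ?thesis .
  qed
  have ET: "emeasure (distr (density \<rho> (indicator {p..q})) borel T) B = emeasure \<rho> ({p..q} \<inter> T -` B)"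
    if B: "B \<in> sets borel" for p q :: real and B
  proof -
    have "T -` B \<in> sets borel" using measurable_sets[OF T_measurable B] by simp
    moreover have "sets (density \<rho> (indicator {p..q})) = sets borel" by (simp add: \<rho>_def)
    from measurable_cong_sets[OF this refl] T_measurable have "T \<in> measurable (density \<rho> (indicator {p..q})) borel" by blast
    ultimately show ?thesis using B E[of "T -` B" p q] by (simp add: emeasure_distr \<rho>_def)
  qed
  have T_vimage: "T -` B \<in> sets borel" if "B \<in> sets borel" for B using measurable_sets[OF T_measurable that] by simp
  have 1: "distr (density \<rho> (indicator {a..x2})) borel T = density \<rho> (indicator {x2..b})"
  proof (rule measure_eqI)
    fix B assume "B \<in> sets (distr (density \<rho> (indicator {a..x2})) borel T)"
    then have B: "B \<in> sets borel" by simp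
    have "I (\<lambda>s. indicator ({a..x2} \<inter> T -` B) (x0 + s)) = I (\<lambda>s. indicator ({x2..b} \<inter> B) (x2 + s))"
      by (rule I_cong) (use order T_blocks in \<open>auto simp: indicator_def\<close>)
    moreover have "I (\<lambda>s. indicator ({a..x2} \<inter> T -` B) (x1 + s)) = I (\<lambda>s. indicator ({x2..b} \<inter> B) (x3 + s))"
      by (rule I_cong) (use order T_blocks in \<open>auto simp: indicator_def\<close>)
    moreover have "I (\<lambda>s. indicator ({a..x2} \<inter> T -` B) (x2 + s)) = 0" "I (\<lambda>s. indicator ({a..x2} \<inter> T -` B) (x3 + s)) = 0"
      "I (\<lambda>s. indicator ({x2..b} \<inter> B) (x0 + s)) = 0" "I (\<lambda>s. indicator ({x2..b} \<inter> B) (x1 + s)) = 0"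
      by (subst I_const[of 0, symmetric], rule I_cong, use order in \<open>auto simp: indicator_def\<close>)+
    ultimately show "emeasure (distr (density \<rho> (indicator {a..x2})) borel T) B = emeasure (density \<rho> (indicator {x2..b})) B"
      using B T_vimage[OF B] by (simp add: E ET emeasure_\<rho>)
  qed (simp add: \<rho>_def)
  have 2: "distr (density \<rho> (indicator {x2..b})) borel T = density \<rho> (indicator {a..x2})"
  proof (rule measure_eqI)
    fix B assume "B \<in> sets (distr (density \<rho> (indicator {x2..b})) borel T)"
    then have B: "B \<in> sets borel" by simp
    have "I (\<lambda>s. indicator ({x2..b} \<inter> T -` B) (x2 + s)) = I (\<lambda>s. indicator ({a..x2} \<inter> B) (x0 + s))"
      by (rule I_cong) (use order T_blocks in \<open>auto simp: indicator_def\<close>)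
    moreover have "I (\<lambda>s. indicator ({x2..b} \<inter> T -` B) (x3 + s)) = I (\<lambda>s. indicator ({a..x2} \<inter> B) (x1 + s))"
      by (rule I_cong) (use order T_blocks in \<open>auto simp: indicator_def\<close>)
    moreover have "I (\<lambda>s. indicator ({x2..b} \<inter> T -` B) (x0 + s)) = 0" "I (\<lambda>s. indicator ({x2..b} \<inter> T -` B) (x1 + s)) = 0"
      "I (\<lambda>s. indicator ({a..x2} \<inter> B) (x2 + s)) = 0" "I (\<lambda>s. indicator ({a..x2} \<inter> B) (x3 + s)) = 0"
      by (subst I_const[of 0, symmetric], rule I_cong, use order in \<open>auto simp: indicator_def\<close>)+
    ultimately show "emeasure (distr (density \<rho> (indicator {x2..b})) borel T) B = emeasure (density \<rho> (indicator {a..x2})) B"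
      using B T_vimage[OF B] by (simp add: E ET emeasure_\<rho>)
  qed (simp add: \<rho>_def)
  show "distr (density \<rho> (indicator {d i..d (Suc i)})) borel T = density \<rho> (indicator {d (Suc i)..d (Suc (Suc i))})"
    if "i + 2 \<le> 2" for i using that 1 by (simp add: d_def)
  show "distr (density \<rho> (indicator {d (2 - 1)..d 2})) borel T = density \<rho> (indicator {d 0..d 1})"
    using 2 by (simp add: d_def)
qed

lemma nn_integral_seidl_blocks:
  assumes f: "f \<in> borel_measurable (Rn 2)"
  shows "(\<integral>\<^sup>+ y. f y \<partial>distr \<rho> (Rn 2) (\<lambda>x. \<lambda>i\<in>{..<2}. (T ^^ i) x)) = (\<integral>\<^sup>+ y. f y \<partial>pairing (id(0 := 2, 1 := 3, 2 := 0, 3 := 1)))"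
proof -
  let ?\<tau> = "id(0 := 2, 1 := 3, 2 := 0, 3 := 1 :: nat)"
  let ?orb = "\<lambda>x. \<lambda>i\<in>{..<2::nat}. (T ^^ i) x"
  have Tm: "T ^^ i \<in> borel_measurable borel" for i by (induction i) auto
  have om: "?orb \<in> measurable borel (Rn 2)" by (rule measurable_restrict) (rule Tm)
  then have om': "?orb \<in> measurable \<rho> (Rn 2)" unfolding \<rho>_def by (subst measurable_cong_sets[OF sets_mixture refl])
  have "(\<integral>\<^sup>+ y. f y \<partial>distr \<rho> (Rn 2) ?orb) = (\<integral>\<^sup>+ x. f (?orb x) \<partial>\<rho>)" by (rule nn_integral_distr[OF om']) (simp add: f)
  also have "\<dots> = (I (\<lambda>s. f (?orb (x0 + s))) + I (\<lambda>s. f (?orb (x1 + s))) + I (\<lambda>s. f (?orb (x2 + s))) + I (\<lambda>s. f (?orb (x3 + s)))) / 4"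
    by (rule nn_integral_\<rho>[OF measurable_compose[OF om f]])
  also have "\<dots> = (I (\<lambda>s. f (pair (x0 + s) (X (?\<tau> 0) + s))) + I (\<lambda>s. f (pair (x1 + s) (X (?\<tau> 1) + s)))
     + I (\<lambda>s. f (pair (x2 + s) (X (?\<tau> 2) + s))) + I (\<lambda>s. f (pair (x3 + s) (X (?\<tau> 3) + s)))) / 4"
  proof -
    have orb_pair: "?orb x = pair x (T x)" for x by (auto simp: pair_def fun_eq_iff less_2_cases_iff)
    have "I (\<lambda>s. f (?orb (x0 + s))) = I (\<lambda>s. f (pair (x0 + s) (X (?\<tau> 0) + s)))"
      "I (\<lambda>s. f (?orb (x1 + s))) = I (\<lambda>s. f (pair (x1 + s) (X (?\<tau> 1) + s)))"
      "I (\<lambda>s. f (?orb (x2 + s))) = I (\<lambda>s. f (pair (x2 + s) (X (?\<tau> 2) + s)))"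
      "I (\<lambda>s. f (?orb (x3 + s))) = I (\<lambda>s. f (pair (x3 + s) (X (?\<tau> 3) + s)))"
      unfolding orb_pair by (rule I_cong, simp add: T_blocks)+
    then show ?thesis by simp
  qed
  also have "\<dots> = (\<integral>\<^sup>+ y. f y \<partial>pairing ?\<tau>)" by (rule nn_integral_pairing[OF f, symmetric])
  finally show ?thesis .
qed

definition block_cost :: "(real \<Rightarrow> real \<Rightarrow> ereal) \<Rightarrow> real \<Rightarrow> real \<Rightarrow> real \<Rightarrow> ereal" where
  "block_cost w K x y = w x y + w y x + ereal K"

text \<open>Optimality compares averages over the offset; bounds valid at every offset turn this
  into a comparison of numbers. The shift by \<open>2 * C\<close> makes each block cost nonnegative,
  and \<open>pos\<close> prevents \<open>c2\<close> from being truncated to 0 in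
  \<open>ennreal\<close>.\<close>

lemma pairing_compare:
  fixes w :: "real \<Rightarrow> real \<Rightarrow> ereal"
  assumes w: "(\<lambda>z. w (fst z) (snd z)) \<in> borel_measurable borel" and w_ge: "\<And>x y. ereal (- C) \<le> w x y" and C: "0 \<le> C"
    and opt: "is_OT_minimizer 2 w \<rho> (distr \<rho> (Rn 2) (\<lambda>x. \<lambda>i\<in>{..<2}. (T ^^ i) x))"
    and \<pi>: "\<pi> permutes {..<4}"
    and c1: "\<And>s. 0 < s \<Longrightarrow> s < h \<Longrightarrow> block_cost w (2 * C) (x0 + s) (X (\<pi> 0) + s) + block_cost w (2 * C) (x1 + s) (X (\<pi> 1) + s)
        + block_cost w (2 * C) (x2 + s) (X (\<pi> 2) + s) + block_cost w (2 * C) (x3 + s) (X (\<pi> 3) + s) \<le> ereal c1"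
    and c2: "\<And>s. 0 < s \<Longrightarrow> s < h \<Longrightarrow> ereal c2 \<le> block_cost w (2 * C) (x0 + s) (x2 + s) + block_cost w (2 * C) (x1 + s) (x3 + s)
        + block_cost w (2 * C) (x2 + s) (x0 + s) + block_cost w (2 * C) (x3 + s) (x1 + s)"
    and pos: "0 < c2"
  shows "c2 \<le> c1"
proof -
  let ?S = "distr \<rho> (Rn 2) (\<lambda>x. \<lambda>i\<in>{..<2}. (T ^^ i) x)"
  let ?\<tau> = "id(0 := 2, 1 := 3, 2 := 0, 3 := 1 :: nat)"
  let ?g = "\<lambda>y. e2ennreal (cost_n 2 w y + ereal (2 * C))"
  let ?k = "\<lambda>x y. e2ennreal (block_cost w (2 * C) x y)"
  have cm [measurable]: "cost_n 2 w \<in> borel_measurable (Rn 2)" by (rule measurable_cost_n[OF w])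
  have gm: "?g \<in> borel_measurable (Rn 2)" by measurable
  have lb: "ereal (- (2 * C)) \<le> w x y + w y x" for x y
    using add_mono[OF w_ge[of x y] w_ge[of y x]] by simp
  have shift: "ot_cost 2 w \<gamma> = enn2ereal (\<integral>\<^sup>+ y. ?g y \<partial>\<gamma>) - ereal (2 * C)" if \<gamma>: "\<gamma> \<in> couplings 2 \<rho>" for \<gamma>
    unfolding ot_cost_def
  proof (rule ereal_integral_shift[OF couplingsD(1)[OF \<gamma>]])
    show "cost_n 2 w \<in> borel_measurable \<gamma>" using cm measurable_cong_sets[OF couplingsD(2)[OF \<gamma>] refl] by blast
    show "ereal (- (2 * C)) \<le> cost_n 2 w y" for y unfolding cost_n_2 by (rule lb)
  qed (use C in simp)
  have "ot_cost 2 w ?S \<le> ot_cost 2 w (pairing \<pi>)"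
    using opt pairing_coupling[OF \<pi>] unfolding is_OT_minimizer_def F_OT_def by (auto intro: INF_lower)
  moreover have "?S \<in> couplings 2 \<rho>" using opt by (simp add: is_OT_minimizer_def)
  ultimately have "enn2ereal (\<integral>\<^sup>+ y. ?g y \<partial>?S) - ereal (2 * C) \<le> enn2ereal (\<integral>\<^sup>+ y. ?g y \<partial>pairing \<pi>) - ereal (2 * C)"
    by (simp add: shift pairing_coupling[OF \<pi>])
  then have "enn2ereal (\<integral>\<^sup>+ y. ?g y \<partial>?S) \<le> enn2ereal (\<integral>\<^sup>+ y. ?g y \<partial>pairing \<pi>)"
    by (cases "enn2ereal (\<integral>\<^sup>+ y. ?g y \<partial>?S)"; cases "enn2ereal (\<integral>\<^sup>+ y. ?g y \<partial>pairing \<pi>)") auto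
  then have le: "(\<integral>\<^sup>+ y. ?g y \<partial>pairing ?\<tau>) \<le> (\<integral>\<^sup>+ y. ?g y \<partial>pairing \<pi>)"
    by (simp add: less_eq_ennreal.rep_eq[symmetric] nn_integral_seidl_blocks[OF gm])
  have km: "(\<lambda>s. ?k (x + s) (y + s)) \<in> borel_measurable borel" for x y
  proof -
    have "(\<lambda>s. pair (x + s) (y + s)) \<in> measurable borel (Rn 2)" unfolding pair_def by (rule measurable_restrict) auto
    from measurable_compose[OF this gm] show ?thesis by (simp add: cost_n_2 block_cost_def)
  qed
  have k_nonneg: "0 \<le> block_cost w (2 * C) x y" for x y
    using add_right_mono[OF lb[of x y], of "ereal (2 * C)"] by (simp add: block_cost_def zero_ereal_def)
  have total: "(\<integral>\<^sup>+ y. ?g y \<partial>pairing \<sigma>) = I (\<lambda>s. e2ennreal (block_cost w (2 * C) (x0 + s) (X (\<sigma> 0) + s) + block_cost w (2 * C) (x1 + s) (X (\<sigma> 1) + s)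
        + block_cost w (2 * C) (x2 + s) (X (\<sigma> 2) + s) + block_cost w (2 * C) (x3 + s) (X (\<sigma> 3) + s))) / 4" for \<sigma>
  proof -
    have "(\<integral>\<^sup>+ y. ?g y \<partial>pairing \<sigma>) = (I (\<lambda>s. ?k (x0 + s) (X (\<sigma> 0) + s)) + I (\<lambda>s. ?k (x1 + s) (X (\<sigma> 1) + s))
       + I (\<lambda>s. ?k (x2 + s) (X (\<sigma> 2) + s)) + I (\<lambda>s. ?k (x3 + s) (X (\<sigma> 3) + s))) / 4"
      by (subst nn_integral_pairing[OF gm]) (simp add: cost_n_2 block_cost_def)
    also have "\<dots> = I (\<lambda>s. ?k (x0 + s) (X (\<sigma> 0) + s) + ?k (x1 + s) (X (\<sigma> 1) + s)
       + ?k (x2 + s) (X (\<sigma> 2) + s) + ?k (x3 + s) (X (\<sigma> 3) + s)) / 4"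
      by (simp add: I_add km borel_measurable_add)
    finally show ?thesis by (simp add: e2ennreal_add k_nonneg)
  qed
  have "ennreal c2 = I (\<lambda>_. ennreal c2)" by (simp add: I_const)
  also have "\<dots> \<le> I (\<lambda>s. e2ennreal (block_cost w (2 * C) (x0 + s) (X (?\<tau> 0) + s) + block_cost w (2 * C) (x1 + s) (X (?\<tau> 1) + s)
        + block_cost w (2 * C) (x2 + s) (X (?\<tau> 2) + s) + block_cost w (2 * C) (x3 + s) (X (?\<tau> 3) + s)))"
  proof (rule I_mono)
    fix s assume "0 < s" "s < h"
    from e2ennreal_mono[OF c2[OF this]]
    show "ennreal c2 \<le> e2ennreal (block_cost w (2 * C) (x0 + s) (X (?\<tau> 0) + s) + block_cost w (2 * C) (x1 + s) (X (?\<tau> 1) + s)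
        + block_cost w (2 * C) (x2 + s) (X (?\<tau> 2) + s) + block_cost w (2 * C) (x3 + s) (X (?\<tau> 3) + s))" by simp
  qed
  also have "\<dots> \<le> I (\<lambda>s. e2ennreal (block_cost w (2 * C) (x0 + s) (X (\<pi> 0) + s) + block_cost w (2 * C) (x1 + s) (X (\<pi> 1) + s)
        + block_cost w (2 * C) (x2 + s) (X (\<pi> 2) + s) + block_cost w (2 * C) (x3 + s) (X (\<pi> 3) + s)))"
  proof -
    have "x \<le> y" if "x / 4 \<le> y / 4" for x y :: ennreal
      using that ennreal_mult_le_mult_iff[of "inverse 4" x y] by (simp add: divide_ennreal_def mult.commute)
    then show ?thesis using le unfolding total .
  qed
  also have "\<dots> \<le> I (\<lambda>_. ennreal c1)"
  proof (rule I_mono)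
    fix s assume "0 < s" "s < h"
    from e2ennreal_mono[OF c1[OF this]]
    show "e2ennreal (block_cost w (2 * C) (x0 + s) (X (\<pi> 0) + s) + block_cost w (2 * C) (x1 + s) (X (\<pi> 1) + s)
        + block_cost w (2 * C) (x2 + s) (X (\<pi> 2) + s) + block_cost w (2 * C) (x3 + s) (X (\<pi> 3) + s)) \<le> ennreal c1" by simp
  qed
  also have "\<dots> = ennreal c1" by (rule I_const)
  finally show ?thesis using pos by (simp add: ennreal_le_iff2)
qed

end

text \<open>A strict violation leaves room for two reals in between and, by continuity, persists
  when all four points move by a small common offset. Blocks shorter than this offset then
  contradict the optimality of the Seidl plan.\<close>

lemma seidl_optimal_imp_four_point:
  assumes w_cont: "continuous_on UNIV (\<lambda>z. w (fst z) (snd z))" and w_ge: "\<And>x y. ereal (- C) \<le> w x y" and C: "0 \<le> C"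
    and w_sym: "\<And>x y. w x y = w y x"
    and opt: "\<And>\<rho> \<gamma>. nonatomic_prob a b \<rho> \<Longrightarrow> seidl_plan a b 2 \<rho> \<gamma> \<Longrightarrow> is_OT_minimizer 2 w \<rho> \<gamma>"
    and x: "a < x0" "x0 < x1" "x1 < x2" "x2 < x3" "x3 < b"
  shows "w x0 x2 + w x1 x3 \<le> w x0 x1 + w x2 x3" "w x0 x2 + w x1 x3 \<le> w x0 x3 + w x1 x2"
proof -
  have not_minf: "w u v \<noteq> - \<infinity>" for u v using w_ge[of u v] by auto
  have lim: "((\<lambda>s. w (u + s) (v + s) + w (u' + s) (v' + s)) \<longlongrightarrow> w u v + w u' v') (at_right 0)" for u v u' v'
  proof -
    have "((\<lambda>s. w (u + s) (v + s)) \<longlongrightarrow> w u v) (at_right 0)" for u v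
    proof -
      have "((\<lambda>s. (u + s, v + s)) \<longlongrightarrow> (u + 0, v + 0)) (at_right 0)" by (intro tendsto_intros)
      from continuous_on_tendsto_compose[OF w_cont this] show ?thesis by simp
    qed
    then show ?thesis using not_minf by (intro tendsto_add_ereal_nonneg) auto
  qed
  have main: "w x0 x2 + w x1 x3 \<le> w p0 p1 + w q0 q1"
    if \<pi>: "\<pi> permutes {..<4::nat}"
      and cost: "\<And>s h. four_blocks a b h x0 x1 x2 x3 \<Longrightarrow>
         four_blocks.block_cost w (2 * C) (x0 + s) (four_blocks.X x0 x1 x2 x3 (\<pi> 0) + s)
         + four_blocks.block_cost w (2 * C) (x1 + s) (four_blocks.X x0 x1 x2 x3 (\<pi> 1) + s)
         + four_blocks.block_cost w (2 * C) (x2 + s) (four_blocks.X x0 x1 x2 x3 (\<pi> 2) + s)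
         + four_blocks.block_cost w (2 * C) (x3 + s) (four_blocks.X x0 x1 x2 x3 (\<pi> 3) + s)
         = (let P = w (p0 + s) (p1 + s); Q = w (q0 + s) (q1 + s) in
            (P + P + ereal (2 * C)) + (P + P + ereal (2 * C)) + (Q + Q + ereal (2 * C)) + (Q + Q + ereal (2 * C)))"
    for \<pi> p0 p1 q0 q1
  proof (rule ccontr)
    assume "\<not> w x0 x2 + w x1 x3 \<le> w p0 p1 + w q0 q1"
    then have "w p0 p1 + w q0 q1 < w x0 x2 + w x1 x3" by simp
    then obtain c1 where c1: "w p0 p1 + w q0 q1 < ereal c1" "ereal c1 < w x0 x2 + w x1 x3" using ereal_dense2 by blast
    obtain c2 where c2: "ereal c1 < ereal c2" "ereal c2 < w x0 x2 + w x1 x3" using ereal_dense2[OF c1(2)] by blast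
    have "ereal (- C) + ereal (- C) \<le> w p0 p1 + w q0 q1" using w_ge by (intro add_mono)
    from order_le_less_trans[OF this c1(1)] have pos: "- (2 * C) < c1" by simp
    have "eventually (\<lambda>s. w (p0 + s) (p1 + s) + w (q0 + s) (q1 + s) < ereal c1) (at_right 0)"
      using order_tendstoD(2)[OF lim c1(1)] .
    moreover have "eventually (\<lambda>s. ereal c2 < w (x0 + s) (x2 + s) + w (x1 + s) (x3 + s)) (at_right 0)"
      using order_tendstoD(1)[OF lim c2(2)] .
    ultimately have "eventually (\<lambda>s. w (p0 + s) (p1 + s) + w (q0 + s) (q1 + s) < ereal c1 \<and>
        ereal c2 < w (x0 + s) (x2 + s) + w (x1 + s) (x3 + s)) (at_right 0)"
      by (rule eventually_conj)
    then obtain \<eta> where \<eta>: "\<eta> > 0" "\<And>s. 0 < s \<Longrightarrow> s < \<eta> \<Longrightarrow> w (p0 + s) (p1 + s) + w (q0 + s) (q1 + s) < ereal c1 \<and>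
        ereal c2 < w (x0 + s) (x2 + s) + w (x1 + s) (x3 + s)"
      unfolding eventually_at_right_field by blast
    define h where "h = min \<eta> (min (x1 - x0) (min (x2 - x1) (min (x3 - x2) (b - x3)))) / 2"
    have h: "0 < h" "h < \<eta>" "h < x1 - x0" "h < x2 - x1" "h < x3 - x2" "h < b - x3"
      using \<eta>(1) x by (auto simp: h_def min_def)
    interpret four_blocks a b h x0 x1 x2 x3 using h x by unfold_locales auto
    \<comment> \<open>Each of the two pairs is met from both of its blocks, each time in both
      orders: four times \<open>P + Q\<close>, and four shifts by \<open>2 * C\<close>.\<close>
    have up: "(P + P + ereal (2 * C)) + (P + P + ereal (2 * C)) + (Q + Q + ereal (2 * C)) + (Q + Q + ereal (2 * C)) \<le> ereal (4 * c1 + 8 * C)"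
      if "P + Q < ereal c1" "P \<noteq> - \<infinity>" "Q \<noteq> - \<infinity>" for P Q using that by (cases P; cases Q) auto
    have lo: "ereal (4 * c2 + 8 * C) \<le> (P + P + ereal (2 * C)) + (Q + Q + ereal (2 * C)) + (P + P + ereal (2 * C)) + (Q + Q + ereal (2 * C))"
      if "ereal c2 < P + Q" "P \<noteq> - \<infinity>" "Q \<noteq> - \<infinity>" for P Q using that by (cases P; cases Q) auto
    have "4 * c2 + 8 * C \<le> 4 * c1 + 8 * C"
    proof (rule pairing_compare[OF borel_measurable_continuous_onI[OF w_cont] w_ge C opt[OF nonatomic_\<rho> seidl_plan_blocks] \<pi>])
      fix s assume s: "0 < s" "s < h"
      show "block_cost w (2 * C) (x0 + s) (X (\<pi> 0) + s) + block_cost w (2 * C) (x1 + s) (X (\<pi> 1) + s)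
        + block_cost w (2 * C) (x2 + s) (X (\<pi> 2) + s) + block_cost w (2 * C) (x3 + s) (X (\<pi> 3) + s) \<le> ereal (4 * c1 + 8 * C)"
        unfolding cost[OF four_blocks_axioms] Let_def using \<eta>(2)[of s] s h by (intro up not_minf) auto
      show "ereal (4 * c2 + 8 * C) \<le> block_cost w (2 * C) (x0 + s) (x2 + s) + block_cost w (2 * C) (x1 + s) (x3 + s)
        + block_cost w (2 * C) (x2 + s) (x0 + s) + block_cost w (2 * C) (x3 + s) (x1 + s)"
        using lo[of "w (x0 + s) (x2 + s)" "w (x1 + s) (x3 + s)"] \<eta>(2)[of s] s h not_minf
        by (simp add: block_cost_def w_sym[of "x2 + s" "x0 + s"] w_sym[of "x3 + s" "x1 + s"])
    next
      show "0 < 4 * c2 + 8 * C" using pos c2(1) by simp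
    qed
    then show False using c2(1) by simp
  qed
  \<comment> \<open>The neighbouring and the nested pairing, as involutions of the blocks.\<close>
  have p1: "id(0 := 1, 1 := 0, 2 := 3, 3 := 2) permutes {..<4::nat}" and p2: "id(0 := 3, 1 := 2, 2 := 1, 3 := 0) permutes {..<4::nat}"
    by (auto intro!: permutes_lessThan_4I simp: bij_betw_def inj_on_def)
  show "w x0 x2 + w x1 x3 \<le> w x0 x1 + w x2 x3"
  proof (rule main[OF p1])
    fix s h assume "four_blocks a b h x0 x1 x2 x3"
    then interpret four_blocks a b h x0 x1 x2 x3 .
    let ?\<pi> = "id(0 := 1, 1 := 0, 2 := 3, 3 := 2 :: nat)"
    show "block_cost w (2 * C) (x0 + s) (X (?\<pi> 0) + s) + block_cost w (2 * C) (x1 + s) (X (?\<pi> 1) + s)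
         + block_cost w (2 * C) (x2 + s) (X (?\<pi> 2) + s) + block_cost w (2 * C) (x3 + s) (X (?\<pi> 3) + s)
         = (let P = w (x0 + s) (x1 + s); Q = w (x2 + s) (x3 + s) in
            (P + P + ereal (2 * C)) + (P + P + ereal (2 * C)) + (Q + Q + ereal (2 * C)) + (Q + Q + ereal (2 * C)))"
      by (simp add: block_cost_def Let_def w_sym[of "x1 + s" "x0 + s"] w_sym[of "x3 + s" "x2 + s"])
  qed
  show "w x0 x2 + w x1 x3 \<le> w x0 x3 + w x1 x2"
  proof (rule main[OF p2])
    fix s h assume "four_blocks a b h x0 x1 x2 x3"
    then interpret four_blocks a b h x0 x1 x2 x3 .
    let ?\<pi> = "id(0 := 3, 1 := 2, 2 := 1, 3 := 0 :: nat)"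
    show "block_cost w (2 * C) (x0 + s) (X (?\<pi> 0) + s) + block_cost w (2 * C) (x1 + s) (X (?\<pi> 1) + s)
         + block_cost w (2 * C) (x2 + s) (X (?\<pi> 2) + s) + block_cost w (2 * C) (x3 + s) (X (?\<pi> 3) + s)
         = (let P = w (x0 + s) (x3 + s); Q = w (x1 + s) (x2 + s) in
            (P + P + ereal (2 * C)) + (P + P + ereal (2 * C)) + (Q + Q + ereal (2 * C)) + (Q + Q + ereal (2 * C)))"
    proof -
      have ac: "(P + P + K) + (Q + Q + K) + (Q + Q + K) + (P + P + K) = (P + P + K) + (P + P + K) + (Q + Q + K) + (Q + Q + K)"
        for P Q K :: ereal by (simp only: ac_simps)
      have v: "X (?\<pi> 0) = x3" "X (?\<pi> 1) = x2" "X (?\<pi> 2) = x1" "X (?\<pi> 3) = x0" by simp_all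
      show ?thesis
        unfolding v block_cost_def Let_def w_sym[of "x3 + s" "x0 + s"] w_sym[of "x2 + s" "x1 + s"] by (rule ac)
    qed
  qed
qed

text \<open>Coinciding points and points at the ends are reached as limits of strictly ordered
  interior points.\<close>

lemma four_point_closure:
  fixes w :: "real \<Rightarrow> real \<Rightarrow> ereal"
  assumes w_cont: "continuous_on UNIV (\<lambda>z. w (fst z) (snd z))" and not_minf: "\<And>x y. w x y \<noteq> - \<infinity>"
    and le: "\<And>x0 x1 x2 x3. a < x0 \<Longrightarrow> x0 < x1 \<Longrightarrow> x1 < x2 \<Longrightarrow> x2 < x3 \<Longrightarrow> x3 < b \<Longrightarrow>
      w x0 x2 + w x1 x3 \<le> w x0 x1 + w x2 x3 \<and> w x0 x2 + w x1 x3 \<le> w x0 x3 + w x1 x2"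
    and x: "a \<le> x0" "x0 \<le> x1" "x1 \<le> x2" "x2 \<le> x3" "x3 \<le> b"
  shows "w x0 x2 + w x1 x3 \<le> w x0 x1 + w x2 x3 \<and> w x0 x2 + w x1 x3 \<le> w x0 x3 + w x1 x2"
proof (cases "a = b")
  case True
  then have "x0 = x3" "x1 = x3" "x2 = x3" using x by auto
  then show ?thesis by simp
next
  case False
  then have ab: "a < b" using x by linarith
  \<comment> \<open>Each point \<open>u\<close> is moved by the fraction \<open>1 / (N + 1)\<close>
    of the way to one of the equally spaced \<open>m k\<close>: a convex combination of a weakly and
    a strictly increasing sequence is strictly increasing.\<close>
  define m where "m k = a + (b - a) * real k / 5" for k :: nat
  define z where "z u k N = u + (m k - u) / (real N + 1)" for u :: real and k N :: nat
  have z_lim: "(\<lambda>N. z u k N) \<longlonglongrightarrow> u" for u k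
  proof -
    have "(\<lambda>N. (m k - u) * inverse (real (Suc N))) \<longlonglongrightarrow> (m k - u) * 0"
      by (intro tendsto_intros LIMSEQ_inverse_real_of_nat)
    then have "(\<lambda>N. u + (m k - u) / (real N + 1)) \<longlonglongrightarrow> u + 0"
      by (intro tendsto_add tendsto_const) (simp add: divide_inverse add.commute)
    then show ?thesis by (simp add: z_def)
  qed
  have z_conv: "z u k N = (real N * u + m k) / (real N + 1)" for u k N
    by (simp add: z_def field_simps)
  have z_less: "z u j N < z v k N" if "u \<le> v" "j < k" for u v j k N
  proof -
    have "m j < m k" using that ab by (simp add: m_def divide_less_cancel)
    moreover have "real N * u \<le> real N * v" using that by (intro mult_left_mono) auto
    ultimately show ?thesis unfolding z_conv by (intro divide_strict_right_mono) auto
  qed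
  \<comment> \<open>With \<open>m 0 = a\<close> and \<open>m 5 = b\<close> the ends stay fixed, so
    the same comparison also yields the strict bounds \<open>a <\<close> and \<open>< b\<close>;
    hence fifths for four points.\<close>
  have za: "z a 0 N = a" and zb: "z b 5 N = b" for N by (simp_all add: z_def m_def diff_divide_distrib)
  have lim: "(\<lambda>N. w (z u i N) (z v j N) + w (z u' i' N) (z v' j' N)) \<longlonglongrightarrow> w u v + w u' v'" for u v u' v' i j i' j'
  proof -
    have "(\<lambda>N. w (z u i N) (z v j N)) \<longlonglongrightarrow> w u v" for u v i j
      using continuous_on_tendsto_compose[OF w_cont tendsto_Pair[OF z_lim z_lim], of u v i j] by simp
    then show ?thesis using not_minf by (intro tendsto_add_ereal_nonneg) auto
  qed
  have le': "w (z x0 1 N) (z x2 3 N) + w (z x1 2 N) (z x3 4 N) \<le> w (z x0 1 N) (z x1 2 N) + w (z x2 3 N) (z x3 4 N) \<and>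
     w (z x0 1 N) (z x2 3 N) + w (z x1 2 N) (z x3 4 N) \<le> w (z x0 1 N) (z x3 4 N) + w (z x1 2 N) (z x2 3 N)" for N
    using z_less[OF x(1), of 0 1 N] z_less[OF x(5), of 4 5 N] unfolding za zb
    by (intro le z_less x) auto
  show ?thesis
    using LIMSEQ_le[OF lim lim] le' by blast
qed

section \<open>Reduction to costs on the whole plane, and conclusion\<close>

lemma ot_cost_cong:
  assumes \<gamma>: "\<gamma> \<in> couplings n \<rho>" and \<rho>: "nonatomic_prob a b \<rho>"
    and eq: "\<And>x y. x \<in> {a..b} \<Longrightarrow> y \<in> {a..b} \<Longrightarrow> w' x y = w x y"
  shows "ot_cost n w' \<gamma> = ot_cost n w \<gamma>"
proof -
  interpret nonatomic a b \<rho> using \<rho> by unfold_locales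
  have AE: "AE y in \<gamma>. cost_n n w' y = cost_n n w y"
    using AE_coupling[OF \<gamma> AE_in_interval] by eventually_elim (auto simp: cost_n_def eq intro!: sum.cong)
  have "(\<integral>\<^sup>+ y. e2ennreal (cost_n n w' y) \<partial>\<gamma>) = (\<integral>\<^sup>+ y. e2ennreal (cost_n n w y) \<partial>\<gamma>)"
    by (rule nn_integral_cong_AE) (use AE in \<open>auto elim: eventually_mono\<close>)
  moreover have "(\<integral>\<^sup>+ y. e2ennreal (- cost_n n w' y) \<partial>\<gamma>) = (\<integral>\<^sup>+ y. e2ennreal (- cost_n n w y) \<partial>\<gamma>)"
    by (rule nn_integral_cong_AE) (use AE in \<open>auto elim: eventually_mono\<close>)
  ultimately show ?thesis by (simp add: ot_cost_def ereal_integral_def)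
qed

text \<open>Composing with the projection onto \<open>{a..b}\<close> gives a cost continuous and
  symmetric on the plane, hence globally measurable; the lower bound is its minimum on the compact
  square.\<close>

lemma clamp_extension:
  fixes w :: "real \<Rightarrow> real \<Rightarrow> ereal"
  assumes ab: "a \<le> b"
    and w_cont: "continuous_on ({a..b} \<times> {a..b}) (\<lambda>(x, y). w x y)"
    and w_sym: "\<forall>x\<in>{a..b}. \<forall>y\<in>{a..b}. w x y = w y x"
    and w_val: "\<forall>x\<in>{a..b}. \<forall>y\<in>{a..b}. w x y \<noteq> -\<infinity>"
  obtains w' C where "continuous_on UNIV (\<lambda>z. w' (fst z) (snd z))" "\<And>x y. w' x y = w' y x" "0 \<le> C"
    "\<And>x y. ereal (- C) \<le> w' x y" "\<And>x y. x \<in> {a..b} \<Longrightarrow> y \<in> {a..b} \<Longrightarrow> w' x y = w x y"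
proof -
  define cl where "cl x = max a (min b x)" for x
  have cl: "cl x \<in> {a..b}" for x using ab by (auto simp: cl_def)
  define w' where "w' x y = w (cl x) (cl y)" for x y
  have "continuous_on UNIV (\<lambda>z::real \<times> real. (cl (fst z), cl (snd z)))"
    unfolding cl_def by (intro continuous_intros)
  from continuous_on_compose2[OF w_cont this] cl
  have 1: "continuous_on UNIV (\<lambda>z. w' (fst z) (snd z))" unfolding w'_def by fastforce
  have "compact ({a..b} \<times> {a..b})" "{a..b} \<times> {a..b} \<noteq> {}" using ab by (auto intro: compact_Times)
  from continuous_attains_inf[OF this w_cont] obtain p q where
    pq: "p \<in> {a..b}" "q \<in> {a..b}" "\<And>x y. x \<in> {a..b} \<Longrightarrow> y \<in> {a..b} \<Longrightarrow> w p q \<le> w x y"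
    by auto
  define C where "C = max 0 (- real_of_ereal (w p q))"
  have "ereal (- C) \<le> w p q"
    using w_val pq(1,2) by (cases "w p q") (auto simp: C_def)
  then have "ereal (- C) \<le> w' x y" for x y
    using pq(3)[OF cl cl, of x y] unfolding w'_def by (rule order_trans)
  moreover have "w' x y = w' y x" for x y using w_sym cl by (simp add: w'_def)
  moreover have "w' x y = w x y" if "x \<in> {a..b}" "y \<in> {a..b}" for x y using that by (simp add: w'_def cl_def)
  moreover have "0 \<le> C" by (simp add: C_def)
  ultimately show ?thesis using that 1 by blast
qed

theorem theorem2p2:
  fixes a b :: real and w :: "real \<Rightarrow> real \<Rightarrow> ereal"
  assumes ab: "a \<le> b"
    and w_cont: "continuous_on ({a..b} \<times> {a..b}) (\<lambda>(x, y). w x y)"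
    and w_sym: "\<forall>x\<in>{a..b}. \<forall>y\<in>{a..b}. w x y = w y x"
    and w_val: "\<forall>x\<in>{a..b}. \<forall>y\<in>{a..b}. w x y \<noteq> -\<infinity>"
    and finite_OT: "\<forall>n\<ge>1. \<forall>\<rho>. nonatomic_prob a b \<rho> \<longrightarrow> F_OT n w \<rho> < \<infinity>"
  shows "((\<forall>n\<ge>1. \<forall>\<rho>. nonatomic_prob a b \<rho> \<longrightarrow>
             (\<forall>\<gamma>. seidl_plan a b n \<rho> \<gamma> \<longrightarrow> is_OT_minimizer n w \<rho> \<gamma>))
          \<longleftrightarrow> well_ordering {a..b} w)
       \<and> (strictly_well_ordering {a..b} w \<longrightarrow>
          (\<forall>n\<ge>1. \<forall>\<rho>. nonatomic_prob a b \<rho> \<longrightarrow>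
             (\<forall>\<gamma>. seidl_plan a b n \<rho> \<gamma> \<longrightarrow>
                symmetrization n \<gamma> \<in> couplings n \<rho> \<and>
                symmetric_measure n (symmetrization n \<gamma>) \<and>
                (\<forall>\<gamma>'. \<gamma>' \<in> couplings n \<rho> \<and> symmetric_measure n \<gamma>' \<longrightarrow>
                   (is_OT_minimizer n w \<rho> \<gamma>' \<longleftrightarrow> \<gamma>' = symmetrization n \<gamma>)))))"
proof -
  obtain w' C where w': "continuous_on UNIV (\<lambda>z. w' (fst z) (snd z))" "\<And>x y. w' x y = w' y x" "0 \<le> C"
    "\<And>x y. ereal (- C) \<le> w' x y" and eq: "\<And>x y. x \<in> {a..b} \<Longrightarrow> y \<in> {a..b} \<Longrightarrow> w' x y = w x y"
    using clamp_extension[OF ab w_cont w_sym w_val] by blast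
  have cost: "ot_cost n w' \<gamma> = ot_cost n w \<gamma>" if "nonatomic_prob a b \<rho>" "\<gamma> \<in> couplings n \<rho>" for n \<rho> \<gamma>
    using ot_cost_cong[OF that(2,1) eq] .
  have F: "F_OT n w' \<rho> = F_OT n w \<rho>" if "nonatomic_prob a b \<rho>" for n \<rho>
    unfolding F_OT_def using cost[OF that] by (intro INF_cong) auto
  have mini: "is_OT_minimizer n w' \<rho> \<gamma> \<longleftrightarrow> is_OT_minimizer n w \<rho> \<gamma>" if "nonatomic_prob a b \<rho>" for n \<rho> \<gamma>
    using cost[OF that] F[OF that] by (auto simp: is_OT_minimizer_def)
  have sc: "seidl_cost a b \<rho> n d T w' C"
    if wo: "well_ordering {a..b} w" and "seidl a b \<rho> n d T" for \<rho> n d T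
  proof -
    interpret seidl a b \<rho> n d T by fact
    have wo1: "w' x1 x3 + w' x2 x4 \<le> w' x1 x2 + w' x3 x4" "w' x1 x3 + w' x2 x4 \<le> w' x1 x4 + w' x2 x3"
      if "a \<le> x1" "x1 \<le> x2" "x2 \<le> x3" "x3 \<le> x4" "x4 \<le> b" for x1 x2 x3 x4
      using well_orderingD[OF wo, of x1 x2 x3 x4] that eq by simp_all
    show ?thesis
    proof (unfold_locales)
      show "w' x y \<noteq> \<infinity>" if "a \<le> x" "x < y" "y \<le> b" "a < x \<or> y < b" for x y
        using finite_OT F by (intro well_ordered_finite[OF w'(1,4,2) wo1(1) _ that]) auto
    qed (use a_less_b w' wo1 in auto)
  qed
  have suff: "is_OT_minimizer n w \<rho> \<gamma>"
    if wo: "well_ordering {a..b} w" and n: "1 \<le> n" and \<rho>: "nonatomic_prob a b \<rho>" and \<gamma>: "seidl_plan a b n \<rho> \<gamma>" for n \<rho> \<gamma>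
  proof -
    obtain d T where S: "seidl a b \<rho> n d T" and \<gamma>_eq: "\<gamma> = distr \<rho> (Rn n) (seidl.orb n T)"
      using seidl_planE[OF \<gamma> \<rho> n] .
    interpret seidl_cost a b \<rho> n d T w' C by (rule sc[OF wo S])
    show ?thesis using orb_optimal mini[OF \<rho>] \<gamma>_eq by simp
  qed
  have nec: "well_ordering {a..b} w"
    if opt: "\<forall>n\<ge>1. \<forall>\<rho>. nonatomic_prob a b \<rho> \<longrightarrow> (\<forall>\<gamma>. seidl_plan a b n \<rho> \<gamma> \<longrightarrow> is_OT_minimizer n w \<rho> \<gamma>)"
  proof -
    have opt': "is_OT_minimizer 2 w' \<rho> \<gamma>" if "nonatomic_prob a b \<rho>" "seidl_plan a b 2 \<rho> \<gamma>" for \<rho> \<gamma>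
      using opt that mini[OF that(1)] by auto
    have ineq: "w' x0 x2 + w' x1 x3 \<le> w' x0 x1 + w' x2 x3 \<and> w' x0 x2 + w' x1 x3 \<le> w' x0 x3 + w' x1 x2"
      if "a \<le> x0" "x0 \<le> x1" "x1 \<le> x2" "x2 \<le> x3" "x3 \<le> b" for x0 x1 x2 x3
    proof (rule four_point_closure[OF w'(1) _ _ that])
      show "w' x y \<noteq> - \<infinity>" for x y using w'(4)[of x y] by auto
      show "w' x0 x2 + w' x1 x3 \<le> w' x0 x1 + w' x2 x3 \<and> w' x0 x2 + w' x1 x3 \<le> w' x0 x3 + w' x1 x2"
        if "a < x0" "x0 < x1" "x1 < x2" "x2 < x3" "x3 < b" for x0 x1 x2 x3
        using seidl_optimal_imp_four_point[OF w'(1,4,3,2) opt' that] by blast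
    qed
    show ?thesis
    proof (rule well_orderingI[OF w_cont w_sym])
      fix x1 x2 x3 x4 assume "x1 \<in> {a..b}" "x2 \<in> {a..b}" "x3 \<in> {a..b}" "x4 \<in> {a..b}" "x1 \<le> x2" "x2 \<le> x3" "x3 \<le> x4"
      then show "w x1 x3 + w x2 x4 \<le> w x1 x2 + w x3 x4" "w x1 x3 + w x2 x4 \<le> w x1 x4 + w x2 x3"
        using ineq[of x1 x2 x3 x4] eq by simp_all
    qed
  qed
  have uniq: "symmetrization n \<gamma> \<in> couplings n \<rho> \<and> symmetric_measure n (symmetrization n \<gamma>) \<and>
      (\<forall>\<gamma>'. \<gamma>' \<in> couplings n \<rho> \<and> symmetric_measure n \<gamma>' \<longrightarrow> (is_OT_minimizer n w \<rho> \<gamma>' \<longleftrightarrow> \<gamma>' = symmetrization n \<gamma>))"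
    if swo: "strictly_well_ordering {a..b} w" and n: "1 \<le> n" and \<rho>: "nonatomic_prob a b \<rho>" and \<gamma>: "seidl_plan a b n \<rho> \<gamma>" for n \<rho> \<gamma>
  proof -
    have wo: "well_ordering {a..b} w" using swo by (simp add: strictly_well_ordering_def)
    obtain d T where S: "seidl a b \<rho> n d T" and \<gamma>_eq: "\<gamma> = distr \<rho> (Rn n) (seidl.orb n T)"
      using seidl_planE[OF \<gamma> \<rho> n] .
    interpret seidl_cost a b \<rho> n d T w' C by (rule sc[OF wo S])
    interpret strict_seidl_cost a b \<rho> n d T w' C
    proof
      fix x1 x2 x3 x4 assume "a \<le> x1" "x1 < x2" "x2 \<le> x3" "x3 < x4" "x4 \<le> b" "w' x1 x3 + w' x2 x4 \<noteq> \<infinity>"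
      then show "w' x1 x3 + w' x2 x4 < w' x1 x4 + w' x2 x3"
        using strictly_well_orderingD[OF swo, of x1 x2 x3 x4] eq by simp
    qed
    have min\<gamma>: "is_OT_minimizer n w' \<rho> \<gamma>" using orb_optimal \<gamma>_eq by simp
    have c\<gamma>: "\<gamma> \<in> couplings n \<rho>" using min\<gamma> by (simp add: is_OT_minimizer_def)
    have \<rho>_sets: "sets \<rho> = sets borel" using \<rho> by (simp add: nonatomic_prob_def)
    note pr = couplingsD(1,2)[OF c\<gamma>]
    have csym: "symmetrization n \<gamma> \<in> couplings n \<rho>" by (rule symmetrization_coupling[OF c\<gamma> \<rho>_sets])
    \<comment> \<open>Equality of costs carries information about a minimizer only if the common
      value is finite.\<close>
    have fin: "F_OT n w' \<rho> \<noteq> \<infinity>" using finite_OT n \<rho> F[OF \<rho>] by (metis less_irrefl)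
    have "is_OT_minimizer n w' \<rho> \<gamma>' \<longleftrightarrow> \<gamma>' = symmetrization n \<gamma>"
      if \<gamma>': "\<gamma>' \<in> couplings n \<rho>" "symmetric_measure n \<gamma>'" for \<gamma>'
    proof
      assume "is_OT_minimizer n w' \<rho> \<gamma>'"
      then have "ot_cost n w' \<gamma>' = ot_cost n w' (distr \<rho> (Rn n) orb)" "ot_cost n w' \<gamma>' \<noteq> \<infinity>"
        using min\<gamma> fin \<gamma>_eq by (simp_all add: is_OT_minimizer_def)
      from symmetric_minimizer_unique[OF \<gamma>' this] show "\<gamma>' = symmetrization n \<gamma>" using \<gamma>_eq by simp
    next
      assume "\<gamma>' = symmetrization n \<gamma>"
      then show "is_OT_minimizer n w' \<rho> \<gamma>'"
        using min\<gamma> csym ot_cost_symmetrization[OF pr w_measurable] by (simp add: is_OT_minimizer_def)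
    qed
    then show ?thesis using csym symmetric_symmetrization[OF pr] mini[OF \<rho>] by blast
  qed
  show ?thesis using suff nec uniq by blast
qed

end
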